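(* Let $M_8$ be an $8$-manifold with an $SU(4)$-structure $(J,\Omega)$ of conformal factor $1$ which, together with the metric, real functions $A,\phi,\vartheta,\alpha$, NSNS flux $H$ and RR flux $F$, satisfies the complex supersymmetric system. Then $$\Omega_B=e^{-\phi+2A+i\vartheta}\,\Omega,\qquad J_B=e^{\frac23(-\phi+A)}J,\qquad K_B=e^{\frac23(\phi+2A)},$$ with $\rho_B$ defined by $\rho_B:=2i\,\partial\bar\partial\big(K_B^{-1}J_B\big)$, satisfy the LTY 2B system for $n=4$. Thus solutions of the complex supersymmetric system give solutions of the LTY 2B system. The converse is not true: equivalently, at the level of the constraints, the LTY 2B constraints are a proper subset of the constraints of the complex supersymmetric system.
   Context: **$SU(4)$-structure.** An $SU(4)$-structure with conformal factor $K$ (a nowhere vanishing function) on an $8$-manifold is a pair $(J,\Omega)$, with $J$ a real positive-definite two-form and $\Omega$ a complex nowhere vanishing decomposable four-form, such that $J\wedge\Omega=0$ and $\frac1{2^4}\Omega\wedge\Omega^*=\frac1{4!}KJ^4$. $\Omega$ determines an almost complex structure for which $\Omega$ is of type $(4,0)$ and $J$ of type $(1,1)$. **Origin of the system.** The complex supersymmetric system is the solution of the type IIB supersymmetry equations on $\mathbb R^{1,1}\times M_8$ with metric $e^{2A}ds^2(\mathbb R^{1,1})+ds^2(M_8)$ and $\mathcal N=(2,0)$ supersymmetry, for internal Killing spinors $\eta_1=\alpha\eta$, $\eta_2=\alpha e^{i\vartheta}\eta$ (strict ansatz), where $\eta$ is the unimodular pure spinor defining $(J,\Omega)$. Here $A$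 is the warp factor, $\phi$ the dilaton, and $F=F_1+F_3+F_5+F_7$ the internal RR flux. **Torsion classes.** $$dJ=W_1\lrcorner\Omega^*+W_3+W_4\wedge J+\text{c.c.},\qquad d\Omega=\tfrac{8i}{3}W_1\wedge J\wedge J+W_2\wedge J+W_5^*\wedge\Omega,$$ with $W_1,W_4,W_5$ of type $(1,0)$ and $W_2,W_3$ primitive of type $(2,1)$. $\partial u$ denotes the $(1,0)$-part of $du$. **Flux components.** $F_1=f_1^{(1,0)}+\text{c.c.}$ The three-form is $F_{mnp}=f^{(2,1)}_{3|mnp}+3f^{(1,0)}_{3|[m}J_{np]}+\tilde f^{(1,0)}_{3|s}\Omega^{s*}{}_{mnp}+\text{c.c.}$, with $f_3^{(2,1)}$ primitive of type $(2,1)$ and the other components of type $(1,0)$. The internal part of $H$ is decomposed in the same way, with components $h^{(2,1)},h_3^{(1,0)},\tilde h_3^{(1,0)}$; $h_1^{(1,0)}$ is the $(1,0)$-part of the internal one-form multiplying the volume form of $\mathbb R^{1,1}$ in $H$. For $F_5$ and $F_7$ the Hodge duals are decomposed in the same way, with components $f_5^{(2,1)},f_5^{(1,0)},\tilde f_5^{(1,0)}$ and $f_7^{(1,0)}$. **Complex supersymmetric system.** $$W_1=W_2=0,\quad W_3=ie^{\phi}\big(\cos\vartheta\, f_3^{(2,1)}-i\sin\vartheta\, f_5^{(2,1)}\big),\quad W_4=\tfrac23\partial(\phi-A),\quad W_5=\partial(\phi-2A+i\vartheta),$$ $$\alpha=e^{\frac12A},\quad \tilde f_3^{(1,0)}=\tilde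 f_5^{(1,0)}=\tilde h_3^{(1,0)}=0,\quad h_1^{(1,0)}=0,\quad h_3^{(1,0)}=\tfrac23\partial\vartheta,$$ $$f_1^{(1,0)}=-i\,\partial(e^{-\phi}\sin\vartheta),\quad f_3^{(1,0)}=-\tfrac i3e^{2A}\partial(e^{-2A-\phi}\cos\vartheta),$$ $$f_5^{(1,0)}=\tfrac13e^{-4A}\partial(e^{4A-\phi}\sin\vartheta),\quad f_7^{(1,0)}=e^{-2A}\partial(e^{2A-\phi}\cos\vartheta),$$ $$h^{(2,1)}=e^{\phi}\big(-\cos\vartheta\, f_5^{(2,1)}+i\sin\vartheta\, f_3^{(2,1)}\big).$$ **LTY 2B system ($n=4$).** $(J_B,\Omega_B)$ is an $SU(4)$-structure with conformal factor $K_B$, i.e. $J_B\wedge\Omega_B=0$ and $\frac1{2^4}\Omega_B\wedge\Omega_B^*=\frac1{4!}K_BJ_B^4$, such that $$dJ_B^{3}=0,\qquad d\Omega_B=0,\qquad 2i\,\partial\bar\partial\big(K_B^{-1}J_B\big)\equiv\rho_B,$$ where the last equation can be taken as the definition of $\rho_B$. *)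

theory Defs
  imports "HOL-Analysis.Analysis" "HOL-Library.Function_Algebras"
begin

section \<open>Smooth functions and smooth 8-manifolds\<close>

definition pderiv_at :: "8 \<Rightarrow> (real^8 \<Rightarrow> 'b::real_normed_vector) \<Rightarrow> real^8 \<Rightarrow> 'b" where
  "pderiv_at m f x = frechet_derivative f (at x) (axis m 1)"

fun Ck_on :: "nat \<Rightarrow> (real^8) set \<Rightarrow> (real^8 \<Rightarrow> 'b::real_normed_vector) \<Rightarrow> bool" where
  "Ck_on 0 S f \<longleftrightarrow> continuous_on S f"
| "Ck_on (Suc k) S f \<longleftrightarrow> f differentiable_on S \<and> (\<forall>m. Ck_on k S (pderiv_at m f))"

text \<open>Only used for open \<open>S\<close>.\<close>

definition smooth_on :: "(real^8) set \<Rightarrow> (real^8 \<Rightarrow> 'b::real_normed_vector) \<Rightarrow> bool" where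
  "smooth_on S f \<longleftrightarrow> (\<forall>k. Ck_on k S f)"

text \<open>A chart is a pair of its domain and its coordinate map.\<close>

type_synonym 'a chart = "'a set \<times> ('a \<Rightarrow> real^8)"

definition crange :: "'a chart \<Rightarrow> (real^8) set" where
  "crange c = snd c ` fst c"

definition cinv :: "'a chart \<Rightarrow> real^8 \<Rightarrow> 'a" where
  "cinv c = inv_into (fst c) (snd c)"

definition transition :: "'a chart \<Rightarrow> 'a chart \<Rightarrow> real^8 \<Rightarrow> real^8" where
  "transition c c' = snd c' \<circ> cinv c"

definition manifold8 :: "'a topology \<Rightarrow> 'a chart set \<Rightarrow> bool" where
  "manifold8 X \<A> \<longleftrightarrow>
     Hausdorff_space X \<and> second_countable X \<and>
     topspace X = (\<Union>c\<in>\<A>. fst c) \<and>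
     (\<forall>c\<in>\<A>. openin X (fst c) \<and> open (crange c) \<and>
        homeomorphic_map (subtopology X (fst c)) (top_of_set (crange c)) (snd c)) \<and>
     (\<forall>c\<in>\<A>. \<forall>c'\<in>\<A>. smooth_on (snd c ` (fst c \<inter> fst c')) (transition c c'))"

text \<open>A point of the manifold seen in a chart: the chart together with the coordinates.\<close>

type_synonym 'a lpt = "'a chart \<times> (real^8)"

definition lpts :: "'a chart set \<Rightarrow> 'a lpt set" where
  "lpts \<A> = (SIGMA c:\<A>. crange c)"

definition pt :: "'a lpt \<Rightarrow> 'a" where
  "pt z = cinv (fst z) (snd z)"

definition smooth_fun :: "'a chart set \<Rightarrow> ('a \<Rightarrow> real) \<Rightarrow> bool" where
  "smooth_fun \<A> u \<longleftrightarrow> (\<forall>c\<in>\<A>. smooth_on (crange c) (u \<circ> cinv c))"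


section \<open>Exterior algebra of the complexified tangent space\<close>

text \<open>A complex \<open>k\<close>-form at a point is an alternating \<open>complex\<close>-multilinear function of \<open>k\<close> vectors
  of the complexified tangent space, extended by \<open>0\<close> to lists of any other length. Its components
  are its values on lists of coordinate vectors. Sums are pointwise (\<open>Function_Algebras\<close>).\<close>

type_synonym cvec = "complex^8"
type_synonym pform = "cvec list \<Rightarrow> complex"

abbreviation ebas :: "8 \<Rightarrow> cvec" where
  "ebas m \<equiv> axis m 1"

definition cvec_of :: "real^8 \<Rightarrow> cvec" where
  "cvec_of v = (\<chi> m. complex_of_real (v $ m))"

definition cnjv :: "cvec \<Rightarrow> cvec" where
  "cnjv v = (\<chi> m. cnj (v $ m))"

definition is_form :: "nat \<Rightarrow> pform \<Rightarrow> bool" where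
  "is_form k \<omega> \<longleftrightarrow>
     (\<forall>vs. length vs \<noteq> k \<longrightarrow> \<omega> vs = 0) \<and>
     (\<forall>us v w vs a b. \<omega> (us @ (a *s v + b *s w) # vs) = a * \<omega> (us @ v # vs) + b * \<omega> (us @ w # vs)) \<and>
     (\<forall>us v vs ws. \<omega> (us @ v # vs @ v # ws) = 0)"

definition fscale :: "complex \<Rightarrow> pform \<Rightarrow> pform"  (infixr "*\<^sub>f" 75) where
  "c *\<^sub>f \<omega> = (\<lambda>vs. c * \<omega> vs)"

text \<open>Wedge product as a sum over shuffles: \<open>S\<close> is the set of positions whose vectors are fed to the
  first factor, and the sign is that of the corresponding shuffle. Thus
  \<open>(\<alpha> \<and>\<^sub>f \<beta>) [v, w] = \<alpha> [v] * \<beta> [w] - \<alpha> [w] * \<beta> [v]\<close> for one-forms.\<close>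

definition shuffle_sign :: "nat set \<Rightarrow> complex" where
  "shuffle_sign S = (-1) ^ card {(i, j). i \<in> S \<and> j \<notin> S \<and> j < i}"

definition wedge :: "pform \<Rightarrow> pform \<Rightarrow> pform"  (infixr "\<and>\<^sub>f" 70) where
  "\<omega> \<and>\<^sub>f \<eta> = (\<lambda>vs. \<Sum>S\<in>Pow {..<length vs}. shuffle_sign S * \<omega> (nths vs S) * \<eta> (nths vs (- S)))"

definition conjf :: "pform \<Rightarrow> pform" where
  "conjf \<omega> = (\<lambda>vs. cnj (\<omega> (map cnjv vs)))"

definition plus_cc :: "pform \<Rightarrow> pform" where
  "plus_cc \<omega> = \<omega> + conjf \<omega>"

definition decomposable4 :: "pform \<Rightarrow> bool" where
  "decomposable4 \<Omega> \<longleftrightarrow> (\<exists>\<theta>\<^sub>1 \<theta>\<^sub>2 \<theta>\<^sub>3 \<theta>\<^sub>4. is_form 1 \<theta>\<^sub>1 \<and> is_form 1 \<theta>\<^sub>2 \<and> is_form 1 \<theta>\<^sub>3 \<and> is_form 1 \<theta>\<^sub>4 \<and>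
     \<Omega> = \<theta>\<^sub>1 \<and>\<^sub>f \<theta>\<^sub>2 \<and>\<^sub>f \<theta>\<^sub>3 \<and>\<^sub>f \<theta>\<^sub>4)"


section \<open>The almost complex structure determined by a decomposable four-form\<close>

definition T01 :: "pform \<Rightarrow> cvec set" where
  "T01 \<Omega> = {v. \<forall>vs. \<Omega> (v # vs) = 0}"

definition T10 :: "pform \<Rightarrow> cvec set" where
  "T10 \<Omega> = cnjv ` T01 \<Omega>"

definition determines_acs :: "pform \<Rightarrow> bool" where
  "determines_acs \<Omega> \<longleftrightarrow> (\<forall>v. \<exists>!u. u \<in> T10 \<Omega> \<and> v - u \<in> T01 \<Omega>)"

definition p10 :: "pform \<Rightarrow> cvec \<Rightarrow> cvec" where
  "p10 \<Omega> v = (THE u. u \<in> T10 \<Omega> \<and> v - u \<in> T01 \<Omega>)"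

definition p01 :: "pform \<Rightarrow> cvec \<Rightarrow> cvec" where
  "p01 \<Omega> v = v - p10 \<Omega> v"

definition acs :: "pform \<Rightarrow> cvec \<Rightarrow> cvec" where
  "acs \<Omega> v = \<i> *s p10 \<Omega> v - \<i> *s p01 \<Omega> v"

definition of_type :: "pform \<Rightarrow> nat \<Rightarrow> nat \<Rightarrow> pform \<Rightarrow> bool" where
  "of_type \<Omega> p q \<omega> \<longleftrightarrow> is_form (p + q) \<omega> \<and>
     (\<forall>us vs. set us \<subseteq> T10 \<Omega> \<and> set vs \<subseteq> T01 \<Omega> \<and> \<not> (length us = p \<and> length vs = q) \<longrightarrow> \<omega> (us @ vs) = 0)"

text \<open>The \<open>(p,q)\<close>-part of a form; \<open>S\<close> is the set of positions whose vectors are projected to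
  \<open>T10\<close>.\<close>

definition type_part :: "pform \<Rightarrow> nat \<Rightarrow> nat \<Rightarrow> pform \<Rightarrow> pform" where
  "type_part \<Omega> p q \<omega> = (\<lambda>vs. if length vs = p + q
     then \<Sum>S | S \<subseteq> {..<p + q} \<and> card S = p.
            \<omega> (map (\<lambda>j. if j \<in> S then p10 \<Omega> (vs ! j) else p01 \<Omega> (vs ! j)) [0..<p + q])
     else 0)"


section \<open>Metric, contractions and Hodge star of an SU(4)-structure\<close>

text \<open>\<open>g(u,v) = J(u,Iv)\<close>, equivalently \<open>J(u,v) = g(Iu,v)\<close>; for \<open>\<Omega> = dz\<^sup>1 \<and> dz\<^sup>2 \<and> dz\<^sup>3 \<and> dz\<^sup>4\<close> and
  \<open>J = \<i>/2 \<Sum> dz \<and> dz*\<close> this is the flat metric.\<close>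

definition gmet :: "pform \<Rightarrow> pform \<Rightarrow> cvec \<Rightarrow> cvec \<Rightarrow> complex" where
  "gmet J \<Omega> u v = J [u, acs \<Omega> v]"

definition ginv :: "pform \<Rightarrow> pform \<Rightarrow> 8 \<Rightarrow> 8 \<Rightarrow> complex" where
  "ginv J \<Omega> m n = matrix_inv (\<chi> s t. gmet J \<Omega> (ebas s) (ebas t)) $ m $ n"

text \<open>\<open>(w \<lrcorner> \<omega>)\<^sub>m\<^sub>.\<^sub>.\<^sub>. = w\<^sub>s g\<^sup>s\<^sup>t \<omega>\<^sub>t\<^sub>m\<^sub>.\<^sub>.\<^sub>.\<close> for a one-form \<open>w\<close>.\<close>

definition contr :: "pform \<Rightarrow> pform \<Rightarrow> pform \<Rightarrow> pform \<Rightarrow> pform" where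
  "contr J \<Omega> w \<omega> = (\<lambda>vs. \<Sum>s\<in>UNIV. \<Sum>t\<in>UNIV. w [ebas s] * ginv J \<Omega> s t * \<omega> (ebas t # vs))"

text \<open>\<open>J\<^sup>m\<^sup>n \<omega>\<^sub>m\<^sub>n\<^sub>.\<^sub>.\<^sub>. = 0\<close>.\<close>

definition primitive :: "pform \<Rightarrow> pform \<Rightarrow> pform \<Rightarrow> bool" where
  "primitive J \<Omega> \<omega> \<longleftrightarrow> (\<forall>vs.
     (\<Sum>m\<in>UNIV. \<Sum>n\<in>UNIV. \<Sum>p\<in>UNIV. \<Sum>q\<in>UNIV.
        ginv J \<Omega> m p * ginv J \<Omega> n q * J [ebas p, ebas q] * \<omega> (ebas m # ebas n # vs)) = 0)"

text \<open>\<open>(\<star>\<omega>)\<^sub>n\<^sub>.\<^sub>.\<^sub>. = 1/k! \<omega>\<^sub>a\<^sub>.\<^sub>.\<^sub>. \<epsilon>\<^sup>a\<^sup>.\<^sup>.\<^sup>.\<^sub>n\<^sub>.\<^sub>.\<^sub>.\<close>, where \<open>k\<close> is the degree of \<open>\<omega>\<close> and \<open>\<epsilon>\<close> is the volume form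
  \<open>J\<^sup>4/4!\<close>; equivalently \<open>\<alpha> \<and> \<star>\<beta> = g(\<alpha>,\<beta>) J\<^sup>4/4!\<close>.\<close>

definition hodge :: "pform \<Rightarrow> pform \<Rightarrow> pform \<Rightarrow> pform" where
  "hodge J \<Omega> \<omega> = (\<lambda>vs. let k = 8 - length vs in
     1 / fact k * (\<Sum>as | length as = k. \<Sum>bs | length bs = k.
        (\<Prod>j<k. ginv J \<Omega> (as ! j) (bs ! j)) * \<omega> (map ebas as) *
        (1 / fact 4 * (J \<and>\<^sub>f J \<and>\<^sub>f J \<and>\<^sub>f J) (map ebas bs @ vs))))"


section \<open>Differential forms on a manifold\<close>

text \<open>A differential form is given by its local representatives in the charts of the atlas, subject
  to the transformation law under changes of charts. Its values outside \<open>lpts \<A>\<close> are irrelevant.\<close>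

type_synonym 'a dform = "'a lpt \<Rightarrow> pform"

definition push :: "(real^8 \<Rightarrow> real^8) \<Rightarrow> cvec \<Rightarrow> cvec" where
  "push L v = cvec_of (L (\<chi> m. Re (v $ m))) + \<i> *s cvec_of (L (\<chi> m. Im (v $ m)))"

definition dforms :: "'a chart set \<Rightarrow> nat \<Rightarrow> 'a dform set" where
  "dforms \<A> k = {\<omega>.
     (\<forall>z\<in>lpts \<A>. is_form k (\<omega> z)) \<and>
     (\<forall>c\<in>\<A>. \<forall>vs. smooth_on (crange c) (\<lambda>x. \<omega> (c, x) vs)) \<and>
     (\<forall>c\<in>\<A>. \<forall>c'\<in>\<A>. \<forall>y\<in>fst c \<inter> fst c'. \<forall>vs.
        \<omega> (c, snd c y) vs =
        \<omega> (c', snd c' y) (map (push (frechet_derivative (transition c c') (at (snd c y)))) vs))}"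

definition real_dforms :: "'a chart set \<Rightarrow> nat \<Rightarrow> 'a dform set" where
  "real_dforms \<A> k = {\<omega> \<in> dforms \<A> k. \<forall>z\<in>lpts \<A>. conjf (\<omega> z) = \<omega> z}"

definition type_dforms :: "'a chart set \<Rightarrow> 'a dform \<Rightarrow> nat \<Rightarrow> nat \<Rightarrow> 'a dform set" where
  "type_dforms \<A> \<Omega> p q = {\<omega> \<in> dforms \<A> (p + q). \<forall>z\<in>lpts \<A>. of_type (\<Omega> z) p q (\<omega> z)}"

definition prim_dforms :: "'a chart set \<Rightarrow> 'a dform \<Rightarrow> 'a dform \<Rightarrow> nat \<Rightarrow> nat \<Rightarrow> 'a dform set" where
  "prim_dforms \<A> J \<Omega> p q = {\<omega> \<in> type_dforms \<A> \<Omega> p q. \<forall>z\<in>lpts \<A>. primitive (J z) (\<Omega> z) (\<omega> z)}"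

definition zero_form :: "('a \<Rightarrow> complex) \<Rightarrow> 'a dform" where
  "zero_form u z = (\<lambda>vs. if vs = [] then u (pt z) else 0)"

text \<open>\<open>d\<omega>(v\<^sub>0,\<dots>,v\<^sub>k) = \<Sum>\<^sub>j (-1)\<^sup>j v\<^sub>j(\<omega>(v\<^sub>0,\<dots>,v\<^sub>k))\<close> with \<open>v\<^sub>j\<close> omitted among the arguments of \<open>\<omega>\<close>, for
  vectors with constant components in the chart.\<close>

definition ext_d :: "'a dform \<Rightarrow> 'a dform" where
  "ext_d \<omega> z = (\<lambda>vs. \<Sum>j<length vs. (-1) ^ j *
     (\<Sum>m\<in>UNIV. (vs ! j) $ m *
        pderiv_at m (\<lambda>y. \<omega> (fst z, y) (take j vs @ drop (Suc j) vs)) (snd z)))"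

text \<open>\<open>\<partial>\<close> and its conjugate on forms of type \<open>(p,q)\<close>.\<close>

definition del :: "'a dform \<Rightarrow> nat \<Rightarrow> nat \<Rightarrow> 'a dform \<Rightarrow> 'a dform" where
  "del \<Omega> p q \<omega> z = type_part (\<Omega> z) (Suc p) q (ext_d \<omega> z)"

definition delbar :: "'a dform \<Rightarrow> nat \<Rightarrow> nat \<Rightarrow> 'a dform \<Rightarrow> 'a dform" where
  "delbar \<Omega> p q \<omega> z = type_part (\<Omega> z) p (Suc q) (ext_d \<omega> z)"

abbreviation del0 :: "'a dform \<Rightarrow> ('a \<Rightarrow> complex) \<Rightarrow> 'a dform" where
  "del0 \<Omega> u \<equiv> del \<Omega> 0 0 (zero_form u)"


section \<open>SU(4)-structures and torsion classes\<close>

text \<open>The condition \<open>determines_acs\<close> follows from the remaining ones; it is listed because the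
  positivity of \<open>J\<close> refers to the almost complex structure of \<open>\<Omega>\<close>.\<close>

definition su4_structure :: "'a chart set \<Rightarrow> 'a dform \<Rightarrow> 'a dform \<Rightarrow> ('a \<Rightarrow> real) \<Rightarrow> bool" where
  "su4_structure \<A> J \<Omega> K \<longleftrightarrow>
     J \<in> real_dforms \<A> 2 \<and> \<Omega> \<in> dforms \<A> 4 \<and> smooth_fun \<A> K \<and>
     (\<forall>z\<in>lpts \<A>.
        K (pt z) \<noteq> 0 \<and> \<Omega> z \<noteq> 0 \<and> decomposable4 (\<Omega> z) \<and> determines_acs (\<Omega> z) \<and>
        (\<forall>v. v \<noteq> 0 \<longrightarrow> 0 < Re (gmet (J z) (\<Omega> z) (cvec_of v) (cvec_of v))) \<and>
        J z \<and>\<^sub>f \<Omega> z = 0 \<and>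
        (1 / 2 ^ 4) *\<^sub>f (\<Omega> z \<and>\<^sub>f conjf (\<Omega> z)) =
          (1 / fact 4 * complex_of_real (K (pt z))) *\<^sub>f (J z \<and>\<^sub>f J z \<and>\<^sub>f J z \<and>\<^sub>f J z))"

definition torsion_classes ::
  "'a chart set \<Rightarrow> 'a dform \<Rightarrow> 'a dform \<Rightarrow>
   'a dform \<Rightarrow> 'a dform \<Rightarrow> 'a dform \<Rightarrow> 'a dform \<Rightarrow> 'a dform \<Rightarrow> bool" where
  "torsion_classes \<A> J \<Omega> W\<^sub>1 W\<^sub>2 W\<^sub>3 W\<^sub>4 W\<^sub>5 \<longleftrightarrow>
     W\<^sub>1 \<in> type_dforms \<A> \<Omega> 1 0 \<and> W\<^sub>4 \<in> type_dforms \<A> \<Omega> 1 0 \<and> W\<^sub>5 \<in> type_dforms \<A> \<Omega> 1 0 \<and>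
     W\<^sub>2 \<in> prim_dforms \<A> J \<Omega> 2 1 \<and> W\<^sub>3 \<in> prim_dforms \<A> J \<Omega> 2 1 \<and>
     (\<forall>z\<in>lpts \<A>.
        ext_d J z = plus_cc (contr (J z) (\<Omega> z) (W\<^sub>1 z) (conjf (\<Omega> z)) + W\<^sub>3 z + W\<^sub>4 z \<and>\<^sub>f J z) \<and>
        ext_d \<Omega> z = (8 * \<i> / 3) *\<^sub>f (W\<^sub>1 z \<and>\<^sub>f J z \<and>\<^sub>f J z) + W\<^sub>2 z \<and>\<^sub>f J z + conjf (W\<^sub>5 z) \<and>\<^sub>f \<Omega> z)"


section \<open>Flux components and the complex supersymmetric system\<close>

definition one_form_components :: "'a chart set \<Rightarrow> 'a dform \<Rightarrow> 'a dform \<Rightarrow> 'a dform \<Rightarrow> bool" where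
  "one_form_components \<A> \<Omega> F f \<longleftrightarrow>
     f \<in> type_dforms \<A> \<Omega> 1 0 \<and> (\<forall>z\<in>lpts \<A>. F z = plus_cc (f z))"

text \<open>The components \<open>3 f\<^sub>[\<^sub>mJ\<^sub>n\<^sub>p\<^sub>]\<close> are those of \<open>f \<and>\<^sub>f J\<close>. The last three arguments are the primitive
  \<open>(2,1)\<close>-component, the \<open>(1,0)\<close>-component along \<open>J\<close> and the \<open>(1,0)\<close>-component along \<open>\<Omega>\<^sup>*\<close>.\<close>

definition three_form_components ::
  "'a chart set \<Rightarrow> 'a dform \<Rightarrow> 'a dform \<Rightarrow> 'a dform \<Rightarrow> 'a dform \<Rightarrow> 'a dform \<Rightarrow> 'a dform \<Rightarrow> bool" where
  "three_form_components \<A> J \<Omega> F f21 f ft \<longleftrightarrow>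
     f21 \<in> prim_dforms \<A> J \<Omega> 2 1 \<and> f \<in> type_dforms \<A> \<Omega> 1 0 \<and> ft \<in> type_dforms \<A> \<Omega> 1 0 \<and>
     (\<forall>z\<in>lpts \<A>.
        F z = plus_cc (f21 z + f z \<and>\<^sub>f J z + contr (J z) (\<Omega> z) (ft z) (conjf (\<Omega> z))))"

text \<open>The NSNS flux is given by \<open>H\<^sub>1\<close>, the internal one-form multiplying the volume form of the
  two-dimensional Minkowski space, and the internal three-form \<open>H\<^sub>3\<close>.\<close>

definition configuration ::
  "'a chart set \<Rightarrow> 'a dform \<Rightarrow> 'a dform \<Rightarrow>
   ('a \<Rightarrow> real) \<Rightarrow> ('a \<Rightarrow> real) \<Rightarrow> ('a \<Rightarrow> real) \<Rightarrow> ('a \<Rightarrow> real) \<Rightarrow>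
   'a dform \<Rightarrow> 'a dform \<Rightarrow> 'a dform \<Rightarrow> 'a dform \<Rightarrow> 'a dform \<Rightarrow> 'a dform \<Rightarrow> bool" where
  "configuration \<A> J \<Omega> A \<phi> \<theta> \<alpha> H\<^sub>1 H\<^sub>3 F\<^sub>1 F\<^sub>3 F\<^sub>5 F\<^sub>7 \<longleftrightarrow>
     su4_structure \<A> J \<Omega> (\<lambda>_. 1) \<and>
     smooth_fun \<A> A \<and> smooth_fun \<A> \<phi> \<and> smooth_fun \<A> \<theta> \<and> smooth_fun \<A> \<alpha> \<and>
     H\<^sub>1 \<in> real_dforms \<A> 1 \<and> H\<^sub>3 \<in> real_dforms \<A> 3 \<and>
     F\<^sub>1 \<in> real_dforms \<A> 1 \<and> F\<^sub>3 \<in> real_dforms \<A> 3 \<and>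
     F\<^sub>5 \<in> real_dforms \<A> 5 \<and> F\<^sub>7 \<in> real_dforms \<A> 7"

text \<open>The torsion classes and flux components are uniquely determined by their defining
  decompositions, so it does not matter that they are introduced existentially. The names
  \<open>ft\<^sub>3\<close>, \<open>ft\<^sub>5\<close>, \<open>ht\<^sub>3\<close> stand for the components carrying a tilde.\<close>

definition complex_susy_system ::
  "'a chart set \<Rightarrow> 'a dform \<Rightarrow> 'a dform \<Rightarrow>
   ('a \<Rightarrow> real) \<Rightarrow> ('a \<Rightarrow> real) \<Rightarrow> ('a \<Rightarrow> real) \<Rightarrow> ('a \<Rightarrow> real) \<Rightarrow>
   'a dform \<Rightarrow> 'a dform \<Rightarrow> 'a dform \<Rightarrow> 'a dform \<Rightarrow> 'a dform \<Rightarrow> 'a dform \<Rightarrow> bool" where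
  "complex_susy_system \<A> J \<Omega> A \<phi> \<theta> \<alpha> H\<^sub>1 H\<^sub>3 F\<^sub>1 F\<^sub>3 F\<^sub>5 F\<^sub>7 \<longleftrightarrow>
     (\<exists>W\<^sub>1 W\<^sub>2 W\<^sub>3 W\<^sub>4 W\<^sub>5 f\<^sub>1 f21\<^sub>3 f\<^sub>3 ft\<^sub>3 f21\<^sub>5 f\<^sub>5 ft\<^sub>5 f\<^sub>7 h21 h\<^sub>3 ht\<^sub>3.
        torsion_classes \<A> J \<Omega> W\<^sub>1 W\<^sub>2 W\<^sub>3 W\<^sub>4 W\<^sub>5 \<and>
        one_form_components \<A> \<Omega> F\<^sub>1 f\<^sub>1 \<and>
        three_form_components \<A> J \<Omega> F\<^sub>3 f21\<^sub>3 f\<^sub>3 ft\<^sub>3 \<and>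
        three_form_components \<A> J \<Omega> (\<lambda>z. hodge (J z) (\<Omega> z) (F\<^sub>5 z)) f21\<^sub>5 f\<^sub>5 ft\<^sub>5 \<and>
        one_form_components \<A> \<Omega> (\<lambda>z. hodge (J z) (\<Omega> z) (F\<^sub>7 z)) f\<^sub>7 \<and>
        three_form_components \<A> J \<Omega> H\<^sub>3 h21 h\<^sub>3 ht\<^sub>3 \<and>
        (\<forall>z\<in>lpts \<A>. let a = A (pt z); b = \<phi> (pt z); t = \<theta> (pt z) in
           W\<^sub>1 z = 0 \<and> W\<^sub>2 z = 0 \<and>
           W\<^sub>3 z = (\<i> * exp b) *\<^sub>f ((cos t) *\<^sub>f f21\<^sub>3 z - (\<i> * sin t) *\<^sub>f f21\<^sub>5 z) \<and>
           W\<^sub>4 z = (2 / 3) *\<^sub>f del0 \<Omega> (\<lambda>y. of_real (\<phi> y - A y)) z \<and>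
           W\<^sub>5 z = del0 \<Omega> (\<lambda>y. of_real (\<phi> y - 2 * A y) + \<i> * of_real (\<theta> y)) z \<and>
           \<alpha> (pt z) = exp (1 / 2 * a) \<and>
           ft\<^sub>3 z = 0 \<and> ft\<^sub>5 z = 0 \<and> ht\<^sub>3 z = 0 \<and>
           type_part (\<Omega> z) 1 0 (H\<^sub>1 z) = 0 \<and>
           h\<^sub>3 z = (2 / 3) *\<^sub>f del0 \<Omega> (\<lambda>y. of_real (\<theta> y)) z \<and>
           f\<^sub>1 z = (- \<i>) *\<^sub>f del0 \<Omega> (\<lambda>y. of_real (exp (- \<phi> y) * sin (\<theta> y))) z \<and>
           f\<^sub>3 z = (- (\<i> / 3) * exp (2 * a)) *\<^sub>f
             del0 \<Omega> (\<lambda>y. of_real (exp (- 2 * A y - \<phi> y) * cos (\<theta> y))) z \<and>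
           f\<^sub>5 z = (1 / 3 * exp (- 4 * a)) *\<^sub>f
             del0 \<Omega> (\<lambda>y. of_real (exp (4 * A y - \<phi> y) * sin (\<theta> y))) z \<and>
           f\<^sub>7 z = (exp (- 2 * a)) *\<^sub>f
             del0 \<Omega> (\<lambda>y. of_real (exp (2 * A y - \<phi> y) * cos (\<theta> y))) z \<and>
           h21 z = (exp b) *\<^sub>f (- ((cos t) *\<^sub>f f21\<^sub>5 z) + (\<i> * sin t) *\<^sub>f f21\<^sub>3 z)))"


section \<open>The LTY 2B system\<close>

definition rho_LTY :: "'a dform \<Rightarrow> 'a dform \<Rightarrow> ('a \<Rightarrow> real) \<Rightarrow> 'a dform" where
  "rho_LTY J \<Omega> K z =
     (2 * \<i>) *\<^sub>f del \<Omega> 1 2 (delbar \<Omega> 1 1 (\<lambda>w. (inverse (K (pt w))) *\<^sub>f J w)) z"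

definition lty_2B_system ::
  "'a chart set \<Rightarrow> 'a dform \<Rightarrow> 'a dform \<Rightarrow> ('a \<Rightarrow> real) \<Rightarrow> 'a dform \<Rightarrow> bool" where
  "lty_2B_system \<A> J \<Omega> K \<rho> \<longleftrightarrow>
     su4_structure \<A> J \<Omega> K \<and>
     (\<forall>z\<in>lpts \<A>.
        ext_d (\<lambda>w. J w \<and>\<^sub>f J w \<and>\<^sub>f J w) z = 0 \<and>
        ext_d \<Omega> z = 0 \<and>
        rho_LTY J \<Omega> K z = \<rho> z)"

definition Omega_B :: "('a \<Rightarrow> real) \<Rightarrow> ('a \<Rightarrow> real) \<Rightarrow> ('a \<Rightarrow> real) \<Rightarrow> 'a dform \<Rightarrow> 'a dform" where
  "Omega_B A \<phi> \<theta> \<Omega> z =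
     exp (of_real (- \<phi> (pt z) + 2 * A (pt z)) + \<i> * of_real (\<theta> (pt z))) *\<^sub>f \<Omega> z"

definition J_B :: "('a \<Rightarrow> real) \<Rightarrow> ('a \<Rightarrow> real) \<Rightarrow> 'a dform \<Rightarrow> 'a dform" where
  "J_B A \<phi> J z = exp (2 / 3 * (- \<phi> (pt z) + A (pt z))) *\<^sub>f J z"

definition K_B :: "('a \<Rightarrow> real) \<Rightarrow> ('a \<Rightarrow> real) \<Rightarrow> 'a \<Rightarrow> real" where
  "K_B A \<phi> y = exp (2 / 3 * (\<phi> y + 2 * A y))"

end

theory Submission
  imports Defs
begin

text \<open>For arbitrary functions on lists the shuffle product satisfies
  \<open>\<iota>\<^sub>v(\<omega> \<and> \<eta>) = \<iota>\<^sub>v \<omega> \<and> \<eta> + (\<plusminus>\<omega>) \<and> \<iota>\<^sub>v \<eta>\<close>, and the laws of the exterior algebra follow by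
  induction on the argument list.

  The powers in \<open>J_B\<close> and \<open>\<Omega>_B\<close> absorb \<open>W\<^sub>4\<close> and \<open>W\<^sub>5\<close>. What is left of \<open>dJ_B\<^sup>3\<close> is a multiple of
  \<open>(W\<^sub>3 + c.c.) \<and> J\<^sup>2\<close>, which vanishes because \<open>W\<^sub>3\<close> is primitive; what is left of \<open>d\<Omega>_B\<close> is a one-form of
  type \<open>(1,0)\<close> wedged with the \<open>(4,0)\<close>-form \<open>\<Omega>\<close>. For the failure of the converse, flat space with
  constant scalars solves the LTY system for every choice of RR flux, but the supersymmetric system
  determines \<open>F\<^sub>1\<close> from the scalars.\<close>

section \<open>The shuffle product\<close>

text \<open>The given notions are values on lists of vectors and index sums, and no adapted frame is
  chosen at any point of the manifold. Two pointwise facts therefore need an argument.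

  Primitivity is a trace against \<open>ginv\<close>, whereas closure of the cube needs
  \<open>W\<^sub>3\<close> wedged with the square of \<open>J\<close> to vanish. The bridge is that
  \<open>J\<close> with both indices raised is minus the inverse of \<open>J\<close>: the condition
  that \<open>J\<close> wedged with \<Omega> is zero makes \<open>J\<close> of type (1,1), so the
  metric is symmetric, and positivity makes it invertible. Secondly, the (1,0) one-forms are known
  only as those vanishing on the kernel of \<Omega>, and decomposability turns this into a vanishing
  wedge product.

  The exponents are forced. Since \<open>W\<^sub>4\<close> plus its conjugate is 2/3 d(\<phi> - A),
  the logarithm of the factor of \<open>J\<close> has to be -2/3 (\<phi> - A). Conjugating
  \<open>W\<^sub>5\<close> gives the (0,1)-part of d(\<phi> - 2 A - i \<theta>), which is minus that
  of the exponent in \<open>Omega_B\<close>; this fixes the sign of the phase.\<close>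

definition ins :: "cvec \<Rightarrow> pform \<Rightarrow> pform" where
  "ins v \<omega> = (\<lambda>vs. \<omega> (v # vs))"

text \<open>The grading involution. The conditions \<open>sg \<omega> = \<omega>\<close> and
  \<open>sg \<omega> = - \<omega>\<close> express even and odd degree, and this parity is all that
  reordering the factors of a wedge product requires.\<close>

definition sg :: "pform \<Rightarrow> pform" where
  "sg \<omega> = (\<lambda>vs. (-1) ^ length vs * \<omega> vs)"

lemma ins_apply: "ins v \<omega> vs = \<omega> (v # vs)"
  by (simp add: ins_def)

lemma fsum_apply: "(\<Sum>i\<in>I. F i) x = (\<Sum>i\<in>I. F i x)"
  for F :: "'i \<Rightarrow> 'b \<Rightarrow> 'c::comm_monoid_add"
  by (induction I rule: infinite_finite_induct) auto

lemma ins_linear [simp]: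
  "ins v (\<omega> + \<eta>) = ins v \<omega> + ins v \<eta>" "ins v (- \<omega>) = - ins v \<omega>" "ins v (c *\<^sub>f \<omega>) = c *\<^sub>f ins v \<omega>"
  "ins v 0 = 0"
  by (auto simp: ins_def fscale_def fun_eq_iff)

lemma sg_linear [simp]:
  "sg (\<omega> + \<eta>) = sg \<omega> + sg \<eta>" "sg (- \<omega>) = - sg \<omega>" "sg (c *\<^sub>f \<omega>) = c *\<^sub>f sg \<omega>" "sg 0 = 0"
  "sg (sg \<omega>) = \<omega>"
  by (auto simp: sg_def fscale_def fun_eq_iff algebra_simps simp flip: power_mult_distrib)

lemma ins_sg [simp]: "ins v (sg \<omega>) = - sg (ins v \<omega>)"
  by (auto simp: ins_def sg_def fun_eq_iff)

lemma sg_ins: "sg (ins v \<omega>) = - ins v (sg \<omega>)"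
  by (auto simp: ins_def sg_def fun_eq_iff)

lemma fscale_simps [simp]:
  "0 *\<^sub>f \<omega> = 0" "1 *\<^sub>f \<omega> = \<omega>" "(-1) *\<^sub>f \<omega> = - \<omega>" "c *\<^sub>f 0 = 0" "c *\<^sub>f d *\<^sub>f \<omega> = (c * d) *\<^sub>f \<omega>"
  "c *\<^sub>f (- \<omega>) = (- c) *\<^sub>f \<omega>" "- (c *\<^sub>f \<omega>) = (- c) *\<^sub>f \<omega>"
  by (auto simp: fscale_def fun_eq_iff)

lemma fscale_add_right: "c *\<^sub>f (\<omega> + \<eta>) = c *\<^sub>f \<omega> + c *\<^sub>f \<eta>"
  by (auto simp: fscale_def fun_eq_iff algebra_simps)

lemma fscale_add_left: "(c + d) *\<^sub>f \<omega> = c *\<^sub>f \<omega> + d *\<^sub>f \<omega>"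
  by (auto simp: fscale_def fun_eq_iff algebra_simps)

lemma fscale_diff_right: "c *\<^sub>f (\<omega> - \<eta>) = c *\<^sub>f \<omega> - c *\<^sub>f \<eta>"
  by (auto simp: fscale_def fun_eq_iff algebra_simps)

lemma fscale_sum: "c *\<^sub>f (\<Sum>i\<in>I. F i) = (\<Sum>i\<in>I. c *\<^sub>f F i)"
  by (auto simp: fscale_def fun_eq_iff fsum_apply sum_distrib_left)

lemma wedge_add_left: "(\<omega> + \<omega>') \<and>\<^sub>f \<eta> = \<omega> \<and>\<^sub>f \<eta> + \<omega>' \<and>\<^sub>f \<eta>"
  by (auto simp: wedge_def fun_eq_iff algebra_simps sum.distrib)

lemma wedge_add_right: "\<omega> \<and>\<^sub>f (\<eta> + \<eta>') = \<omega> \<and>\<^sub>f \<eta> + \<omega> \<and>\<^sub>f \<eta>'"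
  by (auto simp: wedge_def fun_eq_iff algebra_simps sum.distrib)

lemma wedge_scale [simp]:
  "(c *\<^sub>f \<omega>) \<and>\<^sub>f \<eta> = c *\<^sub>f (\<omega> \<and>\<^sub>f \<eta>)" "\<omega> \<and>\<^sub>f (c *\<^sub>f \<eta>) = c *\<^sub>f (\<omega> \<and>\<^sub>f \<eta>)"
  by (auto simp: wedge_def fun_eq_iff fscale_def sum_distrib_left mult_ac)

lemma wedge_minus [simp]:
  "(- \<omega>) \<and>\<^sub>f \<eta> = - (\<omega> \<and>\<^sub>f \<eta>)" "\<omega> \<and>\<^sub>f (- \<eta>) = - (\<omega> \<and>\<^sub>f \<eta>)"
  by (auto simp: wedge_def fun_eq_iff sum_negf)

lemma wedge_zero [simp]: "0 \<and>\<^sub>f \<eta> = 0" "\<eta> \<and>\<^sub>f 0 = 0"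
  by (auto simp: wedge_def fun_eq_iff)

lemma wedge_diff_left: "(\<omega> - \<omega>') \<and>\<^sub>f \<eta> = \<omega> \<and>\<^sub>f \<eta> - \<omega>' \<and>\<^sub>f \<eta>"
  using wedge_add_left[of \<omega> "- \<omega>'" \<eta>] by simp

lemma wedge_sum_left: "(\<Sum>i\<in>I. F i) \<and>\<^sub>f \<eta> = (\<Sum>i\<in>I. F i \<and>\<^sub>f \<eta>)"
proof
  fix vs show "((\<Sum>i\<in>I. F i) \<and>\<^sub>f \<eta>) vs = (\<Sum>i\<in>I. F i \<and>\<^sub>f \<eta>) vs"
    unfolding wedge_def fsum_apply sum_distrib_left sum_distrib_right by (rule sum.swap)
qed

lemma wedge_sum_right: "\<eta> \<and>\<^sub>f (\<Sum>i\<in>I. F i) = (\<Sum>i\<in>I. \<eta> \<and>\<^sub>f F i)"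
proof
  fix vs show "(\<eta> \<and>\<^sub>f (\<Sum>i\<in>I. F i)) vs = (\<Sum>i\<in>I. \<eta> \<and>\<^sub>f F i) vs"
    unfolding wedge_def fsum_apply sum_distrib_left sum_distrib_right by (rule sum.swap)
qed

lemma shuffle_sign_insert_0:
  "shuffle_sign (insert 0 (Suc ` T)) = shuffle_sign T"
proof -
  have "{(i, j). i \<in> insert 0 (Suc ` T) \<and> j \<notin> insert 0 (Suc ` T) \<and> j < i}
      = map_prod Suc Suc ` {(i, j). i \<in> T \<and> j \<notin> T \<and> j < i}"
    by (auto simp: image_iff gr0_conv_Suc; blast)
  then show ?thesis
    by (simp add: shuffle_sign_def card_image inj_on_def)
qed

text \<open>Position 0 goes to the second factor, so each of the \<open>card T\<close> positions of
  the first factor has to pass it: one additional inversion for each element of \<open>T\<close>. In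
  \<open>shuffle_sign_insert_0\<close> position 0 goes to the first factor and creates no
  inversion.\<close>

lemma shuffle_sign_Suc:
  assumes "finite T"
  shows "shuffle_sign (Suc ` T) = (-1) ^ card T * shuffle_sign T"
proof -
  have eq: "{(i, j). i \<in> Suc ` T \<and> j \<notin> Suc ` T \<and> j < i}
      = map_prod Suc Suc ` {(i, j). i \<in> T \<and> j \<notin> T \<and> j < i} \<union> (\<lambda>i. (Suc i, 0)) ` T"
    (is "_ = ?A \<union> ?B")
    by (auto simp: image_iff gr0_conv_Suc; blast)
  have "finite {(i, j). i \<in> T \<and> j \<notin> T \<and> j < i}"
    by (rule finite_subset[of _ "T \<times> {..Max T}"])
      (use assms in \<open>auto intro: order.trans[OF less_imp_le Max_ge]\<close>)
  then have "card (?A \<union> ?B) = card ?A + card ?B"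
    using assms by (intro card_Un_disjoint) auto
  also have "card ?A = card {(i, j). i \<in> T \<and> j \<notin> T \<and> j < i}"
    by (rule card_image) (auto simp: inj_on_def)
  also have "card ?B = card T"
    by (rule card_image) (auto simp: inj_on_def)
  finally show ?thesis
    unfolding shuffle_sign_def eq by (simp add: power_add)
qed

lemma wedge_Nil [simp]: "(\<omega> \<and>\<^sub>f \<eta>) [] = \<omega> [] * \<eta> []"
  by (simp add: wedge_def shuffle_sign_def)

text \<open>The subsets of positions are split by whether they contain 0, that is, by which factor
  receives \<open>v\<close>. In the second case the sign \<open>(-1) ^ card T\<close> depends only
  on the number of arguments of the first factor, so it is absorbed into
  \<open>sg \<omega>\<close>.\<close>

lemma wedge_Cons:
  "(\<omega> \<and>\<^sub>f \<eta>) (v # vs) = (ins v \<omega> \<and>\<^sub>f \<eta>) vs + (sg \<omega> \<and>\<^sub>f ins v \<eta>) vs"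
proof -
  let ?n = "length vs"
  let ?t = "\<lambda>S. shuffle_sign S * \<omega> (nths (v # vs) S) * \<eta> (nths (v # vs) (- S))"
  have Pow_Suc: "Pow {..<Suc ?n} = (\<lambda>T. insert 0 (Suc ` T)) ` Pow {..<?n} \<union> (\<lambda>T. Suc ` T) ` Pow {..<?n}"
  proof -
    have "Pow {..<Suc ?n} = Pow (Suc ` {..<?n}) \<union> insert 0 ` Pow (Suc ` {..<?n})"
      unfolding lessThan_Suc_eq_insert_0 by (rule Pow_insert)
    also have "Pow (Suc ` {..<?n}) = (`) Suc ` Pow {..<?n}"
      by (rule image_Pow_surj[OF refl, symmetric])
    finally show ?thesis
      by (simp only: image_image Un_commute)
  qed
  have inj0: "inj_on (\<lambda>T. insert 0 (Suc ` T)) (Pow {..<?n})"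
  proof (rule inj_onI)
    fix S T :: "nat set" assume *: "insert 0 (Suc ` S) = insert 0 (Suc ` T)"
    have "0 \<notin> Suc ` S" "0 \<notin> Suc ` T" by auto
    with * have "Suc ` S = Suc ` T"
      by (rule insert_ident[THEN iffD1, rotated 2])
    then show "S = T"
      by (simp add: inj_image_eq_iff)
  qed
  have inj1: "inj_on (\<lambda>T. Suc ` T) (Pow {..<?n})"
    by (rule inj_onI) (simp add: inj_image_eq_iff)
  have disj: "(\<lambda>T. insert 0 (Suc ` T)) ` Pow {..<?n} \<inter> (\<lambda>T. Suc ` T) ` Pow {..<?n} = {}"
  proof (rule equals0I)
    fix x assume "x \<in> (\<lambda>T. insert 0 (Suc ` T)) ` Pow {..<?n} \<inter> (\<lambda>T. Suc ` T) ` Pow {..<?n}"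
    then obtain S T where "x = insert 0 (Suc ` S)" "x = Suc ` T" by (elim IntE imageE)
    then have "0 \<in> Suc ` T" by (metis insertI1)
    then show False by simp
  qed
  have "(\<omega> \<and>\<^sub>f \<eta>) (v # vs) = (\<Sum>S\<in>(\<lambda>T. insert 0 (Suc ` T)) ` Pow {..<?n}. ?t S) + (\<Sum>S\<in>(\<lambda>T. Suc ` T) ` Pow {..<?n}. ?t S)"
    unfolding wedge_def list.size(4) One_nat_def add_Suc_right add_0_right Pow_Suc
    by (rule sum.union_disjoint[OF _ _ disj]) simp_all
  also have "(\<Sum>S\<in>(\<lambda>T. insert 0 (Suc ` T)) ` Pow {..<?n}. ?t S) = (ins v \<omega> \<and>\<^sub>f \<eta>) vs"
    by (subst sum.reindex[OF inj0]) (auto intro!: sum.cong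
      simp: wedge_def shuffle_sign_insert_0 nths_Cons ins_def image_iff Compl_eq)
  also have "(\<Sum>S\<in>(\<lambda>T. Suc ` T) ` Pow {..<?n}. ?t S) = (sg \<omega> \<and>\<^sub>f ins v \<eta>) vs"
  proof (subst sum.reindex[OF inj1], unfold wedge_def, rule sum.cong[OF refl], goal_cases)
    case (1 T)
    \<comment> \<open>This identifies \<open>card T\<close> with the length of
      \<open>nths vs T\<close>, the number of arguments on which \<open>sg\<close> acts.\<close>
    then have "finite T" "{i. i < length vs \<and> i \<in> T} = T"
      by (auto intro: finite_subset)
    then show ?case
      by (simp add: nths_Cons image_iff Compl_eq ins_def sg_def shuffle_sign_Suc length_nths)
  qed
  finally show ?thesis .
qed

lemma ins_wedge: "ins v (\<omega> \<and>\<^sub>f \<eta>) = ins v \<omega> \<and>\<^sub>f \<eta> + sg \<omega> \<and>\<^sub>f ins v \<eta>"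
  by (auto simp: fun_eq_iff ins_apply wedge_Cons)

lemma sg_wedge: "sg (\<omega> \<and>\<^sub>f \<eta>) = sg \<omega> \<and>\<^sub>f sg \<eta>"
proof
  fix vs show "sg (\<omega> \<and>\<^sub>f \<eta>) vs = (sg \<omega> \<and>\<^sub>f sg \<eta>) vs"
  proof (induction vs arbitrary: \<omega> \<eta>)
    case (Cons v vs)
    have "sg (\<omega> \<and>\<^sub>f \<eta>) (v # vs) = - (sg (ins v \<omega> \<and>\<^sub>f \<eta>) vs + sg (sg \<omega> \<and>\<^sub>f ins v \<eta>) vs)"
      by (simp add: sg_def wedge_Cons algebra_simps)
    then show ?case
      by (simp add: Cons.IH wedge_Cons)
  qed (simp add: sg_def)
qed

text \<open>Both sides obey the same recursion on the argument list. The factors are generalized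
  because each step replaces some of them by their images under \<open>ins\<close> and
  \<open>sg\<close>.\<close>

lemma wedge_assoc: "(\<omega> \<and>\<^sub>f \<eta>) \<and>\<^sub>f \<zeta> = \<omega> \<and>\<^sub>f \<eta> \<and>\<^sub>f \<zeta>"
proof
  fix vs show "((\<omega> \<and>\<^sub>f \<eta>) \<and>\<^sub>f \<zeta>) vs = (\<omega> \<and>\<^sub>f \<eta> \<and>\<^sub>f \<zeta>) vs"
    by (induction vs arbitrary: \<omega> \<eta> \<zeta>)
      (simp_all add: wedge_Cons ins_wedge sg_wedge wedge_add_left wedge_add_right)
qed

text \<open>The flags \<open>p\<close> and \<open>q\<close> say whether the factors are odd.
  Contraction flips a parity, so the induction has to treat the four combinations together.\<close>

lemma wedge_commute_parity:
  assumes "sg \<omega> = (if p then - \<omega> else \<omega>)" "sg \<eta> = (if q then - \<eta> else \<eta>)"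
  shows "\<omega> \<and>\<^sub>f \<eta> = (if p \<and> q then - (\<eta> \<and>\<^sub>f \<omega>) else \<eta> \<and>\<^sub>f \<omega>)"
proof
  fix vs show "(\<omega> \<and>\<^sub>f \<eta>) vs = (if p \<and> q then - (\<eta> \<and>\<^sub>f \<omega>) else \<eta> \<and>\<^sub>f \<omega>) vs"
    using assms
  proof (induction vs arbitrary: \<omega> \<eta> p q)
    case (Cons v vs)
    have flip: "sg (ins v \<omega>) = (if \<not> r then - ins v \<omega> else ins v \<omega>)"
      if "sg \<omega> = (if r then - \<omega> else \<omega>)" for \<omega> r
      unfolding sg_ins that by (cases r) simp_all
    have *: "sg \<omega> = (if p then - \<omega> else \<omega>)" "sg \<eta> = (if q then - \<eta> else \<eta>)"
      using Cons.prems by (simp_all add: fun_eq_iff)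
    have i1: "(ins v \<omega> \<and>\<^sub>f \<eta>) vs = (if \<not> p \<and> q then - (\<eta> \<and>\<^sub>f ins v \<omega>) else \<eta> \<and>\<^sub>f ins v \<omega>) vs"
      by (rule Cons.IH[OF flip[OF *(1)] *(2)])
    have i2: "(\<omega> \<and>\<^sub>f ins v \<eta>) vs = (if p \<and> \<not> q then - (ins v \<eta> \<and>\<^sub>f \<omega>) else ins v \<eta> \<and>\<^sub>f \<omega>) vs"
      by (rule Cons.IH[OF *(1) flip[OF *(2)]])
    show ?case
      by (cases p; cases q; simp add: wedge_Cons i1 i2 *)
  next
    case (Nil \<omega> \<eta> p q)
    \<comment> \<open>On the empty list \<open>sg\<close> is the identity, so an odd function equals
      its own negative there.\<close>
    have "\<omega> [] = 0" if p
      using fun_cong[OF Nil(1), of "[]"] that by (simp add: sg_def)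
    then show ?case by auto
  qed
qed

lemma wedge_commute_even: "sg \<omega> = \<omega> \<Longrightarrow> sg \<eta> = \<eta> \<or> sg \<eta> = - \<eta> \<Longrightarrow> \<omega> \<and>\<^sub>f \<eta> = \<eta> \<and>\<^sub>f \<omega>"
  using wedge_commute_parity[of \<omega> False \<eta> False] wedge_commute_parity[of \<omega> False \<eta> True] by auto

lemma wedge_anticommute: "sg \<omega> = - \<omega> \<Longrightarrow> sg \<eta> = - \<eta> \<Longrightarrow> \<omega> \<and>\<^sub>f \<eta> = - (\<eta> \<and>\<^sub>f \<omega>)"
  using wedge_commute_parity[of \<omega> True \<eta> True] by auto

lemma wedge_self_odd: "sg \<omega> = - \<omega> \<Longrightarrow> \<omega> \<and>\<^sub>f \<omega> = 0"
  using wedge_anticommute[of \<omega> \<omega>] by (simp add: fun_eq_iff)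

lemma conjf_wedge: "conjf (\<omega> \<and>\<^sub>f \<eta>) = conjf \<omega> \<and>\<^sub>f conjf \<eta>"
  by (auto simp: conjf_def wedge_def fun_eq_iff nths_map shuffle_sign_def)

section \<open>Alternating forms and primitivity\<close>

definition multilin :: "pform \<Rightarrow> bool" where
  "multilin \<omega> \<longleftrightarrow> (\<forall>us v w vs a b.
     \<omega> (us @ (a *s v + b *s w) # vs) = a * \<omega> (us @ v # vs) + b * \<omega> (us @ w # vs))"

text \<open>Restricting to adjacent repetitions suits the recursion of the wedge product: two equal
  leading arguments become two successive contractions with the same vector, whose mixed terms
  cancel. With multilinearity, full alternation is recovered in
  \<open>adj_alternating_alternating\<close>.\<close>

definition adj_alternating :: "pform \<Rightarrow> bool" where
  "adj_alternating \<omega> \<longleftrightarrow> (\<forall>us v ws. \<omega> (us @ v # v # ws) = 0)"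

definition homogeneous :: "nat \<Rightarrow> pform \<Rightarrow> bool" where
  "homogeneous k \<omega> \<longleftrightarrow> (\<forall>vs. length vs \<noteq> k \<longrightarrow> \<omega> vs = 0)"

lemma multilin_ins: "multilin \<omega> \<Longrightarrow> multilin (ins v \<omega>)"
  unfolding multilin_def ins_apply by (metis append_Cons)

lemma multilin_sg: "multilin \<omega> \<Longrightarrow> multilin (sg \<omega>)"
  unfolding multilin_def sg_def by (simp add: algebra_simps)

lemma ins_combination:
  "multilin \<omega> \<Longrightarrow> ins (a *s v + b *s w) \<omega> = a *\<^sub>f ins v \<omega> + b *\<^sub>f ins w \<omega>"
  unfolding multilin_def ins_def fscale_def fun_eq_iff plus_fun_apply by (metis append_Nil)

lemma multilin_wedge:
  assumes "multilin \<omega>" "multilin \<eta>"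
  shows "multilin (\<omega> \<and>\<^sub>f \<eta>)"
  unfolding multilin_def
proof (intro allI)
  fix us v w vs a b
  show "(\<omega> \<and>\<^sub>f \<eta>) (us @ (a *s v + b *s w) # vs)
      = a * (\<omega> \<and>\<^sub>f \<eta>) (us @ v # vs) + b * (\<omega> \<and>\<^sub>f \<eta>) (us @ w # vs)"
    using assms
  proof (induction us arbitrary: \<omega> \<eta>)
    case Nil
    then show ?case
      by (simp add: wedge_Cons ins_combination wedge_add_left wedge_add_right) (simp add: fscale_def algebra_simps)
  next
    case (Cons u us)
    then show ?case
      by (simp add: wedge_Cons multilin_ins multilin_sg algebra_simps)
  qed
qed

lemma adj_alternating_ins: "adj_alternating \<omega> \<Longrightarrow> adj_alternating (ins v \<omega>)"
  unfolding adj_alternating_def ins_apply by (metis append_Cons)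

lemma adj_alternating_sg: "adj_alternating \<omega> \<Longrightarrow> adj_alternating (sg \<omega>)"
  unfolding adj_alternating_def sg_def by simp

lemma ins_ins_self: "adj_alternating \<omega> \<Longrightarrow> ins v (ins v \<omega>) = 0"
  unfolding adj_alternating_def ins_def fun_eq_iff by (metis append_Nil zero_fun_apply)

lemma adj_alternating_wedge:
  assumes "adj_alternating \<omega>" "adj_alternating \<eta>"
  shows "adj_alternating (\<omega> \<and>\<^sub>f \<eta>)"
  unfolding adj_alternating_def
proof (intro allI)
  fix us v ws
  show "(\<omega> \<and>\<^sub>f \<eta>) (us @ v # v # ws) = 0"
    using assms
  proof (induction us arbitrary: \<omega> \<eta>)
    case Nil
    then show ?case
      by (simp add: wedge_Cons ins_ins_self)
  next
    case (Cons u us)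
    then show ?case
      by (simp add: wedge_Cons adj_alternating_ins adj_alternating_sg)
  qed
qed

lemma adj_alternating_swap:
  assumes "multilin \<omega>" "adj_alternating \<omega>"
  shows "\<omega> (us @ v # w # ws) = - \<omega> (us @ w # v # ws)"
proof -
  have add: "\<omega> (us @ (x + y) # ws) = \<omega> (us @ x # ws) + \<omega> (us @ y # ws)" for us x y ws
    using assms(1)[unfolded multilin_def, rule_format, of us 1 x 1 y ws] by simp
  have "0 = \<omega> (us @ (v + w) # (v + w) # ws)"
    using assms(2) by (simp add: adj_alternating_def)
  also have "\<dots> = \<omega> (us @ v # (v + w) # ws) + \<omega> (us @ w # (v + w) # ws)"
    by (rule add)
  also have "\<omega> (us @ v # (v + w) # ws) = \<omega> (us @ v # w # ws)"
    using add[of "us @ [v]" v w ws] assms(2) by (simp add: adj_alternating_def)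
  also have "\<omega> (us @ w # (v + w) # ws) = \<omega> (us @ w # v # ws)"
    using add[of "us @ [w]" v w ws] assms(2) by (simp add: adj_alternating_def)
  finally show ?thesis
    by (simp add: eq_neg_iff_add_eq_0)
qed

text \<open>Adjacent swaps carry the first \<open>v\<close> to the right until it meets the
  second.\<close>

lemma adj_alternating_alternating:
  assumes "multilin \<omega>" "adj_alternating \<omega>"
  shows "\<omega> (us @ v # vs @ v # ws) = 0"
proof (induction vs arbitrary: us)
  case Nil
  then show ?case
    using assms(2) by (simp add: adj_alternating_def)
next
  case (Cons w vs)
  show ?case
    using Cons.IH[of "us @ [w]"] adj_alternating_swap[OF assms, of us v w "vs @ v # ws"] by simp
qed

lemma is_form_iff: "is_form k \<omega> \<longleftrightarrow> homogeneous k \<omega> \<and> multilin \<omega> \<and> adj_alternating \<omega>"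
proof
  assume *: "is_form k \<omega>"
  then have "\<omega> (us @ v # [] @ v # ws) = 0" for us v ws
    unfolding is_form_def by blast
  with * show "homogeneous k \<omega> \<and> multilin \<omega> \<and> adj_alternating \<omega>"
    unfolding is_form_def homogeneous_def multilin_def adj_alternating_def by simp
next
  assume "homogeneous k \<omega> \<and> multilin \<omega> \<and> adj_alternating \<omega>"
  then show "is_form k \<omega>"
    unfolding is_form_def using adj_alternating_alternating[of \<omega>]
    by (auto simp: homogeneous_def multilin_def)
qed

lemma homogeneous_wedge:
  assumes "homogeneous k \<omega>" "homogeneous l \<eta>"
  shows "homogeneous (k + l) (\<omega> \<and>\<^sub>f \<eta>)"
  unfolding homogeneous_def wedge_def
proof (intro allI impI sum.neutral ballI)
  fix vs :: "cvec list" and S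
  assume *: "length vs \<noteq> k + l"
  have "length (nths vs S) + length (nths vs (- S))
      = card ({i. i < length vs \<and> i \<in> S} \<union> {i. i < length vs \<and> i \<in> - S})"
    unfolding length_nths by (rule card_Un_disjoint[symmetric]) auto
  also have "{i. i < length vs \<and> i \<in> S} \<union> {i. i < length vs \<and> i \<in> - S} = {..<length vs}"
    by auto
  finally have "length (nths vs S) \<noteq> k \<or> length (nths vs (- S)) \<noteq> l"
    using * by auto
  then show "shuffle_sign S * \<omega> (nths vs S) * \<eta> (nths vs (- S)) = 0"
    using assms by (auto simp: homogeneous_def)
qed

lemma is_form_wedge: "is_form k \<omega> \<Longrightarrow> is_form l \<eta> \<Longrightarrow> is_form (k + l) (\<omega> \<and>\<^sub>f \<eta>)"
  by (simp add: is_form_iff homogeneous_wedge multilin_wedge adj_alternating_wedge)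

lemma sg_homogeneous: "homogeneous k \<omega> \<Longrightarrow> sg \<omega> = (-1) ^ k *\<^sub>f \<omega>"
  by (fastforce simp: homogeneous_def sg_def fscale_def)

lemma is_form_sg: "is_form k \<omega> \<Longrightarrow> sg \<omega> = (-1) ^ k *\<^sub>f \<omega>"
  by (simp add: is_form_iff sg_homogeneous)

section \<open>Expansion in the coordinate basis and vanishing above degree 8\<close>

lemma sum_ebas: "(\<Sum>m\<in>UNIV. v $ m *s ebas m) = v"
  by (simp add: vec_eq_iff axis_def if_distrib[of "\<lambda>x. _ * x"] cong: if_cong)

lemma multilin_zero:
  assumes "multilin \<omega>"
  shows "\<omega> (us @ 0 # vs) = 0"
  using assms[unfolded multilin_def, rule_format, of us 0 0 0 0 vs] by simp

lemma multilin_sum: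
  assumes "multilin \<omega>"
  shows "\<omega> (us @ (\<Sum>m\<in>M. c m *s x m) # vs) = (\<Sum>m\<in>M. c m * \<omega> (us @ x m # vs))"
proof (induction M rule: infinite_finite_induct)
  case (insert m M)
  then show ?case
    using assms[unfolded multilin_def, rule_format, of us "c m" "x m" 1 "\<Sum>m\<in>M. c m *s x m" vs] by simp
qed (simp_all add: multilin_zero[OF assms])

lemma multilin_expand:
  "multilin \<omega> \<Longrightarrow> \<omega> (us @ v # vs) = (\<Sum>m\<in>UNIV. v $ m * \<omega> (us @ ebas m # vs))"
  using multilin_sum[of \<omega> us "\<lambda>m. v $ m" ebas UNIV vs] by (simp only: sum_ebas)

lemma multilin_eq_zero_on_basis:
  assumes "multilin \<omega>" "\<And>ms. length ms = length vs \<Longrightarrow> \<omega> (map ebas ms) = 0"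
  shows "\<omega> vs = 0"
  using assms
proof (induction vs arbitrary: \<omega>)
  case Nil
  then show ?case by force
next
  case (Cons v vs)
  have "ins (ebas m) \<omega> vs = 0" for m
    by (rule Cons.IH[OF multilin_ins[OF Cons.prems(1)]])
      (use Cons.prems(2)[of "m # _"] in \<open>auto simp: ins_apply\<close>)
  then show ?case
    using multilin_expand[OF Cons.prems(1), of "[]" v vs] by (simp add: ins_apply)
qed

text \<open>Pigeonhole: more than eight basis vectors contain a repetition.\<close>

lemma is_form_gt_8_eq_0:
  assumes "is_form k \<omega>" "8 < k"
  shows "\<omega> = 0"
proof
  fix vs
  have "\<omega> (map ebas ms) = 0" for ms :: "8 list"
  proof (cases "length ms = k")
    case True
    have "\<not> distinct ms"
    proof
      assume "distinct ms"
      then have "length ms \<le> card (UNIV :: 8 set)"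
        using card_mono[of UNIV "set ms"] by (simp add: distinct_card)
      with True assms(2) show False by simp
    qed
    then obtain xs y ys zs where "ms = xs @ [y] @ ys @ [y] @ zs"
      using not_distinct_decomp by blast
    then show ?thesis
      using assms(1) by (simp add: is_form_def)
  qed (use assms(1) in \<open>simp add: is_form_def\<close>)
  then show "\<omega> vs = 0 vs"
    using assms(1) by (simp add: multilin_eq_zero_on_basis is_form_iff)
qed

definition zform :: "complex \<Rightarrow> pform" where
  "zform c = (\<lambda>vs. if vs = [] then c else 0)"

definition dx :: "8 \<Rightarrow> pform" where
  "dx m = (\<lambda>vs. if length vs = 1 then hd vs $ m else 0)"

lemma zform_wedge [simp]: "zform c \<and>\<^sub>f \<eta> = c *\<^sub>f \<eta>"
proof
  have [simp]: "ins v (zform c) = 0" for v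
    by (auto simp: ins_def zform_def fun_eq_iff)
  have [simp]: "sg (zform c) = zform c"
    by (auto simp: sg_def zform_def fun_eq_iff)
  fix vs show "(zform c \<and>\<^sub>f \<eta>) vs = (c *\<^sub>f \<eta>) vs"
    by (induction vs arbitrary: \<eta>) (auto simp: wedge_Cons fscale_def ins_apply, simp add: zform_def)
qed

lemma ins_one_form: "homogeneous 1 \<omega> \<Longrightarrow> ins v \<omega> = zform (\<omega> [v])"
  by (auto simp: ins_def zform_def homogeneous_def fun_eq_iff)

lemma sg_one_form: "homogeneous 1 \<omega> \<Longrightarrow> sg \<omega> = - \<omega>"
  using sg_homogeneous[of 1 \<omega>] by simp

lemma homogeneous_dx: "homogeneous 1 (dx m)"
  by (auto simp: homogeneous_def dx_def)

lemma one_form_wedge_Cons: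
  assumes "homogeneous 1 \<omega>"
  shows "(\<omega> \<and>\<^sub>f \<eta>) (v # vs) = \<omega> [v] * \<eta> vs - (\<omega> \<and>\<^sub>f ins v \<eta>) vs"
  by (simp add: wedge_Cons ins_one_form[OF assms] sg_one_form[OF assms]) (simp add: fscale_def)

lemma dx_wedge_Cons: "(dx m \<and>\<^sub>f \<eta>) (v # vs) = v $ m * \<eta> vs - (dx m \<and>\<^sub>f ins v \<eta>) vs"
  using one_form_wedge_Cons[OF homogeneous_dx] by (simp add: dx_def)

lemma homogeneous_ins: "homogeneous (Suc k) \<omega> \<Longrightarrow> homogeneous k (ins v \<omega>)"
  by (auto simp: homogeneous_def ins_apply)

lemma is_form_ins: "is_form (Suc k) \<omega> \<Longrightarrow> is_form k (ins v \<omega>)"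
  by (simp add: is_form_iff homogeneous_ins multilin_ins adj_alternating_ins)

text \<open>The operator on the left counts the degree. Applied to \<open>v # vs\<close>, the
  leading \<open>v\<close> is either taken by \<open>dx m\<close>, which reassembles
  \<open>v\<close> from its components and yields one copy of \<omega>, or contracted into \<omega>,
  where the induction hypothesis for \<open>ins v \<omega>\<close> supplies the remaining
  \<open>k - 1\<close> copies.\<close>

lemma euler_identity:
  assumes "is_form k \<omega>"
  shows "(\<Sum>m\<in>UNIV. dx m \<and>\<^sub>f ins (ebas m) \<omega>) = of_nat k *\<^sub>f \<omega>"
proof
  fix vs show "(\<Sum>m\<in>UNIV. dx m \<and>\<^sub>f ins (ebas m) \<omega>) vs = (of_nat k *\<^sub>f \<omega>) vs"
    using assms
  proof (induction vs arbitrary: k \<omega>)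
    case Nil
    then show ?case
      by (cases k) (auto simp: fsum_apply fscale_def dx_def is_form_def)
  next
    case (Cons v vs)
    have ml: "multilin \<omega>" and alt: "adj_alternating \<omega>"
      using Cons.prems by (auto simp: is_form_iff)
    have swap: "ins v (ins (ebas m) \<omega>) = - ins (ebas m) (ins v \<omega>)" for m
      using adj_alternating_swap[OF ml alt, of "[]" v "ebas m"] by (simp add: ins_def fun_eq_iff)
    have "(\<Sum>m\<in>UNIV. dx m \<and>\<^sub>f ins (ebas m) \<omega>) (v # vs)
        = (\<Sum>m\<in>UNIV. v $ m * \<omega> (ebas m # vs)) + (\<Sum>m\<in>UNIV. dx m \<and>\<^sub>f ins (ebas m) (ins v \<omega>)) vs"
      by (simp add: fsum_apply dx_wedge_Cons swap ins_apply[of _ \<omega>] sum.distrib)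
    also have "(\<Sum>m\<in>UNIV. v $ m * \<omega> (ebas m # vs)) = \<omega> (v # vs)"
      using multilin_expand[OF ml, of "[]" v vs] by simp
    also have "\<omega> (v # vs) + (\<Sum>m\<in>UNIV. dx m \<and>\<^sub>f ins (ebas m) (ins v \<omega>)) vs = of_nat k * \<omega> (v # vs)"
    proof (cases k)
      case 0
      then have "\<omega> (v # vs) = 0" "ins v \<omega> = 0"
        using Cons.prems by (auto simp: is_form_def ins_def fun_eq_iff)
      then show ?thesis
        by (simp add: fsum_apply)
    next
      case (Suc k')
      then have "is_form k' (ins v \<omega>)"
        using Cons.prems is_form_ins by blast
      from Cons.IH[OF this] show ?thesis
        by (simp add: Suc fscale_def ins_apply[of v \<omega> vs] algebra_simps)
    qed
    finally show ?case
      by (simp add: fscale_def)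
  qed
qed

text \<open>As \<open>J\<close> is even, contraction acts on its powers as an ordinary derivation,
  and the odd form \<open>ins v J\<close> still commutes with \<open>J\<close>; hence the factors 2
  and 3.\<close>

lemma ins_wedge_cube:
  assumes "sg J = J"
  shows "ins v (J \<and>\<^sub>f J) = 2 *\<^sub>f (ins v J \<and>\<^sub>f J)"
    and "ins v (J \<and>\<^sub>f J \<and>\<^sub>f J) = 3 *\<^sub>f (ins v J \<and>\<^sub>f J \<and>\<^sub>f J)"
proof -
  have odd: "sg (ins v J) = - ins v J"
    unfolding sg_ins assms by simp
  then have comm: "J \<and>\<^sub>f ins v J \<and>\<^sub>f \<eta> = ins v J \<and>\<^sub>f J \<and>\<^sub>f \<eta>" "J \<and>\<^sub>f ins v J = ins v J \<and>\<^sub>f J" for \<eta>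
    using wedge_commute_even[OF assms, of "ins v J"] by (simp_all flip: wedge_assoc)
  show *: "ins v (J \<and>\<^sub>f J) = 2 *\<^sub>f (ins v J \<and>\<^sub>f J)"
    by (simp add: ins_wedge assms comm fun_eq_iff fscale_def)
  show "ins v (J \<and>\<^sub>f J \<and>\<^sub>f J) = 3 *\<^sub>f (ins v J \<and>\<^sub>f J \<and>\<^sub>f J)"
    unfolding ins_wedge[of v J "J \<and>\<^sub>f J"] * assms by (simp add: comm) (simp add: fun_eq_iff fscale_def)
qed

text \<open>Contracting the nine-form \<open>\<omega> \<and> J\<^sup>3 = 0\<close> with the bivector \<open>P\<close> gives a nonzero multiple of
  \<open>\<omega> \<and> J\<^sup>2\<close> (the relation \<open>[\<Lambda>, L\<^sup>3] = 3 (H - 2) L\<^sup>2\<close> of the Lefschetz algebra).\<close>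

lemma primitive_wedge_square:
  assumes \<omega>: "is_form 3 \<omega>" and J: "is_form 2 J"
    and anti: "\<And>m n. P n m = - P m n"
    and inv: "\<And>m v. (\<Sum>n\<in>UNIV. P m n * J [ebas n, v]) = - v $ m"
    and prim: "\<And>vs. (\<Sum>m\<in>UNIV. \<Sum>n\<in>UNIV. P m n * \<omega> (ebas m # ebas n # vs)) = 0"
  shows "\<omega> \<and>\<^sub>f J \<and>\<^sub>f J = 0"
proof -
  let ?I = "\<lambda>m. ins (ebas m)"
  let ?J2 = "J \<and>\<^sub>f J" and ?T = "J \<and>\<^sub>f J \<and>\<^sub>f J"
  have sgJ: "sg J = J" and sg\<omega>: "sg \<omega> = - \<omega>"
    using is_form_sg[OF J] is_form_sg[OF \<omega>] by simp_all
  have sgT: "sg ?T = ?T" by (simp add: sg_wedge sgJ)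
  have sgJ2: "sg ?J2 = ?J2" by (simp add: sg_wedge sgJ)
  have sgI\<omega>: "sg (?I m \<omega>) = ?I m \<omega>" for m
    unfolding sg_ins sg\<omega> by simp
  have sgIJ: "sg (?I m J) = - ?I m J" for m
    unfolding sg_ins sgJ by simp
  have sgdx: "sg (dx m) = - dx m" for m
    by (rule sg_one_form[OF homogeneous_dx])
  have IT: "?I m ?T = 3 *\<^sub>f (?I m J \<and>\<^sub>f ?J2)" and IJ2: "?I m ?J2 = 2 *\<^sub>f (?I m J \<and>\<^sub>f J)" for m
    by (rule ins_wedge_cube[OF sgJ])+
  \<comment> \<open>\<open>P\<close> is minus the inverse of \<open>J\<close>, so contracting one
    index of \<open>P\<close> into \<open>J\<close> leaves \<open>- dx m\<close>. Every contraction
    below is thereby reduced to the Euler identity.\<close>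
  have PJ: "(\<Sum>n\<in>UNIV. P m n *\<^sub>f ?I n J) = - dx m" for m
  proof
    fix vs
    show "(\<Sum>n\<in>UNIV. P m n *\<^sub>f ?I n J) vs = (- dx m) vs"
    proof (cases "length vs = 1")
      case True
      then obtain v where "vs = [v]" by (auto simp: length_Suc_conv)
      then show ?thesis
        using inv[of m v] by (simp add: fsum_apply fscale_def ins_apply dx_def)
    next
      case False
      then show ?thesis
        using J by (simp add: fsum_apply fscale_def ins_apply dx_def is_form_def)
    qed
  qed
  have PJw: "(\<Sum>n\<in>UNIV. P m n *\<^sub>f (\<eta> \<and>\<^sub>f ?I n J \<and>\<^sub>f \<zeta>)) = - (\<eta> \<and>\<^sub>f dx m \<and>\<^sub>f \<zeta>)" for m \<eta> \<zeta>
  proof -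
    have "(\<Sum>n\<in>UNIV. P m n *\<^sub>f (\<eta> \<and>\<^sub>f ?I n J \<and>\<^sub>f \<zeta>)) = \<eta> \<and>\<^sub>f (\<Sum>n\<in>UNIV. P m n *\<^sub>f ?I n J) \<and>\<^sub>f \<zeta>"
      by (simp add: wedge_sum_left wedge_sum_right)
    then show ?thesis by (simp add: PJ)
  qed
  have T0: "\<omega> \<and>\<^sub>f ?T = 0"
    using is_form_wedge[OF \<omega> is_form_wedge[OF J is_form_wedge[OF J J]]] by (rule is_form_gt_8_eq_0) simp
  let ?S = "\<lambda>F. \<Sum>m\<in>UNIV. \<Sum>n\<in>UNIV. P m n *\<^sub>f F m n"
  have S_add: "?S (\<lambda>m n. F m n + G m n) = ?S F + ?S G" for F G :: "8 \<Rightarrow> 8 \<Rightarrow> pform"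
    by (simp add: fscale_add_right sum.distrib)
  have S_scale: "?S (\<lambda>m n. c *\<^sub>f F m n) = c *\<^sub>f ?S F" for c and F :: "8 \<Rightarrow> 8 \<Rightarrow> pform"
    by (simp add: fscale_sum mult.commute)
  have S_swap: "?S (\<lambda>m n. F n m) = - ?S F" for F :: "8 \<Rightarrow> 8 \<Rightarrow> pform"
    by (subst sum.swap) (subst anti, simp add: fun_eq_iff fsum_apply fscale_def sum_negf)
  have S_wedge: "?S (\<lambda>m n. F m n \<and>\<^sub>f \<eta>) = ?S F \<and>\<^sub>f \<eta>" "?S (\<lambda>m n. \<eta> \<and>\<^sub>f F m n) = \<eta> \<and>\<^sub>f ?S F" for \<eta> F
    by (simp_all add: wedge_sum_left wedge_sum_right)
  \<comment> \<open>The coefficient is -(3 * 3): one 3 from differentiating the cube, the other from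
    the degree of \<omega> in the Euler identity, and the sign from \<open>PJ\<close>.\<close>
  have A1: "?S (\<lambda>m n. ?I m \<omega> \<and>\<^sub>f ?I n ?T) = (-9) *\<^sub>f (\<omega> \<and>\<^sub>f ?J2)"
  proof -
    have "?S (\<lambda>m n. ?I m \<omega> \<and>\<^sub>f ?I n ?T) = 3 *\<^sub>f ?S (\<lambda>m n. ?I m \<omega> \<and>\<^sub>f ?I n J \<and>\<^sub>f ?J2)"
      by (simp only: IT wedge_scale S_scale)
    also have "\<dots> = 3 *\<^sub>f (\<Sum>m\<in>UNIV. - ((?I m \<omega> \<and>\<^sub>f dx m) \<and>\<^sub>f ?J2))"
      by (simp only: PJw wedge_assoc)
    also have "(\<Sum>m\<in>UNIV. - ((?I m \<omega> \<and>\<^sub>f dx m) \<and>\<^sub>f ?J2)) = - ((\<Sum>m\<in>UNIV. dx m \<and>\<^sub>f ?I m \<omega>) \<and>\<^sub>f ?J2)"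
      using wedge_commute_even[OF sgI\<omega>, of "dx _"] sgdx by (simp add: wedge_sum_left sum_negf)
    finally show ?thesis
      by (simp add: euler_identity[OF \<omega>])
  qed
  \<comment> \<open>The full contraction of \<open>P\<close> with \<open>J\<close> is the trace of
    the identity, namely the dimension 8.\<close>
  have A2: "?S (\<lambda>m n. ?I n (?I m J)) = zform 8"
  proof
    fix vs
    have swapJ: "J [ebas m, ebas n] = - J [ebas n, ebas m]" for m n
      using adj_alternating_swap[of J "[]" "ebas m" "ebas n" "[]"] J by (simp add: is_form_iff)
    have "(\<Sum>m\<in>UNIV. \<Sum>n\<in>UNIV. P m n * J [ebas m, ebas n]) = (\<Sum>m\<in>UNIV. - (\<Sum>n\<in>UNIV. P m n * J [ebas n, ebas m]))"
      unfolding sum_negf[symmetric] by (intro sum.cong refl) (subst swapJ, simp)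
    also have "\<dots> = 8"
      by (simp add: inv)
    finally show "?S (\<lambda>m n. ?I n (?I m J)) vs = zform 8 vs"
      using J by (cases vs) (simp_all add: fsum_apply fscale_def ins_apply zform_def is_form_def)
  qed
  have A3: "?S (\<lambda>m n. ?I m J \<and>\<^sub>f ?I n J \<and>\<^sub>f J) = 2 *\<^sub>f ?J2"
  proof -
    have "?S (\<lambda>m n. ?I m J \<and>\<^sub>f ?I n J \<and>\<^sub>f J) = (\<Sum>m\<in>UNIV. (dx m \<and>\<^sub>f ?I m J) \<and>\<^sub>f J)"
      by (simp only: PJw) (simp add: wedge_anticommute[OF sgIJ sgdx] flip: wedge_assoc)
    also have "\<dots> = (\<Sum>m\<in>UNIV. dx m \<and>\<^sub>f ?I m J) \<and>\<^sub>f J"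
      by (simp only: wedge_sum_left)
    finally show ?thesis
      by (simp add: euler_identity[OF J])
  qed
  have IIT: "?I n (?I m ?T) = 3 *\<^sub>f (?I n (?I m J) \<and>\<^sub>f ?J2) + (-6) *\<^sub>f (?I m J \<and>\<^sub>f ?I n J \<and>\<^sub>f J)" for m n
    unfolding IT ins_linear(3) ins_wedge[of "ebas n" "?I m J" ?J2] IJ2 sgIJ by (simp add: fscale_add_right)
  \<comment> \<open>3 * 8 from the terms in which both contractions hit the same \<open>J\<close>,
    and -6 * 2 from those in which they hit different ones.\<close>
  have A4: "?S (\<lambda>m n. ?I n (?I m ?T)) = 12 *\<^sub>f ?J2"
    unfolding IIT S_add S_scale S_wedge A2 A3 by (simp add: fun_eq_iff fscale_def)
  have A5: "?S (\<lambda>m n. ?I n (?I m \<omega>)) = 0"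
    using prim by (simp add: fun_eq_iff fsum_apply fscale_def ins_apply)
  have "?I n (?I m (\<omega> \<and>\<^sub>f ?T)) = ?I n (?I m \<omega>) \<and>\<^sub>f ?T + (?I m \<omega> \<and>\<^sub>f ?I n ?T
      + ((-1) *\<^sub>f (?I n \<omega> \<and>\<^sub>f ?I m ?T) + \<omega> \<and>\<^sub>f ?I n (?I m ?T)))" for m n
    unfolding ins_wedge[of _ \<omega> ?T] ins_linear ins_wedge[of _ "?I m \<omega>"] sg\<omega> sgI\<omega>
    by (simp add: ins_wedge[of _ \<omega> "?I m ?T"] sg\<omega>)
  \<comment> \<open>The two mixed terms contribute -9 each, the second after exchanging the indices
    of the antisymmetric \<open>P\<close>. Both contractions on the cube give 12, and both on
    \<omega> give 0 by primitivity: -9 - 9 + 12 = -6.\<close>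
  then have "?S (\<lambda>m n. ?I n (?I m (\<omega> \<and>\<^sub>f ?T))) = (-6) *\<^sub>f (\<omega> \<and>\<^sub>f ?J2)"
    by (simp only: S_add S_scale S_wedge S_swap[of "\<lambda>m n. ?I m \<omega> \<and>\<^sub>f ?I n ?T"] A1 A4 A5)
      (simp flip: fscale_add_left)
  then have "(-6) *\<^sub>f (\<omega> \<and>\<^sub>f ?J2) = 0"
    by (simp add: T0)
  then show ?thesis
    by (simp add: fun_eq_iff fscale_def)
qed

section \<open>Pointwise geometry of SU(4)-structures\<close>

lemma cnjv_simps [simp]:
  "cnjv (cnjv v) = v" "cnjv 0 = 0" "cnjv (v + w) = cnjv v + cnjv w" "cnjv (v - w) = cnjv v - cnjv w"
  "cnjv (c *s v) = cnj c *s cnjv v"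
  by (simp_all add: cnjv_def vec_eq_iff)

lemma T10_iff: "v \<in> T10 \<Omega> \<longleftrightarrow> cnjv v \<in> T01 \<Omega>"
  unfolding T10_def by (metis cnjv_simps(1) image_iff)

lemma T01_scale: "c \<noteq> 0 \<Longrightarrow> T01 (c *\<^sub>f \<Omega>) = T01 \<Omega>"
  by (simp add: T01_def fscale_def)

lemma acs_scale:
  assumes "c \<noteq> 0"
  shows "T10 (c *\<^sub>f \<Omega>) = T10 \<Omega>" "p10 (c *\<^sub>f \<Omega>) = p10 \<Omega>" "acs (c *\<^sub>f \<Omega>) = acs \<Omega>"
    "determines_acs (c *\<^sub>f \<Omega>) = determines_acs \<Omega>"
  using T01_scale[OF assms, of \<Omega>]
  by (simp_all add: T10_def p10_def[abs_def] p01_def[abs_def] acs_def[abs_def] determines_acs_def)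

lemma is_form_scale: "is_form k \<omega> \<Longrightarrow> is_form k (c *\<^sub>f \<omega>)"
  by (simp add: is_form_def fscale_def algebra_simps)

section \<open>The splitting of complex vectors into types (1,0) and (0,1)\<close>

locale acs_form =
  fixes \<Omega> :: pform
  assumes form: "is_form 4 \<Omega>" and det: "determines_acs \<Omega>"
begin

lemma T01_combination: "v \<in> T01 \<Omega> \<Longrightarrow> w \<in> T01 \<Omega> \<Longrightarrow> a *s v + b *s w \<in> T01 \<Omega>"
  using form[unfolded is_form_iff] ins_combination[of \<Omega> a v b w]
  by (simp add: T01_def ins_def fscale_def fun_eq_iff)

lemma T10_combination: "v \<in> T10 \<Omega> \<Longrightarrow> w \<in> T10 \<Omega> \<Longrightarrow> a *s v + b *s w \<in> T10 \<Omega>"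
  unfolding T10_iff by (simp add: T01_combination)

lemma p10_unique: "u \<in> T10 \<Omega> \<Longrightarrow> v - u \<in> T01 \<Omega> \<Longrightarrow> p10 \<Omega> v = u"
  unfolding p10_def by (rule the1_equality) (use det in \<open>auto simp: determines_acs_def\<close>)

lemma p10_in: "p10 \<Omega> v \<in> T10 \<Omega>" and p01_in: "p01 \<Omega> v \<in> T01 \<Omega>"
  using theI'[of "\<lambda>u. u \<in> T10 \<Omega> \<and> v - u \<in> T01 \<Omega>"] det
  by (auto simp: determines_acs_def p10_def p01_def)

lemma p10_p01: "p10 \<Omega> v + p01 \<Omega> v = v"
  by (simp add: p01_def)

lemma p10_linear: "p10 \<Omega> (a *s v + b *s w) = a *s p10 \<Omega> v + b *s p10 \<Omega> w"
proof (rule p10_unique)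
  have "a *s v + b *s w - (a *s p10 \<Omega> v + b *s p10 \<Omega> w) = a *s p01 \<Omega> v + b *s p01 \<Omega> w"
    by (simp add: p01_def vec_eq_iff algebra_simps)
  then show "a *s v + b *s w - (a *s p10 \<Omega> v + b *s p10 \<Omega> w) \<in> T01 \<Omega>"
    by (simp add: T01_combination p01_in)
qed (intro T10_combination p10_in)

lemma zero_in_T01: "0 \<in> T01 \<Omega>"
  using T01_combination[OF p01_in p01_in, of 0 undefined 0 undefined] by simp

lemma p10_T10: "v \<in> T10 \<Omega> \<Longrightarrow> p10 \<Omega> v = v"
  by (rule p10_unique) (simp_all add: zero_in_T01)

lemma p10_T01: "v \<in> T01 \<Omega> \<Longrightarrow> p10 \<Omega> v = 0"
  by (rule p10_unique) (simp_all add: zero_in_T01 T10_iff)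

lemma p10_cnjv: "p10 \<Omega> (cnjv v) = cnjv (p01 \<Omega> v)"
proof (rule p10_unique)
  have "cnjv v - cnjv (p01 \<Omega> v) = cnjv (p10 \<Omega> v)"
    by (simp add: p01_def)
  then show "cnjv v - cnjv (p01 \<Omega> v) \<in> T01 \<Omega>"
    using p10_in[of v] by (simp add: T10_iff)
qed (simp add: T10_iff p01_in)

lemma acs_T10: "v \<in> T10 \<Omega> \<Longrightarrow> acs \<Omega> v = \<i> *s v"
  by (simp add: acs_def p01_def p10_T10)

lemma acs_T01: "v \<in> T01 \<Omega> \<Longrightarrow> acs \<Omega> v = - (\<i> *s v)"
  by (simp add: acs_def p01_def p10_T01)

lemma acs_linear: "acs \<Omega> (a *s v + b *s w) = a *s acs \<Omega> v + b *s acs \<Omega> w"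
  by (simp add: acs_def p01_def p10_linear vec_eq_iff algebra_simps)

lemma acs_acs: "acs \<Omega> (acs \<Omega> v) = - v"
proof -
  have "acs \<Omega> v = \<i> *s p10 \<Omega> v + (- \<i>) *s p01 \<Omega> v"
    by (simp add: acs_def vec_eq_iff)
  then have "acs \<Omega> (acs \<Omega> v) = \<i> *s (\<i> *s p10 \<Omega> v) + (- \<i>) *s (- (\<i> *s p01 \<Omega> v))"
    by (simp only: acs_linear acs_T10[OF p10_in] acs_T01[OF p01_in])
  also have "\<dots> = - (p10 \<Omega> v + p01 \<Omega> v)"
    by (simp add: vec_eq_iff algebra_simps)
  finally show ?thesis
    by (simp only: p10_p01)
qed

end

lemma is_form_bilinear:
  assumes "is_form 2 J"
  shows "J [a *s u + b *s v, w] = a * J [u, w] + b * J [v, w]"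
    and "J [w, a *s u + b *s v] = a * J [w, u] + b * J [w, v]"
    and "J [u, v] = - J [v, u]"
proof -
  have "multilin J" "adj_alternating J"
    using assms by (auto simp: is_form_iff)
  note * = this(1)[unfolded multilin_def, rule_format] and ** = adj_alternating_swap[OF this]
  show "J [a *s u + b *s v, w] = a * J [u, w] + b * J [v, w]"
    using *[of "[]" a u b v "[w]"] by simp
  show "J [w, a *s u + b *s v] = a * J [w, u] + b * J [w, v]"
    using *[of "[w]" a u b v "[]"] by simp
  show "J [u, v] = - J [v, u]"
    using **[of "[]" u v "[]"] by simp
qed

section \<open>Metric and inverse of the two-form at a point\<close>

locale su4_point = acs_form +
  fixes J :: pform
  assumes form_J: "is_form 2 J" and real_J: "conjf J = J" and \<Omega>_nonzero: "\<Omega> \<noteq> 0"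
    and J_wedge_\<Omega>: "J \<and>\<^sub>f \<Omega> = 0"
    and pos: "\<And>v. v \<noteq> 0 \<Longrightarrow> 0 < Re (gmet J \<Omega> (cvec_of v) (cvec_of v))"
begin

text \<open>Contracting the product of \<open>J\<close> and \<Omega> with two vectors that
  annihilate \<Omega> leaves \<open>J [u, v]\<close> times \<Omega>. As \<Omega> is nonzero,
  \<open>J\<close> has no (0,2)-part; reality then excludes a (2,0)-part.\<close>

lemma J_T01: assumes "u \<in> T01 \<Omega>" "v \<in> T01 \<Omega>" shows "J [u, v] = 0"
proof -
  obtain vs where vs: "\<Omega> vs \<noteq> 0"
    using \<Omega>_nonzero by (auto simp: fun_eq_iff)
  have ins0: "ins u \<Omega> = 0" "ins v \<Omega> = 0"
    using assms by (auto simp: T01_def ins_def fun_eq_iff)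
  have "ins v (ins u J) = zform (J [u, v])"
    using form_J by (auto simp: ins_def zform_def is_form_def fun_eq_iff)
  then have "(J \<and>\<^sub>f \<Omega>) (u # v # vs) = J [u, v] * \<Omega> vs"
    by (simp add: wedge_Cons ins0) (simp add: fscale_def)
  then show ?thesis
    using vs by (simp add: J_wedge_\<Omega>)
qed

lemma J_T10: assumes "u \<in> T10 \<Omega>" "v \<in> T10 \<Omega>" shows "J [u, v] = 0"
proof -
  have "J [u, v] = cnj (J [cnjv u, cnjv v])"
    using fun_cong[OF real_J, of "[u, v]"] by (simp add: conjf_def)
  then show ?thesis
    using assms by (simp add: T10_iff J_T01)
qed

text \<open>Only the mixed (1,1) terms survive, and on these the eigenvalues i and -i multiply to
  1.\<close>

lemma J_acs_acs: "J [acs \<Omega> u, acs \<Omega> v] = J [u, v]"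
proof -
  have split: "J [a *s p10 \<Omega> u + b *s p01 \<Omega> u, c *s p10 \<Omega> v + d *s p01 \<Omega> v]
      = a * d * J [p10 \<Omega> u, p01 \<Omega> v] + b * c * J [p01 \<Omega> u, p10 \<Omega> v]" for a b c d
    by (simp add: is_form_bilinear(1,2)[OF form_J] J_T01 J_T10 p10_in p01_in)
  have "J [u, v] = J [1 *s p10 \<Omega> u + 1 *s p01 \<Omega> u, 1 *s p10 \<Omega> v + 1 *s p01 \<Omega> v]"
    by (simp add: p10_p01)
  also have "\<dots> = J [\<i> *s p10 \<Omega> u + (- \<i>) *s p01 \<Omega> u, \<i> *s p10 \<Omega> v + (- \<i>) *s p01 \<Omega> v]"
    unfolding split by simp
  also have "\<dots> = J [acs \<Omega> u, acs \<Omega> v]"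
    by (simp add: acs_def)
  finally show ?thesis by simp
qed

lemma J_eq_gmet: "J [u, v] = gmet J \<Omega> (acs \<Omega> u) v"
  by (simp add: gmet_def J_acs_acs)

lemma gmet_sym: "gmet J \<Omega> u v = gmet J \<Omega> v u"
proof -
  have "J [v, acs \<Omega> u] = J [acs \<Omega> v, 0 *s u + (- 1) *s u]"
    using J_acs_acs[of v "acs \<Omega> u"] acs_acs[of u] by simp
  also have "\<dots> = - J [acs \<Omega> v, u]"
    by (simp only: is_form_bilinear(2)[OF form_J]) simp
  also have "\<dots> = J [u, acs \<Omega> v]"
    using is_form_bilinear(3)[OF form_J, of u "acs \<Omega> v"] by simp
  finally show ?thesis
    unfolding gmet_def by (rule sym)
qed

lemma gmet_linear_right: "gmet J \<Omega> w (a *s u + b *s v) = a * gmet J \<Omega> w u + b * gmet J \<Omega> w v"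
  by (simp add: gmet_def acs_linear is_form_bilinear(2)[OF form_J])

lemma gmet_linear_left: "gmet J \<Omega> (a *s u + b *s v) w = a * gmet J \<Omega> u w + b * gmet J \<Omega> v w"
  by (simp only: gmet_sym[of _ w] gmet_linear_right)

lemma gmet_expand: "gmet J \<Omega> u v = (\<Sum>t\<in>UNIV. u $ t * gmet J \<Omega> (ebas t) v)"
  using multilin_expand[of J "[]" u "[acs \<Omega> v]"] form_J by (simp add: gmet_def is_form_iff)

abbreviation gmat :: "complex^8^8" where
  "gmat \<equiv> \<chi> s t. gmet J \<Omega> (ebas s) (ebas t)"

text \<open>Positivity is only assumed on real vectors; for \<open>x = a + \<i> b\<close> in the kernel of the bilinear
  extension, symmetry gives \<open>g(a,a) + g(b,b) = 0\<close>.\<close>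

lemma gmet_nondegenerate:
  assumes "\<And>y. gmet J \<Omega> y x = 0"
  shows "x = 0"
proof -
  define a b :: "real^8" where "a = (\<chi> m. Re (x $ m))" and "b = (\<chi> m. Im (x $ m))"
  let ?g = "\<lambda>a b. gmet J \<Omega> (cvec_of a) (cvec_of b)"
  have x: "x = 1 *s cvec_of a + \<i> *s cvec_of b"
    by (simp add: vec_eq_iff a_def b_def cvec_of_def complex_eq_iff)
  have 1: "?g a a + \<i> * ?g a b = 0" "?g b a + \<i> * ?g b b = 0"
    using assms[of "cvec_of a"] assms[of "cvec_of b"] unfolding x gmet_linear_right by simp_all
  have "?g b a = ?g a b" by (rule gmet_sym)
  then have "?g a a + ?g b b = (?g a a + \<i> * ?g a b) - \<i> * (?g b a + \<i> * ?g b b)"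
    by (simp add: algebra_simps)
  also have "\<dots> = 0" using 1 by simp
  finally have "Re (?g a a) + Re (?g b b) = 0"
    by (metis plus_complex.simps(1) zero_complex.simps(1))
  \<comment> \<open>\<open>pos\<close> says nothing about the zero vector; this covers the case
    where exactly one of \<open>a\<close> and \<open>b\<close> vanishes.\<close>
  moreover have "?g 0 0 = 0"
    using gmet_linear_left[of 0 0 0 0] by (simp add: cvec_of_def zero_vec_def[symmetric])
  ultimately have "a = 0" "b = 0"
    using pos[of a] pos[of b] by (cases "a = 0"; cases "b = 0"; force)+
  then show ?thesis
    by (simp add: x cvec_of_def vec_eq_iff)
qed

lemma invertible_gmat: "invertible gmat"
proof -
  have "x = 0" if "gmat *v x = 0" for x
  proof (rule gmet_nondegenerate)
    fix y
    have "gmet J \<Omega> (ebas s) x = 0" for s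
    proof -
      have "(\<Sum>t\<in>UNIV. gmet J \<Omega> (ebas s) (ebas t) * x $ t) = 0"
        using that by (simp add: vec_eq_iff matrix_vector_mult_def)
      then show ?thesis
        by (subst gmet_sym, subst gmet_expand) (simp add: gmet_sym[of _ "ebas s"] mult.commute)
    qed
    then show "gmet J \<Omega> y x = 0"
      by (subst gmet_expand) simp
  qed
  then show ?thesis
    by (simp add: invertible_left_inverse matrix_left_invertible_ker)
qed

lemma matrix_inv_mult: "invertible A \<Longrightarrow> matrix_inv A ** A = mat 1"
  unfolding invertible_def matrix_inv_def by (metis (mono_tags, lifting) someI_ex)

lemma ginv_gmet: "(\<Sum>q\<in>UNIV. ginv J \<Omega> n q * gmet J \<Omega> y (ebas q)) = y $ n"
proof -
  have inv: "(\<Sum>q\<in>UNIV. ginv J \<Omega> n q * gmet J \<Omega> (ebas q) (ebas t)) = (if n = t then 1 else 0)" for t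
    using arg_cong[OF matrix_inv_mult[OF invertible_gmat], of "\<lambda>A. A $ n $ t"]
    by (simp add: ginv_def matrix_matrix_mult_def mat_def)
  have "(\<Sum>q\<in>UNIV. ginv J \<Omega> n q * gmet J \<Omega> y (ebas q))
      = (\<Sum>q\<in>UNIV. \<Sum>t\<in>UNIV. y $ t * (ginv J \<Omega> n q * gmet J \<Omega> (ebas q) (ebas t)))"
    by (subst gmet_expand) (simp add: sum_distrib_left mult_ac gmet_sym[of "ebas _" "ebas _"])
  also have "\<dots> = (\<Sum>t\<in>UNIV. y $ t * (\<Sum>q\<in>UNIV. ginv J \<Omega> n q * gmet J \<Omega> (ebas q) (ebas t)))"
    by (subst sum.swap) (simp add: sum_distrib_left)
  also have "\<dots> = y $ n"
    by (simp add: inv if_distrib[of "\<lambda>x. _ * x"] cong: if_cong)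
  finally show ?thesis .
qed

text \<open>\<open>J\<close> with both indices raised: the bivector whose contraction defines
  \<open>primitive\<close>.\<close>

definition Jinv :: "8 \<Rightarrow> 8 \<Rightarrow> complex" where
  "Jinv m n = (\<Sum>p\<in>UNIV. \<Sum>q\<in>UNIV. ginv J \<Omega> m p * ginv J \<Omega> n q * J [ebas p, ebas q])"

lemma Jinv_antisym: "Jinv n m = - Jinv m n"
  unfolding Jinv_def sum_negf[symmetric]
  by (subst sum.swap, intro sum.cong refl, subst is_form_bilinear(3)[OF form_J]) simp

lemma Jinv_eq: "Jinv m n = (\<Sum>p\<in>UNIV. ginv J \<Omega> m p * acs \<Omega> (ebas p) $ n)"
  unfolding Jinv_def
  by (intro sum.cong refl) (simp add: J_eq_gmet mult.assoc ginv_gmet flip: sum_distrib_left)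

text \<open>By \<open>Jinv_eq\<close>, one raised index turns \<open>J\<close> into the components
  of the almost complex structure. Contracting these with \<open>J\<close> gives the metric back,
  with a minus sign from the antisymmetry of \<open>J\<close>, and the other raised index cancels
  the metric.\<close>

lemma Jinv_J: "(\<Sum>n\<in>UNIV. Jinv m n * J [ebas n, v]) = - v $ m"
proof -
  have "(\<Sum>n\<in>UNIV. Jinv m n * J [ebas n, v])
      = (\<Sum>p\<in>UNIV. ginv J \<Omega> m p * (\<Sum>n\<in>UNIV. acs \<Omega> (ebas p) $ n * J [ebas n, v]))"
    unfolding Jinv_eq sum_distrib_left sum_distrib_right by (subst sum.swap) (simp add: mult_ac)
  also have "\<dots> = (\<Sum>p\<in>UNIV. ginv J \<Omega> m p * J [acs \<Omega> (ebas p), v])"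
    using multilin_expand[of J "[]" "acs \<Omega> (ebas _)" "[v]"] form_J by (simp add: is_form_iff)
  also have "\<dots> = - (\<Sum>p\<in>UNIV. ginv J \<Omega> m p * gmet J \<Omega> v (ebas p))"
    by (subst is_form_bilinear(3)[OF form_J]) (simp add: gmet_def sum_negf)
  finally show ?thesis
    by (simp add: ginv_gmet)
qed

lemma primitive_three_form:
  assumes "is_form 3 \<omega>" "primitive J \<Omega> \<omega>"
  shows "\<omega> \<and>\<^sub>f J \<and>\<^sub>f J = 0"
proof (rule primitive_wedge_square[where P = Jinv])
  show "(\<Sum>m\<in>UNIV. \<Sum>n\<in>UNIV. Jinv m n * \<omega> (ebas m # ebas n # vs)) = 0" for vs
    using assms(2) by (simp add: primitive_def Jinv_def sum_distrib_right)
qed (fact assms(1) form_J Jinv_antisym Jinv_J)+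

end

text \<open>A one-form vanishing on the common kernel is a linear combination of the \<theta>s, so
  each term of the product repeats a factor. The combination is found by elimination: if \<theta>
  vanishes on the kernel of the later forms, it does not affect the hypothesis on \<alpha> and may
  be dropped; otherwise a vector \<open>v\<close> of that kernel with
  \<open>\<theta> [v] = 1\<close> exists, and
  \<open>\<alpha> - \<alpha> [v] *\<^sub>f \<theta>\<close> vanishes on the larger kernel.\<close>

lemma one_form_vanishing_on_kernel:
  fixes \<alpha> :: pform
  assumes "\<forall>\<theta>\<in>set \<theta>s. multilin \<theta> \<and> homogeneous 1 \<theta>" "multilin \<alpha>" "homogeneous 1 \<alpha>"
    and "\<And>v. (\<forall>\<theta>\<in>set \<theta>s. \<theta> [v] = 0) \<Longrightarrow> \<alpha> [v] = 0"
  shows "\<alpha> \<and>\<^sub>f foldr (\<and>\<^sub>f) \<theta>s \<eta> = 0"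
  using assms
proof (induction \<theta>s arbitrary: \<alpha>)
  case Nil
  have "\<alpha> = 0"
  proof
    fix vs show "\<alpha> vs = 0 vs"
      using Nil.prems(3,4) by (cases "length vs = 1") (auto simp: homogeneous_def length_Suc_conv)
  qed
  then have "\<alpha> \<and>\<^sub>f foldr (\<and>\<^sub>f) [] \<eta> = 0" by simp
  then show ?case .
next
  case (Cons \<theta> \<theta>s)
  let ?K = "\<lambda>v. \<forall>\<theta>\<in>set \<theta>s. \<theta> [v] = 0"
  have lin: "\<beta> [a *s v] = a * \<beta> [v]" "\<beta> [w + a *s v] = \<beta> [w] + a * \<beta> [v]"
    if "multilin \<beta>" for \<beta> a v w
    using that[unfolded multilin_def, rule_format, of "[]" a v 0 0 "[]"]
      that[unfolded multilin_def, rule_format, of "[]" 1 w a v "[]"] by simp_all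
  have swap: "\<alpha> \<and>\<^sub>f \<theta> \<and>\<^sub>f \<zeta> = - (\<theta> \<and>\<^sub>f \<alpha> \<and>\<^sub>f \<zeta>)" for \<zeta>
    using wedge_anticommute[of \<alpha> \<theta>] Cons.prems by (simp add: sg_one_form flip: wedge_assoc)
  have "\<alpha> \<and>\<^sub>f foldr (\<and>\<^sub>f) (\<theta> # \<theta>s) \<eta> = 0"
  proof (cases "\<forall>v. ?K v \<longrightarrow> \<theta> [v] = 0")
    case True
    then have "\<alpha> \<and>\<^sub>f foldr (\<and>\<^sub>f) \<theta>s \<eta> = 0"
      using Cons.prems by (intro Cons.IH) auto
    then show ?thesis
      by (simp add: swap)
  next
    case False
    then obtain u where u: "?K u" "\<theta> [u] \<noteq> 0" by auto
    define v where "v = inverse (\<theta> [u]) *s u"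
    have v: "?K v" "\<theta> [v] = 1"
      unfolding v_def using u Cons.prems(1) by (auto simp: lin)
    define \<beta> where "\<beta> = \<alpha> - \<alpha> [v] *\<^sub>f \<theta>"
    have "\<beta> \<and>\<^sub>f foldr (\<and>\<^sub>f) \<theta>s \<eta> = 0"
    proof (rule Cons.IH)
      show "\<forall>\<theta>\<in>set \<theta>s. multilin \<theta> \<and> homogeneous 1 \<theta>" "multilin \<beta>" "homogeneous 1 \<beta>"
        using Cons.prems(1-3) by (auto simp: \<beta>_def multilin_def homogeneous_def fscale_def algebra_simps)
      fix w assume w: "?K w"
      \<comment> \<open>\<open>w + c *s v\<close> stays in the kernel of the later forms and is
        annihilated by \<theta> as well, so the hypothesis on \<alpha> applies to it.\<close>
      define c where "c = - \<theta> [w]"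
      have "\<alpha> [w + c *s v] = 0"
        by (rule Cons.prems(4)) (use w v Cons.prems(1) in \<open>auto simp: lin c_def[symmetric] eq_neg_iff_add_eq_0[symmetric]\<close>, simp add: c_def)
      then show "\<beta> [w] = 0"
        by (simp add: lin[OF Cons.prems(2)]) (simp add: c_def \<beta>_def fscale_def algebra_simps)
    qed
    then have "\<alpha> \<and>\<^sub>f foldr (\<and>\<^sub>f) \<theta>s \<eta> = \<alpha> [v] *\<^sub>f (\<theta> \<and>\<^sub>f foldr (\<and>\<^sub>f) \<theta>s \<eta>)"
      by (simp add: \<beta>_def wedge_diff_left)
    moreover have "\<theta> \<and>\<^sub>f \<theta> \<and>\<^sub>f \<zeta> = 0" for \<zeta>
      using wedge_self_odd[of \<theta>] Cons.prems(1) by (simp add: sg_one_form flip: wedge_assoc)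
    ultimately show ?thesis
      by (simp add: swap)
  qed
  then show ?case .
qed

text \<open>A vector annihilated by the four factors of \<Omega> lies in
  \<open>T01 \<Omega>\<close>, so \<alpha> vanishes on their common kernel.\<close>

lemma decomposable4_wedge_eq_0:
  assumes "decomposable4 \<Omega>" "is_form 1 \<alpha>" "\<And>v. v \<in> T01 \<Omega> \<Longrightarrow> \<alpha> [v] = 0"
  shows "\<alpha> \<and>\<^sub>f \<Omega> = 0"
proof -
  from assms(1) obtain t1 t2 t3 t4 where t: "is_form 1 t1" "is_form 1 t2" "is_form 1 t3" "is_form 1 t4"
    and \<Omega>: "\<Omega> = t1 \<and>\<^sub>f t2 \<and>\<^sub>f t3 \<and>\<^sub>f t4"
    unfolding decomposable4_def by blast
  have ker: "\<Omega> (v # vs) = 0" if "t1 [v] = 0" "t2 [v] = 0" "t3 [v] = 0" "t4 [v] = 0" for v vs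
  proof -
    have "ins v t1 = 0" "ins v t2 = 0" "ins v t3 = 0" "ins v t4 = 0"
      using t that ins_one_form[of _ v] by (auto simp: is_form_iff zform_def fun_eq_iff)
    then have "ins v \<Omega> = 0"
      by (simp add: \<Omega> ins_wedge)
    then show ?thesis
      by (simp add: ins_def fun_eq_iff)
  qed
  \<comment> \<open>The unit \<open>zform 1\<close> closes the fold, so that the list of four
    factors yields exactly \<Omega>.\<close>
  have "\<alpha> \<and>\<^sub>f foldr (\<and>\<^sub>f) [t1, t2, t3, t4] (zform 1) = 0"
    by (rule one_form_vanishing_on_kernel)
      (use t assms ker in \<open>auto simp: is_form_iff T01_def\<close>)
  moreover have "t4 \<and>\<^sub>f zform 1 = t4"
  proof -
    have "sg (zform 1) = zform 1" by (auto simp: sg_def zform_def)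
    then show ?thesis
      using wedge_commute_even[of "zform 1" t4] sg_one_form[of t4] t by (simp add: is_form_iff)
  qed
  ultimately show ?thesis
    by (simp add: \<Omega>)
qed

section \<open>Differentiation of forms\<close>

lemma pderiv_atI: "(f has_derivative f') (at x) \<Longrightarrow> pderiv_at m f x = f' (axis m 1)"
  unfolding pderiv_at_def by (metis frechet_derivative_at)

text \<open>The Frechet derivative is a choice among all derivatives at the point. Functions
  agreeing near the point have the same derivatives there, so the choices coincide even if there is
  none.\<close>

lemma pderiv_at_cong:
  assumes "open S" "x \<in> S" "\<And>y. y \<in> S \<Longrightarrow> f y = g y"
  shows "pderiv_at m f x = pderiv_at m g x"
proof -
  have "(f has_derivative f') (at x) = (g has_derivative f') (at x)" for f'
    using has_derivative_transform_within_open[OF _ assms(1,2), of f f' UNIV g]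
      has_derivative_transform_within_open[OF _ assms(1,2), of g f' UNIV f] assms(3) by auto
  then show ?thesis
    by (simp add: pderiv_at_def frechet_derivative_def)
qed

lemma pderiv_at_const [simp]: "pderiv_at m (\<lambda>_. c) x = 0"
  by (rule pderiv_atI[of _ "\<lambda>_. 0"]) simp

lemma differentiable_has_frechet:
  "f differentiable at x \<Longrightarrow> (f has_derivative frechet_derivative f (at x)) (at x)"
  by (simp add: frechet_derivative_works)

lemma pderiv_at_add:
  assumes "f differentiable at x" "g differentiable at x"
  shows "pderiv_at m (\<lambda>y. f y + g y) x = pderiv_at m f x + pderiv_at m g x"
  using has_derivative_add[OF assms[THEN differentiable_has_frechet]]
  by (subst pderiv_atI) (auto simp: pderiv_at_def)

lemma pderiv_at_mult:
  fixes f g :: "real^8 \<Rightarrow> 'b::real_normed_algebra"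
  assumes "f differentiable at x" "g differentiable at x"
  shows "pderiv_at m (\<lambda>y. f y * g y) x = pderiv_at m f x * g x + f x * pderiv_at m g x"
  using has_derivative_mult[OF assms[THEN differentiable_has_frechet]]
  by (subst pderiv_atI) (auto simp: pderiv_at_def algebra_simps)

lemma pderiv_at_sum:
  assumes "\<And>i. i \<in> I \<Longrightarrow> f i differentiable at x"
  shows "pderiv_at m (\<lambda>y. \<Sum>i\<in>I. f i y) x = (\<Sum>i\<in>I. pderiv_at m (f i) x)"
  using has_derivative_sum[of I f, OF differentiable_has_frechet[OF assms]]
  by (subst pderiv_atI) (auto simp: pderiv_at_def)

lemma pderiv_at_exp:
  fixes f :: "real^8 \<Rightarrow> 'b::{real_normed_field, banach}"
  assumes "f differentiable at x"
  shows "pderiv_at m (\<lambda>y. exp (f y)) x = exp (f x) * pderiv_at m f x"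
    and "(\<lambda>y. exp (f y)) differentiable at x"
proof -
  have "(exp has_derivative (*) (exp (f x))) (at (f x))"
    using DERIV_exp[of "f x"] by (simp add: has_field_derivative_def)
  from has_derivative_compose[OF differentiable_has_frechet[OF assms] this]
  have *: "((\<lambda>y. exp (f y)) has_derivative (\<lambda>h. exp (f x) * frechet_derivative f (at x) h)) (at x)" .
  then show "pderiv_at m (\<lambda>y. exp (f y)) x = exp (f x) * pderiv_at m f x"
    by (subst pderiv_atI) (auto simp: pderiv_at_def)
  show "(\<lambda>y. exp (f y)) differentiable at x"
    using * by (rule differentiableI)
qed

lemma pderiv_at_of_real:
  fixes f :: "real^8 \<Rightarrow> real"
  assumes "f differentiable at x"
  shows "pderiv_at m (\<lambda>y. of_real (f y) :: 'b::real_normed_div_algebra) x = of_real (pderiv_at m f x)"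
    and "(\<lambda>y. of_real (f y) :: 'b) differentiable at x"
proof -
  have *: "((\<lambda>y. of_real (f y) :: 'b) has_derivative (\<lambda>h. of_real (frechet_derivative f (at x) h))) (at x)"
    by (rule has_derivative_of_real[OF differentiable_has_frechet[OF assms]])
  then show "pderiv_at m (\<lambda>y. of_real (f y) :: 'b) x = of_real (pderiv_at m f x)"
    by (subst pderiv_atI) (auto simp: pderiv_at_def)
  show "(\<lambda>y. of_real (f y) :: 'b) differentiable at x"
    using * by (rule differentiableI)
qed

text \<open>The rules for derivatives of sums, products and exponentials hold only at points of
  \<open>S\<close>, while \<open>Ck_on\<close> refers to \<open>pderiv_at m f\<close> as a global
  function. This lemma permits replacing it on \<open>S\<close> by the formula.\<close>

lemma Ck_on_cong:
  "Ck_on k S f \<Longrightarrow> open S \<Longrightarrow> (\<And>x. x \<in> S \<Longrightarrow> f x = g x) \<Longrightarrow> Ck_on k S g"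
proof (induction k arbitrary: f g)
  case 0
  then show ?case by (simp cong: continuous_on_cong)
next
  case (Suc k)
  have "g differentiable_on S"
    unfolding differentiable_on_def differentiable_def
  proof
    fix x assume x: "x \<in> S"
    then obtain f' where "(f has_derivative f') (at x within S)"
      using Suc.prems(1) by (auto simp: differentiable_on_def differentiable_def)
    then have "(g has_derivative f') (at x within S)"
      by (rule has_derivative_transform[OF x, rotated]) (simp add: Suc.prems(3))
    then show "\<exists>g'. (g has_derivative g') (at x within S)" by blast
  qed
  moreover have "Ck_on k S (pderiv_at m g)" for m
    by (rule Suc.IH[of "pderiv_at m f"]) (use Suc.prems in \<open>auto intro: pderiv_at_cong\<close>)
  ultimately show ?case by simp
qed

lemma Ck_on_const [simp]: "Ck_on k S (\<lambda>_. c)"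
proof (induction k arbitrary: c)
  case (Suc k)
  have "pderiv_at m (\<lambda>_. c) = (\<lambda>_. 0)" for m by auto
  then show ?case by (simp add: Suc)
qed simp

lemma Ck_on_pred: "Ck_on (Suc k) S f \<Longrightarrow> Ck_on k S f"
  by (induction k arbitrary: f) (auto intro: differentiable_imp_continuous_on)

lemma Ck_on_differentiable: "Ck_on (Suc k) S f \<Longrightarrow> open S \<Longrightarrow> x \<in> S \<Longrightarrow> f differentiable at x"
  by (simp add: differentiable_on_def) (metis at_within_open)

lemma Ck_on_add:
  "Ck_on k S f \<Longrightarrow> Ck_on k S g \<Longrightarrow> open S \<Longrightarrow> Ck_on k S (\<lambda>x. f x + g x)"
proof (induction k arbitrary: f g)
  case 0
  then show ?case by (simp add: continuous_on_add)
next
  case (Suc k)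
  have d: "f differentiable at x" "g differentiable at x" if "x \<in> S" for x
    using Ck_on_differentiable[OF Suc.prems(1,3) that] Ck_on_differentiable[OF Suc.prems(2,3) that] by blast+
  have "Ck_on k S (pderiv_at m (\<lambda>x. f x + g x))" for m
  proof (rule Ck_on_cong)
    show "Ck_on k S (\<lambda>x. pderiv_at m f x + pderiv_at m g x)"
      using Suc by simp
  qed (simp_all add: Suc.prems(3) pderiv_at_add d)
  then show ?case
    using Suc.prems by (simp add: differentiable_on_add)
qed

lemma Ck_on_mult:
  fixes f g :: "real^8 \<Rightarrow> 'b::real_normed_algebra"
  shows "Ck_on k S f \<Longrightarrow> Ck_on k S g \<Longrightarrow> open S \<Longrightarrow> Ck_on k S (\<lambda>x. f x * g x)"
proof (induction k arbitrary: f g)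
  case 0
  then show ?case by (simp add: continuous_on_mult)
next
  case (Suc k)
  have d: "f differentiable at x" "g differentiable at x" if "x \<in> S" for x
    using Ck_on_differentiable[OF Suc.prems(1,3) that] Ck_on_differentiable[OF Suc.prems(2,3) that] by blast+
  have "Ck_on k S (pderiv_at m (\<lambda>x. f x * g x))" for m
  proof (rule Ck_on_cong)
    show "Ck_on k S (\<lambda>x. pderiv_at m f x * g x + f x * pderiv_at m g x)"
      \<comment> \<open>The product rule also contains the undifferentiated factors, which are
        needed here at order \<open>k\<close> instead of \<open>Suc k\<close>.\<close>
      using Suc Ck_on_pred[OF Suc.prems(1)] Ck_on_pred[OF Suc.prems(2)] by (intro Ck_on_add Suc.IH) auto
  qed (simp_all add: Suc.prems(3) pderiv_at_mult d)
  moreover have "(\<lambda>x. f x * g x) differentiable_on S"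
    using Suc.prems by (auto simp: differentiable_on_def intro: differentiable_mult)
  ultimately show ?case by simp
qed

lemma Ck_on_exp:
  fixes f :: "real^8 \<Rightarrow> 'b::{real_normed_field, banach}"
  shows "Ck_on k S f \<Longrightarrow> open S \<Longrightarrow> Ck_on k S (\<lambda>x. exp (f x))"
proof (induction k arbitrary: f)
  case 0
  then show ?case by (simp add: continuous_on_exp)
next
  case (Suc k)
  have d: "f differentiable at x" if "x \<in> S" for x
    using Ck_on_differentiable[OF Suc.prems that] .
  have "Ck_on k S (pderiv_at m (\<lambda>x. exp (f x)))" for m
  proof (rule Ck_on_cong)
    show "Ck_on k S (\<lambda>x. exp (f x) * pderiv_at m f x)"
      using Suc Ck_on_pred[OF Suc.prems(1)] by (intro Ck_on_mult Suc.IH) auto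
  qed (use Suc.prems pderiv_at_exp(1)[OF d] in auto)
  moreover have "(\<lambda>x. exp (f x)) differentiable_on S"
    using pderiv_at_exp(2)[OF d] by (auto simp: differentiable_on_def intro: differentiable_at_withinI)
  ultimately show ?case by simp
qed

lemma Ck_on_of_real:
  "Ck_on k S f \<Longrightarrow> open S \<Longrightarrow> Ck_on k S (\<lambda>x. of_real (f x) :: 'b::real_normed_div_algebra)"
proof (induction k arbitrary: f)
  case 0
  then show ?case by (simp add: continuous_on_of_real)
next
  case (Suc k)
  have d: "f differentiable at x" if "x \<in> S" for x
    using Ck_on_differentiable[OF Suc.prems that] .
  have "Ck_on k S (pderiv_at m (\<lambda>x. of_real (f x) :: 'b))" for m
  proof (rule Ck_on_cong)
    show "Ck_on k S (\<lambda>x. of_real (pderiv_at m f x) :: 'b)"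
      using Suc by (intro Suc.IH) auto
  qed (simp_all add: Suc.prems(2) pderiv_at_of_real(1)[OF d])
  moreover have "(\<lambda>x. of_real (f x) :: 'b) differentiable_on S"
    using pderiv_at_of_real(2)[OF d] by (auto simp: differentiable_on_def intro: differentiable_at_withinI)
  ultimately show ?case by simp
qed

lemma smooth_on_const: "smooth_on S (\<lambda>_. c)"
  by (simp add: smooth_on_def)

lemma smooth_on_add: "smooth_on S f \<Longrightarrow> smooth_on S g \<Longrightarrow> open S \<Longrightarrow> smooth_on S (\<lambda>x. f x + g x)"
  by (simp add: smooth_on_def Ck_on_add)

lemma smooth_on_mult:
  fixes f g :: "real^8 \<Rightarrow> 'b::real_normed_algebra"
  shows "smooth_on S f \<Longrightarrow> smooth_on S g \<Longrightarrow> open S \<Longrightarrow> smooth_on S (\<lambda>x. f x * g x)"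
  by (simp add: smooth_on_def Ck_on_mult)

lemma smooth_on_exp:
  fixes f :: "real^8 \<Rightarrow> 'b::{real_normed_field, banach}"
  shows "smooth_on S f \<Longrightarrow> open S \<Longrightarrow> smooth_on S (\<lambda>x. exp (f x))"
  by (simp add: smooth_on_def Ck_on_exp)

lemma smooth_on_of_real:
  "smooth_on S f \<Longrightarrow> open S \<Longrightarrow> smooth_on S (\<lambda>x. of_real (f x) :: 'b::real_normed_div_algebra)"
  by (simp add: smooth_on_def Ck_on_of_real)

lemma smooth_on_differentiable: "smooth_on S f \<Longrightarrow> open S \<Longrightarrow> x \<in> S \<Longrightarrow> f differentiable at x"
  unfolding smooth_on_def using Ck_on_differentiable by blast

section \<open>Leibniz rules for the exterior derivative\<close>

definition pderiv_form :: "8 \<Rightarrow> 'a dform \<Rightarrow> 'a dform" where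
  "pderiv_form m \<omega> z = (\<lambda>vs. pderiv_at m (\<lambda>y. \<omega> (fst z, y) vs) (snd z))"

definition form_differentiable :: "'a dform \<Rightarrow> 'a lpt \<Rightarrow> bool" where
  "form_differentiable \<omega> z \<longleftrightarrow> (\<forall>vs. (\<lambda>y. \<omega> (fst z, y) vs) differentiable at (snd z))"

lemma dx_wedge:
  "(dx m \<and>\<^sub>f \<eta>) vs = (\<Sum>j<length vs. (-1) ^ j * ((vs ! j) $ m * \<eta> (take j vs @ drop (Suc j) vs)))"
proof (induction vs arbitrary: \<eta>)
  case Nil
  then show ?case by (simp add: dx_def)
next
  case (Cons v vs)
  show ?case
    unfolding dx_wedge_Cons Cons.IH list.size(4) One_nat_def add_Suc_right add_0_right sum.lessThan_Suc_shift
    by (simp add: ins_apply sum_negf)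
qed

text \<open>By \<open>dx_wedge\<close>, the alternating sum over the omitted argument is a wedge
  product with \<open>dx m\<close>. Differentiation then acts on coefficients alone, and its Leibniz
  rules reduce to the product rule and the algebra of wedge products.\<close>

lemma ext_d_eq: "ext_d \<omega> z = (\<Sum>m\<in>UNIV. dx m \<and>\<^sub>f pderiv_form m \<omega> z)"
proof
  fix vs
  show "ext_d \<omega> z vs = (\<Sum>m\<in>UNIV. dx m \<and>\<^sub>f pderiv_form m \<omega> z) vs"
    unfolding ext_d_def fsum_apply dx_wedge pderiv_form_def sum_distrib_left by (rule sum.swap)
qed

lemma form_differentiable_wedge:
  assumes "form_differentiable \<omega> z" "form_differentiable \<eta> z"
  shows "form_differentiable (\<lambda>w. \<omega> w \<and>\<^sub>f \<eta> w) z"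
  using assms unfolding form_differentiable_def wedge_def
  by (auto intro!: differentiable_sum differentiable_mult)

lemma pderiv_form_wedge:
  assumes "form_differentiable \<omega> z" "form_differentiable \<eta> z"
  shows "pderiv_form m (\<lambda>w. \<omega> w \<and>\<^sub>f \<eta> w) z
    = pderiv_form m \<omega> z \<and>\<^sub>f \<eta> z + \<omega> z \<and>\<^sub>f pderiv_form m \<eta> z"
proof
  fix vs
  have d: "(\<lambda>y. \<omega> (fst z, y) vs) differentiable at (snd z)"
    "(\<lambda>y. \<eta> (fst z, y) vs) differentiable at (snd z)" for vs
    using assms by (auto simp: form_differentiable_def)
  have "pderiv_form m (\<lambda>w. \<omega> w \<and>\<^sub>f \<eta> w) z vs
      = (\<Sum>S\<in>Pow {..<length vs}. pderiv_at m (\<lambda>y. shuffle_sign S * \<omega> (fst z, y) (nths vs S) * \<eta> (fst z, y) (nths vs (- S))) (snd z))"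
    unfolding pderiv_form_def wedge_def
    by (rule pderiv_at_sum) (intro differentiable_mult differentiable_const d)
  also have "\<dots> = (\<Sum>S\<in>Pow {..<length vs}.
      shuffle_sign S * pderiv_form m \<omega> z (nths vs S) * \<eta> z (nths vs (- S))
      + shuffle_sign S * \<omega> z (nths vs S) * pderiv_form m \<eta> z (nths vs (- S)))"
    by (simp add: pderiv_at_mult d pderiv_form_def)
  finally show "pderiv_form m (\<lambda>w. \<omega> w \<and>\<^sub>f \<eta> w) z vs
      = (pderiv_form m \<omega> z \<and>\<^sub>f \<eta> z + \<omega> z \<and>\<^sub>f pderiv_form m \<eta> z) vs"
    by (simp add: wedge_def sum.distrib)
qed

lemma pderiv_form_scale:
  assumes "(\<lambda>y. h (fst z, y)) differentiable at (snd z)" "form_differentiable \<omega> z"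
  shows "pderiv_form m (\<lambda>w. h w *\<^sub>f \<omega> w) z
    = pderiv_at m (\<lambda>y. h (fst z, y)) (snd z) *\<^sub>f \<omega> z + h z *\<^sub>f pderiv_form m \<omega> z"
  using assms by (simp add: pderiv_form_def fscale_def fun_eq_iff form_differentiable_def pderiv_at_mult)

text \<open>The differential of a function of local points, so that auxiliary exponents and factors
  can be differentiated within a chart.\<close>

definition dfun :: "('a lpt \<Rightarrow> complex) \<Rightarrow> 'a dform" where
  "dfun h z = (\<Sum>m\<in>UNIV. pderiv_at m (\<lambda>y. h (fst z, y)) (snd z) *\<^sub>f dx m)"

lemma ext_d_scale:
  assumes "(\<lambda>y. h (fst z, y)) differentiable at (snd z)" "form_differentiable \<omega> z"
  shows "ext_d (\<lambda>w. h w *\<^sub>f \<omega> w) z = dfun h z \<and>\<^sub>f \<omega> z + h z *\<^sub>f ext_d \<omega> z"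
  by (simp add: ext_d_eq pderiv_form_scale[OF assms] dfun_def wedge_add_right sum.distrib
      wedge_sum_left fscale_sum)

lemma multilin_dx: "multilin (dx m)"
  unfolding multilin_def
proof (intro allI)
  fix us v w vs a b
  show "dx m (us @ (a *s v + b *s w) # vs) = a * dx m (us @ v # vs) + b * dx m (us @ w # vs)"
    by (cases us) (auto simp: dx_def)
qed

lemma dfun_apply: "dfun h z [v] = (\<Sum>m\<in>UNIV. v $ m * pderiv_at m (\<lambda>y. h (fst z, y)) (snd z))"
  by (simp add: dfun_def fsum_apply fscale_def dx_def mult.commute)

lemma is_form_dfun: "is_form 1 (dfun h z)"
proof -
  have "multilin (dfun h z)"
    unfolding multilin_def dfun_def fsum_apply
    using multilin_dx[unfolded multilin_def]
    by (simp add: fscale_def sum_distrib_left algebra_simps flip: sum.distrib)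
  moreover have "homogeneous 1 (dfun h z)"
    by (simp add: homogeneous_def dfun_def fsum_apply fscale_def dx_def)
  ultimately show ?thesis
    by (auto simp: is_form_iff adj_alternating_def homogeneous_def)
qed

lemma sg_zform: "sg (zform c) = zform c"
  by (auto simp: sg_def zform_def fun_eq_iff)

lemma ext_d_zero_form: "ext_d (zero_form u) z = dfun (\<lambda>w. u (pt w)) z"
proof
  fix vs
  have "zero_form u w = zform (u (pt w))" for w
    by (auto simp: zero_form_def zform_def)
  then have "pderiv_form m (zero_form u) z = zform (pderiv_at m (\<lambda>y. u (pt (fst z, y))) (snd z))" for m
    by (auto simp: pderiv_form_def fun_eq_iff zform_def)
  moreover have "dx m \<and>\<^sub>f zform c = c *\<^sub>f dx m" for m c
    using wedge_commute_even[OF sg_zform, of "dx m" c] sg_one_form[OF homogeneous_dx, of m] by simp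
  ultimately show "ext_d (zero_form u) z vs = dfun (\<lambda>w. u (pt w)) z vs"
    by (simp add: ext_d_eq dfun_def)
qed

lemma type_part_1_0: "type_part \<Omega> 1 0 \<omega> [v] = \<omega> [p10 \<Omega> v]"
proof -
  have "{S. S \<subseteq> {..<1 + 0} \<and> card S = 1} = {{0 :: nat}}"
  proof (intro equalityI subsetI)
    fix S :: "nat set" assume "S \<in> {S. S \<subseteq> {..<1 + 0} \<and> card S = 1}"
    then have "S \<subseteq> {0}" "S \<noteq> {}" by auto
    then show "S \<in> {{0}}" by auto
  qed auto
  then show ?thesis
    by (simp add: type_part_def)
qed

lemma del0_apply: "del0 \<Omega> u z [v] = dfun (\<lambda>w. u (pt w)) z [p10 (\<Omega> z) v]"
  unfolding del_def ext_d_zero_form One_nat_def[symmetric] by (rule type_part_1_0)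

lemma pderiv_at_cnj:
  "f differentiable at x \<Longrightarrow> pderiv_at m (\<lambda>y. cnj (f y)) x = cnj (pderiv_at m f x)"
  using has_derivative_cnj[OF differentiable_has_frechet[of f x]]
  by (subst pderiv_atI) (auto simp: pderiv_at_def)

section \<open>The supersymmetric system implies the LTY system\<close>

lemma pt_Pair [simp]: "pt (c, x) = cinv c x"
  by (simp add: pt_def)

lemma smooth_fun_differentiable:
  assumes "smooth_fun \<A> u" "c \<in> \<A>" "open (crange c)" "x \<in> crange c"
  shows "(\<lambda>y. u (cinv c y)) differentiable at x"
  using assms smooth_on_differentiable[of "crange c" "u \<circ> cinv c" x] by (simp add: smooth_fun_def comp_def)

lemma manifold8_open_crange: "manifold8 X \<A> \<Longrightarrow> c \<in> \<A> \<Longrightarrow> open (crange c)"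
  by (simp add: manifold8_def)

lemma manifold8_cinv:
  assumes "manifold8 X \<A>" "c \<in> \<A>" "y \<in> fst c"
  shows "cinv c (snd c y) = y"
proof -
  have "openin X (fst c)" "homeomorphic_map (subtopology X (fst c)) (top_of_set (crange c)) (snd c)"
    using assms by (auto simp: manifold8_def)
  then have "inj_on (snd c) (fst c)"
    using homeomorphic_eq_everything_map[of "subtopology X (fst c)" "top_of_set (crange c)" "snd c"]
      openin_subset[of X "fst c"] by (simp add: Int_absorb1)
  then show ?thesis
    using assms(3) by (simp add: cinv_def inv_into_f_f)
qed

lemma dforms_differentiable:
  assumes "manifold8 X \<A>" "\<omega> \<in> dforms \<A> k" "z \<in> lpts \<A>"
  shows "form_differentiable \<omega> z"
  unfolding form_differentiable_def
proof
  fix vs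
  obtain c x where z: "z = (c, x)" "c \<in> \<A>" "x \<in> crange c"
    using assms(3) by (auto simp: lpts_def)
  then have "smooth_on (crange c) (\<lambda>y. \<omega> (c, y) vs)"
    using assms(2) by (simp add: dforms_def)
  then show "(\<lambda>y. \<omega> (fst z, y) vs) differentiable at (snd z)"
    using smooth_on_differentiable[OF _ manifold8_open_crange[OF assms(1) z(2)] z(3)] by (simp add: z(1))
qed

lemma dforms_is_form: "\<omega> \<in> dforms \<A> k \<Longrightarrow> z \<in> lpts \<A> \<Longrightarrow> is_form k (\<omega> z)"
  by (simp add: dforms_def)

text \<open>On lists of the wrong length the form is zero throughout the open chart range, hence so
  is its derivative. This gives the partial derivatives of a form the same parity as the
  form.\<close>

lemma homogeneous_pderiv_form:
  assumes "manifold8 X \<A>" "\<omega> \<in> dforms \<A> k" "z \<in> lpts \<A>"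
  shows "homogeneous k (pderiv_form m \<omega> z)"
  unfolding homogeneous_def pderiv_form_def
proof (intro allI impI)
  fix vs :: "cvec list" assume len: "length vs \<noteq> k"
  obtain c x where z: "z = (c, x)" "c \<in> \<A>" "x \<in> crange c"
    using assms(3) by (auto simp: lpts_def)
  have "pderiv_at m (\<lambda>y. \<omega> (c, y) vs) x = pderiv_at m (\<lambda>_. 0) x"
  proof (rule pderiv_at_cong)
    fix y assume "y \<in> crange c"
    then have "is_form k (\<omega> (c, y))"
      using assms(2) z by (intro dforms_is_form) (auto simp: lpts_def)
    then show "\<omega> (c, y) vs = 0"
      using len by (simp add: is_form_def)
  qed (use manifold8_open_crange[OF assms(1)] z in auto)
  then show "pderiv_at m (\<lambda>y. \<omega> (fst z, y) vs) (snd z) = 0"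
    by (simp add: z)
qed

text \<open>The transformation law survives because the factor depends only on the manifold point,
  which \<open>manifold8_cinv\<close> recovers from either chart.\<close>

lemma dforms_scale:
  assumes "manifold8 X \<A>" "\<omega> \<in> dforms \<A> k" "\<And>c. c \<in> \<A> \<Longrightarrow> smooth_on (crange c) (\<lambda>y. h (cinv c y))"
  shows "(\<lambda>z. h (pt z) *\<^sub>f \<omega> z) \<in> dforms \<A> k"
proof -
  have \<omega>: "smooth_on (crange c) (\<lambda>x. \<omega> (c, x) vs)" if "c \<in> \<A>" for c vs
    using assms(2) that by (simp add: dforms_def)
  have tr: "\<omega> (c, snd c y) vs
      = \<omega> (c', snd c' y) (map (push (frechet_derivative (transition c c') (at (snd c y)))) vs)"
    if "c \<in> \<A>" "c' \<in> \<A>" "y \<in> fst c \<inter> fst c'" for c c' y vs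
    using assms(2) that unfolding dforms_def by blast
  show ?thesis
    unfolding dforms_def mem_Collect_eq
  proof (intro conjI ballI allI)
    fix z assume "z \<in> lpts \<A>"
    then show "is_form k (h (pt z) *\<^sub>f \<omega> z)"
      by (rule is_form_scale[OF dforms_is_form[OF assms(2)]])
  next
    fix c vs assume c: "c \<in> \<A>"
    show "smooth_on (crange c) (\<lambda>x. (h (pt (c, x)) *\<^sub>f \<omega> (c, x)) vs)"
      unfolding fscale_def pt_Pair by (rule smooth_on_mult[OF assms(3)[OF c] \<omega>[OF c] manifold8_open_crange[OF assms(1) c]])
  next
    fix c c' y vs assume c: "c \<in> \<A>" "c' \<in> \<A>" "y \<in> fst c \<inter> fst c'"
    have "cinv c (snd c y) = y" "cinv c' (snd c' y) = y"
      using c by (auto intro: manifold8_cinv[OF assms(1)])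
    then show "(h (pt (c, snd c y)) *\<^sub>f \<omega> (c, snd c y)) vs
      = (h (pt (c', snd c' y)) *\<^sub>f \<omega> (c', snd c' y)) (map (push (frechet_derivative (transition c c') (at (snd c y)))) vs)"
      unfolding fscale_def pt_Pair by (simp only: tr[OF c])
  qed
qed

lemma one_form_eqI:
  assumes "homogeneous 1 \<omega>" "homogeneous 1 \<eta>" "\<And>v. \<omega> [v] = \<eta> [v]"
  shows "\<omega> = \<eta>"
proof
  fix vs show "\<omega> vs = \<eta> vs"
    using assms by (cases "length vs = 1") (auto simp: homogeneous_def length_Suc_conv)
qed

lemma homogeneous_conjf: "homogeneous k \<omega> \<Longrightarrow> homogeneous k (conjf \<omega>)"
  by (simp add: homogeneous_def conjf_def)

lemma homogeneous_add: "homogeneous k \<omega> \<Longrightarrow> homogeneous k \<eta> \<Longrightarrow> homogeneous k (\<omega> + \<eta>)"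
  by (simp add: homogeneous_def)

lemma homogeneous_fscale: "homogeneous k \<omega> \<Longrightarrow> homogeneous k (c *\<^sub>f \<omega>)"
  by (simp add: homogeneous_def fscale_def)

lemma homogeneous_dfun: "homogeneous 1 (dfun h z)"
  using is_form_dfun is_form_iff by blast

lemma conjf_simps:
  "conjf (\<omega> + \<eta>) = conjf \<omega> + conjf \<eta>" "conjf (c *\<^sub>f \<omega>) = cnj c *\<^sub>f conjf \<omega>"
  "conjf 0 = 0"
  by (auto simp: conjf_def fscale_def fun_eq_iff)

lemma is_form_conjf: "is_form k \<omega> \<Longrightarrow> is_form k (conjf \<omega>)"
proof -
  assume *: "is_form k \<omega>"
  then have "multilin \<omega>" "adj_alternating \<omega>" "homogeneous k \<omega>"
    by (auto simp: is_form_iff)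
  then show ?thesis
    by (simp add: is_form_iff homogeneous_conjf) (simp add: multilin_def adj_alternating_def conjf_def)
qed

lemma cnj_dfun:
  assumes "(\<lambda>y. h (fst z, y)) differentiable at (snd z)"
  shows "cnj (dfun h z [cnjv v]) = dfun (\<lambda>w. cnj (h w)) z [v]"
  using pderiv_at_cnj[OF assms] by (simp add: dfun_apply cnjv_def)

lemma dfun_add_vec: "dfun h z [v + w] = dfun h z [v] + dfun h z [w]"
  by (simp add: dfun_apply algebra_simps sum.distrib)

text \<open>Conjugation exchanges the projections \<open>p10\<close> and \<open>p01\<close>, so the
  (1,0)-part of the differential of \<open>u\<close> becomes the (0,1)-part of the differential of
  its conjugate.\<close>

lemma conjf_del0:
  assumes "acs_form (\<Omega> z)" "(\<lambda>y. u (pt (fst z, y))) differentiable at (snd z)"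
  shows "conjf (del0 \<Omega> u z) [v] = dfun (\<lambda>w. cnj (u (pt w))) z [p01 (\<Omega> z) v]"
  using cnj_dfun[of "\<lambda>w. u (pt w)" z "p01 (\<Omega> z) v"] assms(2)
  by (simp add: conjf_def del0_apply acs_form.p10_cnjv[OF assms(1)])

lemma su4_structure_point:
  assumes "su4_structure \<A> J \<Omega> K" "z \<in> lpts \<A>"
  shows "su4_point (\<Omega> z) (J z)"
  using assms by unfold_locales (auto simp: su4_structure_def real_dforms_def intro: dforms_is_form)

text \<open>A nonzero factor leaves the kernel of \<Omega>, hence the almost complex structure,
  unchanged, and a positive factor of \<open>J\<close> preserves positivity. The volume identity
  scales by the squared modulus of \<open>e\<close> on one side and by the fourth power of
  \<open>h\<close> on the other, and \<open>K\<close> is their quotient.\<close>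

lemma su4_structure_scale:
  assumes M: "manifold8 X \<A>" and su4: "su4_structure \<A> J \<Omega> (\<lambda>_. 1)"
    and h: "\<And>c. c \<in> \<A> \<Longrightarrow> smooth_on (crange c) (\<lambda>y. complex_of_real (h (cinv c y)))" "\<And>y. 0 < h y"
    and e: "\<And>c. c \<in> \<A> \<Longrightarrow> smooth_on (crange c) (\<lambda>y. e (cinv c y))" "\<And>y. e y \<noteq> 0"
    and K: "smooth_fun \<A> K" "\<And>y. e y * cnj (e y) = of_real (K y * h y ^ 4)"
  shows "su4_structure \<A> (\<lambda>z. complex_of_real (h (pt z)) *\<^sub>f J z) (\<lambda>z. e (pt z) *\<^sub>f \<Omega> z) K"
proof -
  let ?J = "\<lambda>z. complex_of_real (h (pt z)) *\<^sub>f J z" and ?\<Omega> = "\<lambda>z. e (pt z) *\<^sub>f \<Omega> z"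
  have J: "?J \<in> real_dforms \<A> 2"
    using su4 dforms_scale[OF M _ h(1)] by (auto simp: su4_structure_def real_dforms_def conjf_simps)
  have \<Omega>: "?\<Omega> \<in> dforms \<A> 4"
    using su4 dforms_scale[OF M _ e(1)] by (auto simp: su4_structure_def)
  have "K (pt z) \<noteq> 0 \<and> ?\<Omega> z \<noteq> 0 \<and> decomposable4 (?\<Omega> z) \<and> determines_acs (?\<Omega> z) \<and>
        (\<forall>v. v \<noteq> 0 \<longrightarrow> 0 < Re (gmet (?J z) (?\<Omega> z) (cvec_of v) (cvec_of v))) \<and>
        ?J z \<and>\<^sub>f ?\<Omega> z = 0 \<and>
        (1 / 2 ^ 4) *\<^sub>f (?\<Omega> z \<and>\<^sub>f conjf (?\<Omega> z)) =
          (1 / fact 4 * complex_of_real (K (pt z))) *\<^sub>f (?J z \<and>\<^sub>f ?J z \<and>\<^sub>f ?J z \<and>\<^sub>f ?J z)"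
    if "z \<in> lpts \<A>" for z
  proof (intro conjI)
    from su4 that have *: "\<Omega> z \<noteq> 0" "decomposable4 (\<Omega> z)" "determines_acs (\<Omega> z)"
        "\<forall>v. v \<noteq> 0 \<longrightarrow> 0 < Re (gmet (J z) (\<Omega> z) (cvec_of v) (cvec_of v))" "J z \<and>\<^sub>f \<Omega> z = 0"
        "(1 / 2 ^ 4) *\<^sub>f (\<Omega> z \<and>\<^sub>f conjf (\<Omega> z)) = (1 / fact 4) *\<^sub>f (J z \<and>\<^sub>f J z \<and>\<^sub>f J z \<and>\<^sub>f J z)"
      by (auto simp: su4_structure_def)
    note e0 = e(2)[of "pt z"] and h0 = h(2)[of "pt z"]
    show "K (pt z) \<noteq> 0"
      using K(2)[of "pt z"] e0 by auto
    show "?\<Omega> z \<noteq> 0"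
      using *(1) e0 by (auto simp: fscale_def fun_eq_iff)
    from *(2) show "decomposable4 (?\<Omega> z)"
      unfolding decomposable4_def by (metis is_form_scale wedge_scale(1))
    show "determines_acs (?\<Omega> z)"
      using *(3) e0 by (simp add: acs_scale)
    show "\<forall>v. v \<noteq> 0 \<longrightarrow> 0 < Re (gmet (?J z) (?\<Omega> z) (cvec_of v) (cvec_of v))"
      using *(4) h0 unfolding gmet_def acs_scale(3)[OF e0] by (simp add: fscale_def)
    show "?J z \<and>\<^sub>f ?\<Omega> z = 0"
      by (simp add: *(5))
    have "(1 / 2 ^ 4) *\<^sub>f (?\<Omega> z \<and>\<^sub>f conjf (?\<Omega> z)) = (e (pt z) * cnj (e (pt z))) *\<^sub>f (1 / 2 ^ 4) *\<^sub>f (\<Omega> z \<and>\<^sub>f conjf (\<Omega> z))"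
      by (simp add: conjf_simps mult_ac)
    also have "\<dots> = (1 / fact 4 * complex_of_real (K (pt z))) *\<^sub>f (?J z \<and>\<^sub>f ?J z \<and>\<^sub>f ?J z \<and>\<^sub>f ?J z)"
      unfolding *(6) K(2) by (simp add: mult_ac power4_eq_xxxx)
    finally show "(1 / 2 ^ 4) *\<^sub>f (?\<Omega> z \<and>\<^sub>f conjf (?\<Omega> z)) =
        (1 / fact 4 * complex_of_real (K (pt z))) *\<^sub>f (?J z \<and>\<^sub>f ?J z \<and>\<^sub>f ?J z \<and>\<^sub>f ?J z)" .
  qed
  then show ?thesis
    using J \<Omega> K(1) by (simp add: su4_structure_def)
qed

text \<open>\<open>J\<close> and its partial derivatives are even, so the three terms of the product
  rule coincide after reordering.\<close>

lemma ext_d_cube: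
  assumes "manifold8 X \<A>" "J \<in> dforms \<A> 2" "z \<in> lpts \<A>"
  shows "ext_d (\<lambda>w. J w \<and>\<^sub>f J w \<and>\<^sub>f J w) z = 3 *\<^sub>f (ext_d J z \<and>\<^sub>f J z \<and>\<^sub>f J z)"
proof -
  let ?D = "\<lambda>m. pderiv_form m J z"
  note d = dforms_differentiable[OF assms]
  have even: "sg (J z) = J z" "sg (?D m) = ?D m" for m
    using is_form_sg[OF dforms_is_form[OF assms(2,3)]] sg_homogeneous[OF homogeneous_pderiv_form[OF assms]]
    by simp_all
  have c1: "J z \<and>\<^sub>f ?D m = ?D m \<and>\<^sub>f J z" for m
    by (rule wedge_commute_even) (simp_all add: even)
  have c2: "J z \<and>\<^sub>f ?D m \<and>\<^sub>f \<zeta> = ?D m \<and>\<^sub>f J z \<and>\<^sub>f \<zeta>" for m \<zeta>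
    using c1[of m] by (simp flip: wedge_assoc)
  have "pderiv_form m (\<lambda>w. J w \<and>\<^sub>f J w \<and>\<^sub>f J w) z = 3 *\<^sub>f (?D m \<and>\<^sub>f J z \<and>\<^sub>f J z)" for m
    unfolding pderiv_form_wedge[OF d form_differentiable_wedge[OF d d]] pderiv_form_wedge[OF d d]
    by (simp only: c1 c2 wedge_add_right) (simp add: fun_eq_iff fscale_def)
  then show ?thesis
    by (simp add: ext_d_eq wedge_sum_left fscale_sum wedge_assoc)
qed

text \<open>The torsion equations of the supersymmetric system with
  \<open>W\<^sub>1 = W\<^sub>2 = 0\<close> already substituted.\<close>

locale susy_solution =
  fixes X :: "'a topology" and \<A> J \<Omega> A \<phi> \<theta> W\<^sub>3 W\<^sub>4 W\<^sub>5
  assumes M: "manifold8 X \<A>" and su4: "su4_structure \<A> J \<Omega> (\<lambda>_. 1)"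
    and smooth: "smooth_fun \<A> A" "smooth_fun \<A> \<phi>" "smooth_fun \<A> \<theta>"
    and W\<^sub>4: "W\<^sub>4 \<in> type_dforms \<A> \<Omega> 1 0" and W\<^sub>5: "W\<^sub>5 \<in> type_dforms \<A> \<Omega> 1 0"
    and W\<^sub>3: "W\<^sub>3 \<in> prim_dforms \<A> J \<Omega> 2 1"
    and dJ: "\<And>z. z \<in> lpts \<A> \<Longrightarrow> ext_d J z = plus_cc (W\<^sub>3 z + W\<^sub>4 z \<and>\<^sub>f J z)"
    and d\<Omega>: "\<And>z. z \<in> lpts \<A> \<Longrightarrow> ext_d \<Omega> z = conjf (W\<^sub>5 z) \<and>\<^sub>f \<Omega> z"
    and W\<^sub>4_eq: "\<And>z. z \<in> lpts \<A> \<Longrightarrow> W\<^sub>4 z = (2 / 3) *\<^sub>f del0 \<Omega> (\<lambda>y. of_real (\<phi> y - A y)) z"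
    and W\<^sub>5_eq: "\<And>z. z \<in> lpts \<A> \<Longrightarrow> W\<^sub>5 z = del0 \<Omega> (\<lambda>y. of_real (\<phi> y - 2 * A y) + \<i> * of_real (\<theta> y)) z"
begin

lemma J_dforms: "J \<in> dforms \<A> 2" and \<Omega>_dforms: "\<Omega> \<in> dforms \<A> 4"
  using su4 by (auto simp: su4_structure_def real_dforms_def)

lemma smooth_cinv:
  assumes "c \<in> \<A>"
  shows "smooth_on (crange c) (\<lambda>y. A (cinv c y))" "smooth_on (crange c) (\<lambda>y. \<phi> (cinv c y))"
    "smooth_on (crange c) (\<lambda>y. \<theta> (cinv c y))"
  using smooth assms by (simp_all add: smooth_fun_def comp_def)

lemma smooth_exp_combination:
  assumes "c \<in> \<A>"
  shows "smooth_on (crange c) (\<lambda>y. exp (complex_of_real (a * \<phi> (cinv c y) + b * A (cinv c y)) + \<i> * complex_of_real (d * \<theta> (cinv c y))))"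
    and "smooth_on (crange c) (\<lambda>y. exp (a * \<phi> (cinv c y) + b * A (cinv c y)))"
  by (intro smooth_on_exp smooth_on_add smooth_on_mult smooth_on_of_real smooth_on_const smooth_cinv
      assms manifold8_open_crange[OF M])+

lemma smooth_factor_J: "c \<in> \<A> \<Longrightarrow> smooth_on (crange c) (\<lambda>y. complex_of_real (exp (2 / 3 * (- \<phi> (cinv c y) + A (cinv c y)))))"
  using smooth_exp_combination(1)[of c "- 2 / 3" "2 / 3" 0] by (simp add: algebra_simps flip: exp_of_real)

lemma smooth_factor_\<Omega>: "c \<in> \<A> \<Longrightarrow> smooth_on (crange c)
    (\<lambda>y. exp (complex_of_real (- \<phi> (cinv c y) + 2 * A (cinv c y)) + \<i> * complex_of_real (\<theta> (cinv c y))))"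
  using smooth_exp_combination(1)[of c "- 1" 2 1] by simp

lemma su4_B: "su4_structure \<A> (J_B A \<phi> J) (Omega_B A \<phi> \<theta> \<Omega>) (K_B A \<phi>)"
proof -
  have K: "smooth_fun \<A> (K_B A \<phi>)"
    using smooth_exp_combination(2)[of _ "2 / 3" "4 / 3"]
    by (simp add: smooth_fun_def K_B_def comp_def algebra_simps)
  have "su4_structure \<A> (\<lambda>z. complex_of_real (exp (2 / 3 * (- \<phi> (pt z) + A (pt z)))) *\<^sub>f J z)
     (\<lambda>z. exp (complex_of_real (- \<phi> (pt z) + 2 * A (pt z)) + \<i> * complex_of_real (\<theta> (pt z))) *\<^sub>f \<Omega> z) (K_B A \<phi>)"
  proof (rule su4_structure_scale[OF M su4 smooth_factor_J _ smooth_factor_\<Omega> _ K])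
    fix y
    let ?a = "- \<phi> y + 2 * A y"
    have "exp (complex_of_real ?a + \<i> * complex_of_real (\<theta> y)) * cnj (exp (complex_of_real ?a + \<i> * complex_of_real (\<theta> y)))
        = exp (complex_of_real (2 * ?a))"
      by (simp add: exp_cnj flip: exp_add)
    also have "\<dots> = of_real (exp (2 * ?a))"
      by (rule exp_of_real)
    \<comment> \<open>Origin of \<open>K_B\<close>: 2 (-\<phi> + 2 A) = 2/3 (\<phi> + 2 A) + 4 * 2/3
      (-\<phi> + A). The phase has dropped out of the squared modulus.\<close>
    also have "exp (2 * ?a) = K_B A \<phi> y * exp (2 / 3 * (- \<phi> y + A y)) ^ 4"
      by (simp add: K_B_def flip: exp_add exp_of_nat_mult) (simp add: field_simps)
    finally show "exp (complex_of_real ?a + \<i> * complex_of_real (\<theta> y)) * cnj (exp (complex_of_real ?a + \<i> * complex_of_real (\<theta> y)))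
      = of_real (K_B A \<phi> y * exp (2 / 3 * (- \<phi> y + A y)) ^ 4)" .
  qed simp_all
  then show ?thesis
    by (simp add: J_B_def[abs_def] Omega_B_def[abs_def])
qed

section \<open>Exterior derivatives of the rescaled forms at a point\<close>

context
  fixes z assumes z: "z \<in> lpts \<A>"
begin

interpretation P: su4_point "\<Omega> z" "J z"
  by (rule su4_structure_point[OF su4 z])

lemma differentiable_data:
  "(\<lambda>y. A (pt (fst z, y))) differentiable at (snd z)" "(\<lambda>y. \<phi> (pt (fst z, y))) differentiable at (snd z)"
  "(\<lambda>y. \<theta> (pt (fst z, y))) differentiable at (snd z)"
proof -
  obtain c x where "z = (c, x)" "c \<in> \<A>" "x \<in> crange c"
    using z by (auto simp: lpts_def)
  then show "(\<lambda>y. A (pt (fst z, y))) differentiable at (snd z)"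
    "(\<lambda>y. \<phi> (pt (fst z, y))) differentiable at (snd z)"
    "(\<lambda>y. \<theta> (pt (fst z, y))) differentiable at (snd z)"
    using smooth_fun_differentiable[OF smooth(1)] smooth_fun_differentiable[OF smooth(2)]
      smooth_fun_differentiable[OF smooth(3)] manifold8_open_crange[OF M] by auto
qed

lemma differentiable_combination:
  "(\<lambda>y. complex_of_real (a * \<phi> (pt (fst z, y)) + b * A (pt (fst z, y))) + \<i> * complex_of_real (d * \<theta> (pt (fst z, y)))) differentiable at (snd z)"
  by (intro differentiable_add differentiable_mult differentiable_const pderiv_at_of_real(2) differentiable_data)

lemma dfun_exp:
  assumes "(\<lambda>y. g (fst z, y)) differentiable at (snd z)"
  shows "dfun (\<lambda>w. exp (g w)) z = exp (g z) *\<^sub>f dfun g z"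
  using pderiv_at_exp(1)[OF assms] by (simp add: dfun_def fscale_sum)

lemma dfun_cmult:
  assumes "(\<lambda>y. g (fst z, y)) differentiable at (snd z)"
  shows "dfun (\<lambda>w. c * g w) z = c *\<^sub>f dfun g z"
  using pderiv_at_mult[OF differentiable_const assms] by (simp add: dfun_def fscale_sum)

text \<open>For a real function the (1,0)-part of the differential and its conjugate add up to the
  whole differential, because \<open>p10\<close> and \<open>p01\<close> add up to the
  identity.\<close>

lemma W\<^sub>4_real: "W\<^sub>4 z + conjf (W\<^sub>4 z) = (2 / 3) *\<^sub>f dfun (\<lambda>w. of_real (\<phi> (pt w) - A (pt w))) z"
proof (rule one_form_eqI)
  have hom: "homogeneous 1 (W\<^sub>4 z)"
    using W\<^sub>4 z by (simp add: type_dforms_def dforms_def is_form_iff)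
  then show "homogeneous 1 (W\<^sub>4 z + conjf (W\<^sub>4 z))"
    by (intro homogeneous_add homogeneous_conjf)
  show "homogeneous 1 ((2 / 3) *\<^sub>f dfun (\<lambda>w. of_real (\<phi> (pt w) - A (pt w))) z)"
    by (intro homogeneous_fscale homogeneous_dfun)
  fix v
  have "(\<lambda>y. complex_of_real (\<phi> (pt (fst z, y)) - A (pt (fst z, y)))) differentiable at (snd z)"
    using differentiable_combination[of 1 "- 1" 0] by simp
  then have "conjf (del0 \<Omega> (\<lambda>y. of_real (\<phi> y - A y)) z) [v]
      = dfun (\<lambda>w. of_real (\<phi> (pt w) - A (pt w))) z [p01 (\<Omega> z) v]"
    by (subst conjf_del0[of \<Omega> z, OF P.acs_form_axioms]) simp_all
  then show "(W\<^sub>4 z + conjf (W\<^sub>4 z)) [v] = ((2 / 3) *\<^sub>f dfun (\<lambda>w. of_real (\<phi> (pt w) - A (pt w))) z) [v]"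
    unfolding W\<^sub>4_eq[OF z] conjf_simps plus_fun_apply
    by (simp add: fscale_def del0_apply P.p10_p01 flip: distrib_left dfun_add_vec)
qed

text \<open>The conformal factor of \<open>J_B\<close> is chosen so that its differential cancels the \<open>W\<^sub>4\<close> part of
  \<open>dJ\<close>.\<close>

lemma ext_d_J_B: "ext_d (J_B A \<phi> J) z
    = of_real (exp (2 / 3 * (- \<phi> (pt z) + A (pt z)))) *\<^sub>f (W\<^sub>3 z + conjf (W\<^sub>3 z))"
proof -
  define q where "q = (\<lambda>w :: 'a lpt. complex_of_real (\<phi> (pt w) - A (pt w)))"
  define h where "h = (\<lambda>w. exp (- (2 / 3) * q w))"
  have dq: "(\<lambda>y. q (fst z, y)) differentiable at (snd z)"
    using differentiable_combination[of 1 "- 1" 0] by (simp add: q_def)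
  then have dcq: "(\<lambda>y. - (2 / 3) * q (fst z, y)) differentiable at (snd z)"
    by (intro differentiable_mult differentiable_const)
  have h: "of_real (exp (2 / 3 * (- \<phi> (pt w) + A (pt w)))) = h w" for w
    by (simp add: h_def q_def algebra_simps diff_divide_distrib flip: exp_of_real)
  have J_B: "J_B A \<phi> J = (\<lambda>w. h w *\<^sub>f J w)"
    by (rule ext) (simp only: J_B_def h)
  have dh: "(\<lambda>y. h (fst z, y)) differentiable at (snd z)"
    unfolding h_def by (rule pderiv_at_exp(2)[OF dcq])
  have "dfun h z = (h z * - (2 / 3)) *\<^sub>f dfun q z"
    unfolding h_def dfun_exp[of "\<lambda>w. - (2 / 3) * q w", OF dcq] dfun_cmult[of q, OF dq] by simp
  then have "ext_d (J_B A \<phi> J) z = (h z * - (2 / 3)) *\<^sub>f (dfun q z \<and>\<^sub>f J z)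
      + h z *\<^sub>f (W\<^sub>3 z + conjf (W\<^sub>3 z) + (W\<^sub>4 z + conjf (W\<^sub>4 z)) \<and>\<^sub>f J z)"
    unfolding J_B using ext_d_scale[of h z J, OF dh dforms_differentiable[OF M J_dforms z]]
    by (simp add: dJ[OF z] plus_cc_def conjf_simps conjf_wedge P.real_J wedge_add_left add_ac)
  also have "\<dots> = h z *\<^sub>f (W\<^sub>3 z + conjf (W\<^sub>3 z))"
    unfolding W\<^sub>4_real q_def[symmetric] fscale_add_right wedge_scale
    by (simp add: fun_eq_iff fscale_def)
  finally show ?thesis
    by (simp only: h)
qed

lemma ext_d_J_B_cube: "ext_d (\<lambda>w. J_B A \<phi> J w \<and>\<^sub>f J_B A \<phi> J w \<and>\<^sub>f J_B A \<phi> J w) z = 0"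
proof -
  have W: "W\<^sub>3 z \<and>\<^sub>f J z \<and>\<^sub>f J z = 0"
    using W\<^sub>3 z by (intro P.primitive_three_form) (auto simp: prim_dforms_def type_dforms_def dforms_def)
  \<comment> \<open>The conjugate of the previous identity, \<open>J\<close> being real.\<close>
  then have "conjf (W\<^sub>3 z) \<and>\<^sub>f J z \<and>\<^sub>f J z = 0"
    using conjf_wedge[of "W\<^sub>3 z" "J z \<and>\<^sub>f J z"] by (simp add: conjf_wedge P.real_J conjf_simps)
  moreover have "J_B A \<phi> J \<in> dforms \<A> 2"
    using su4_B by (simp add: su4_structure_def real_dforms_def)
  ultimately show ?thesis
    by (subst ext_d_cube[OF M _ z]) (simp_all add: ext_d_J_B wedge_add_left W J_B_def)
qed

lemma ext_d_Omega_B: "ext_d (Omega_B A \<phi> \<theta> \<Omega>) z = 0"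
proof -
  define g where "g = (\<lambda>w :: 'a lpt. complex_of_real (- \<phi> (pt w) + 2 * A (pt w)) + \<i> * of_real (\<theta> (pt w)))"
  have dg: "(\<lambda>y. g (fst z, y)) differentiable at (snd z)"
    using differentiable_combination[of "- 1" 2 1] by (simp add: g_def)
  have \<Omega>_B: "Omega_B A \<phi> \<theta> \<Omega> = (\<lambda>w. exp (g w) *\<^sub>f \<Omega> w)"
    by (rule ext) (simp only: Omega_B_def g_def)
  have "(dfun g z + conjf (W\<^sub>5 z)) \<and>\<^sub>f \<Omega> z = 0"
  proof (rule decomposable4_wedge_eq_0)
    show "decomposable4 (\<Omega> z)"
      using su4 z by (auto simp: su4_structure_def)
    have "is_form 1 (W\<^sub>5 z)"
      using W\<^sub>5 z by (simp add: type_dforms_def dforms_def)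
    then show "is_form 1 (dfun g z + conjf (W\<^sub>5 z))"
      using is_form_conjf[of 1 "W\<^sub>5 z"] is_form_dfun[of g z] by (simp add: is_form_def algebra_simps)
    fix v assume "v \<in> T01 (\<Omega> z)"
    then have v: "p01 (\<Omega> z) v = v"
      by (simp add: p01_def P.p10_T01)
    have "(\<lambda>y. of_real (\<phi> (pt (fst z, y)) - 2 * A (pt (fst z, y))) + \<i> * of_real (\<theta> (pt (fst z, y)))) differentiable at (snd z)"
      using differentiable_combination[of 1 "- 2" 1] by simp
    \<comment> \<open>Conjugation turns \<phi> - 2 A + i \<theta> into \<phi> - 2 A - i \<theta> =
      -g, and a (0,1)-vector is fixed by \<open>p01\<close>. On such vectors the conjugate of
      \<open>W\<^sub>5\<close> therefore cancels the differential of g, and the sum is of type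
      (1,0).\<close>
    then have "conjf (W\<^sub>5 z) [v] = dfun (\<lambda>w. (- 1) * g w) z [v]"
      unfolding W\<^sub>5_eq[OF z] by (subst conjf_del0[of \<Omega> z, OF P.acs_form_axioms]) (simp_all add: v g_def algebra_simps)
    then show "(dfun g z + conjf (W\<^sub>5 z)) [v] = 0"
      by (simp only: dfun_cmult[of g, OF dg] plus_fun_apply) simp
  qed
  moreover have "ext_d (Omega_B A \<phi> \<theta> \<Omega>) z = exp (g z) *\<^sub>f ((dfun g z + conjf (W\<^sub>5 z)) \<and>\<^sub>f \<Omega> z)"
    unfolding \<Omega>_B using ext_d_scale[of "\<lambda>w. exp (g w)" z \<Omega>, OF pderiv_at_exp(2)[OF dg] dforms_differentiable[OF M \<Omega>_dforms z]]
    by (simp add: d\<Omega>[OF z] dfun_exp[of g, OF dg] wedge_add_left fscale_add_right)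
  ultimately show ?thesis by simp
qed

end

lemma lty_2B: "lty_2B_system \<A> (J_B A \<phi> J) (Omega_B A \<phi> \<theta> \<Omega>) (K_B A \<phi>)
    (rho_LTY (J_B A \<phi> J) (Omega_B A \<phi> \<theta> \<Omega>) (K_B A \<phi>))"
  by (simp add: lty_2B_system_def su4_B ext_d_J_B_cube ext_d_Omega_B)

end

lemma contr_zero [simp]: "contr J \<Omega> 0 \<omega> = 0"
  by (simp add: contr_def fun_eq_iff)

theorem complex_susy_imp_lty_2B:
  fixes X :: "'a topology"
  assumes "manifold8 X \<A>" "configuration \<A> J \<Omega> A \<phi> \<theta> \<alpha> H\<^sub>1 H\<^sub>3 F\<^sub>1 F\<^sub>3 F\<^sub>5 F\<^sub>7"
    and "complex_susy_system \<A> J \<Omega> A \<phi> \<theta> \<alpha> H\<^sub>1 H\<^sub>3 F\<^sub>1 F\<^sub>3 F\<^sub>5 F\<^sub>7"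
  shows "lty_2B_system \<A> (J_B A \<phi> J) (Omega_B A \<phi> \<theta> \<Omega>) (K_B A \<phi>)
    (rho_LTY (J_B A \<phi> J) (Omega_B A \<phi> \<theta> \<Omega>) (K_B A \<phi>))"
proof -
  from assms(3) obtain W\<^sub>1 W\<^sub>2 W\<^sub>3 W\<^sub>4 W\<^sub>5 where W: "torsion_classes \<A> J \<Omega> W\<^sub>1 W\<^sub>2 W\<^sub>3 W\<^sub>4 W\<^sub>5"
    and eqs: "\<And>z. z \<in> lpts \<A> \<Longrightarrow> W\<^sub>1 z = 0" "\<And>z. z \<in> lpts \<A> \<Longrightarrow> W\<^sub>2 z = 0"
      "\<And>z. z \<in> lpts \<A> \<Longrightarrow> W\<^sub>4 z = (2 / 3) *\<^sub>f del0 \<Omega> (\<lambda>y. of_real (\<phi> y - A y)) z"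
      "\<And>z. z \<in> lpts \<A> \<Longrightarrow> W\<^sub>5 z = del0 \<Omega> (\<lambda>y. of_real (\<phi> y - 2 * A y) + \<i> * of_real (\<theta> y)) z"
    unfolding complex_susy_system_def Let_def by blast
  interpret susy_solution X \<A> J \<Omega> A \<phi> \<theta> W\<^sub>3 W\<^sub>4 W\<^sub>5
    using assms(1,2) W eqs by unfold_locales (auto simp: configuration_def torsion_classes_def)
  show ?thesis
    by (rule lty_2B)
qed

section \<open>The flat counterexample to the converse\<close>

text \<open>An enumeration of the index type by ordinary natural numbers. For \<open>k < 4\<close>
  the indices \<open>coord k\<close> and \<open>coord (k + 4)\<close> carry the real and imaginary
  parts of the k-th complex coordinate.\<close>

definition coord :: "nat \<Rightarrow> 8" where
  "coord = (SOME f. bij_betw f {0..<8} UNIV)"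

lemma bij_coord: "bij_betw coord {0..<8} UNIV"
proof -
  have "\<exists>f. bij_betw f {0..<8 :: nat} (UNIV :: 8 set)"
    using ex_bij_betw_nat_finite[OF finite, of "UNIV :: 8 set"] by simp
  then show ?thesis
    unfolding coord_def by (rule someI_ex)
qed

lemma coord_eq_iff: "i < 8 \<Longrightarrow> j < 8 \<Longrightarrow> coord i = coord j \<longleftrightarrow> i = j"
  using bij_betw_imp_inj_on[OF bij_coord] by (auto simp: inj_on_eq_iff)

lemma coord_cases:
  obtains k where "k < 4" "m = coord k" | k where "k < 4" "m = coord (k + 4)"
proof -
  have "m \<in> coord ` {0..<8}"
    using bij_coord by (simp add: bij_betw_def)
  then obtain k where k: "k < 8" "m = coord k" by auto
  show ?thesis
  proof (cases "k < 4")
    case False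
    then show ?thesis
      using k that(2)[of "k - 4"] by simp
  qed (use k that in auto)
qed

lemma coord_vec_eqI:
  fixes v w :: "'b^8"
  assumes "\<And>k. k < 4 \<Longrightarrow> v $ coord k = w $ coord k" "\<And>k. k < 4 \<Longrightarrow> v $ coord (k + 4) = w $ coord (k + 4)"
  shows "v = w"
  unfolding vec_eq_iff
proof
  fix m show "v $ m = w $ m"
    by (cases m rule: coord_cases) (auto simp: assms)
qed

text \<open>The differentials of the complex coordinates; \<open>uform\<close> gives their
  conjugates.\<close>

definition tform :: "nat \<Rightarrow> pform" where
  "tform k = dx (coord k) + \<i> *\<^sub>f dx (coord (k + 4))"

definition uform :: "nat \<Rightarrow> pform" where
  "uform k = dx (coord k) + (- \<i>) *\<^sub>f dx (coord (k + 4))"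

lemma tform_apply: "tform k [v] = v $ coord k + \<i> * v $ coord (k + 4)"
  and uform_apply: "uform k [v] = v $ coord k - \<i> * v $ coord (k + 4)"
  by (simp_all add: tform_def uform_def dx_def fscale_def)

lemma is_form_dx: "is_form 1 (dx m)"
  using homogeneous_dx multilin_dx by (auto simp: is_form_iff adj_alternating_def homogeneous_def)

lemma is_form_add: "is_form k \<omega> \<Longrightarrow> is_form k \<eta> \<Longrightarrow> is_form k (\<omega> + \<eta>)"
  by (simp add: is_form_def algebra_simps)

lemma is_form_tform: "is_form 1 (tform k)" and is_form_uform: "is_form 1 (uform k)"
  unfolding tform_def uform_def by (intro is_form_add is_form_scale is_form_dx)+

lemma homogeneous_tform: "homogeneous 1 (tform k)" and homogeneous_uform: "homogeneous 1 (uform k)"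
  using is_form_tform is_form_uform is_form_iff by blast+

lemma sg_tform: "sg (tform k) = - tform k" and sg_uform: "sg (uform k) = - uform k"
  by (rule sg_one_form[OF homogeneous_tform] sg_one_form[OF homogeneous_uform])+

lemma conjf_tform: "conjf (tform k) = uform k" and conjf_uform: "conjf (uform k) = tform k"
  by (auto simp: conjf_def tform_def uform_def dx_def cnjv_def fscale_def fun_eq_iff length_Suc_conv)

section \<open>The standard SU(4)-structure of flat complex four-space\<close>

definition flat_\<Omega> :: pform where
  "flat_\<Omega> = tform 0 \<and>\<^sub>f tform 1 \<and>\<^sub>f tform 2 \<and>\<^sub>f tform 3"

definition flat_J :: pform where
  "flat_J = (\<i> / 2) *\<^sub>f (tform 0 \<and>\<^sub>f uform 0 + tform 1 \<and>\<^sub>f uform 1 + tform 2 \<and>\<^sub>f uform 2 + tform 3 \<and>\<^sub>f uform 3)"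

lemma is_form_flat_\<Omega>: "is_form 4 flat_\<Omega>"
proof -
  have "is_form (1 + (1 + (1 + 1))) flat_\<Omega>"
    unfolding flat_\<Omega>_def by (intro is_form_wedge is_form_tform)
  then show ?thesis
    by (simp add: numeral_eq_Suc)
qed

lemma is_form_flat_J: "is_form 2 flat_J"
proof -
  have "is_form (1 + 1) flat_J"
    unfolding flat_J_def by (intro is_form_scale is_form_add is_form_wedge is_form_tform is_form_uform)
  then show ?thesis
    by (simp add: numeral_eq_Suc)
qed

text \<open>Products associate to the right, so sorting factors by rewriting needs the swap both at
  the end of a product and in front of a tail \<zeta>.\<close>

lemma odd_swap:
  assumes "sg \<omega> = - \<omega>" "sg \<eta> = - \<eta>"
  shows "\<eta> \<and>\<^sub>f \<omega> = - (\<omega> \<and>\<^sub>f \<eta>)" "\<eta> \<and>\<^sub>f \<omega> \<and>\<^sub>f \<zeta> = - (\<omega> \<and>\<^sub>f \<eta> \<and>\<^sub>f \<zeta>)"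
proof -
  show *: "\<eta> \<and>\<^sub>f \<omega> = - (\<omega> \<and>\<^sub>f \<eta>)"
    by (rule wedge_anticommute[OF assms(2,1)])
  show "\<eta> \<and>\<^sub>f \<omega> \<and>\<^sub>f \<zeta> = - (\<omega> \<and>\<^sub>f \<eta> \<and>\<^sub>f \<zeta>)"
    using arg_cong[OF *, of "\<lambda>\<xi>. \<xi> \<and>\<^sub>f \<zeta>"] by (simp add: wedge_assoc)
qed

lemma odd_square:
  assumes "sg \<omega> = - \<omega>"
  shows "\<omega> \<and>\<^sub>f \<omega> = 0" "\<omega> \<and>\<^sub>f \<omega> \<and>\<^sub>f \<zeta> = 0"
  using wedge_self_odd[OF assms] wedge_assoc[of \<omega> \<omega> \<zeta>] by simp_all

lemmas t_swap = odd_swap[OF sg_tform sg_tform] and ut_swap = odd_swap[OF sg_tform sg_uform]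

lemma tform_wedge_flat_\<Omega>: "k < 4 \<Longrightarrow> tform k \<and>\<^sub>f flat_\<Omega> = 0"
proof -
  assume "k < 4"
  then consider "k = 0" | "k = 1" | "k = 2" | "k = 3" by linarith
  then show ?thesis
    by cases (simp_all add: flat_\<Omega>_def odd_square[OF sg_tform]
        t_swap[of 1 0] t_swap[of 2 0] t_swap[of 3 0] t_swap[of 2 1] t_swap[of 3 1] t_swap[of 3 2] del: One_nat_def)
qed

lemma flat_\<Omega>_nonzero: "flat_\<Omega> \<noteq> 0"
proof
  have [simp]: "zform 0 = 0" by (auto simp: zform_def fun_eq_iff)
  have ins_t: "ins (ebas (coord j)) (tform k) = zform (if j = k then 1 else 0)" if "j < 4" "k < 4" for j k
    using that by (simp add: ins_one_form[OF homogeneous_tform] tform_apply axis_def coord_eq_iff)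
  have "flat_\<Omega> [ebas (coord 0), ebas (coord 1), ebas (coord 2), ebas (coord 3)]
      = ins (ebas (coord 3)) (ins (ebas (coord 2)) (ins (ebas (coord 1)) (ins (ebas (coord 0)) flat_\<Omega>))) []"
    by (simp add: ins_def)
  also have "\<dots> = 1"
    by (simp add: flat_\<Omega>_def ins_wedge ins_t) (simp add: zform_def)
  finally show "flat_\<Omega> = 0 \<Longrightarrow> False" by simp
qed

text \<open>The wedge of \<open>tform k\<close> with \<open>flat_\<Omega>\<close> repeats a factor
  and is zero. Contracting it with a vector that annihilates \<open>flat_\<Omega>\<close> leaves
  \<open>tform k [v] *\<^sub>f flat_\<Omega>\<close>, which forces the coefficient to
  vanish.\<close>

lemma T01_flat_iff: "v \<in> T01 flat_\<Omega> \<longleftrightarrow> (\<forall>k<4. tform k [v] = 0)"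
proof
  assume "v \<in> T01 flat_\<Omega>"
  then have ins0: "ins v flat_\<Omega> = 0"
    by (auto simp: T01_def ins_def fun_eq_iff)
  show "\<forall>k<4. tform k [v] = 0"
  proof (intro allI impI)
    fix k :: nat assume "k < 4"
    then have "ins v (tform k \<and>\<^sub>f flat_\<Omega>) = 0"
      by (simp add: tform_wedge_flat_\<Omega>)
    then have "tform k [v] *\<^sub>f flat_\<Omega> = 0"
      by (simp add: ins_wedge ins0 ins_one_form[OF homogeneous_tform])
    then show "tform k [v] = 0"
      using flat_\<Omega>_nonzero by (auto simp: fscale_def fun_eq_iff)
  qed
next
  assume *: "\<forall>k<4. tform k [v] = 0"
  have "ins v (tform k) = 0" if "k < 4" for k
    using * that by (auto simp: ins_one_form[OF homogeneous_tform] zform_def fun_eq_iff)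
  then have "ins v flat_\<Omega> = 0"
    by (simp add: flat_\<Omega>_def ins_wedge)
  then show "v \<in> T01 flat_\<Omega>"
    by (auto simp: T01_def ins_def fun_eq_iff)
qed

lemma T10_flat_iff: "v \<in> T10 flat_\<Omega> \<longleftrightarrow> (\<forall>k<4. uform k [v] = 0)"
proof -
  have "tform k [cnjv v] = cnj (uform k [v])" for k
    by (simp add: tform_apply uform_apply cnjv_def)
  then show ?thesis
    by (simp add: T10_iff T01_flat_iff)
qed

text \<open>The standard complex structure, rotating the real coordinate direction into the
  imaginary one in each complex coordinate; \<open>inv_into\<close> recovers the number of an
  index.\<close>

definition rot :: "cvec \<Rightarrow> cvec" where
  "rot v = (\<chi> m. let k = inv_into {0..<8} coord m in if k < 4 then - v $ coord (k + 4) else v $ coord (k - 4))"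

lemma rot_nth: "k < 4 \<Longrightarrow> rot v $ coord k = - v $ coord (k + 4)" "k < 4 \<Longrightarrow> rot v $ coord (k + 4) = v $ coord k"
  using bij_betw_imp_inj_on[OF bij_coord] by (simp_all add: rot_def inv_into_f_f)

text \<open>The formula is the projector (1 - i I)/2 with I = \<open>rot\<close>. As an equivalence
  it gives existence and uniqueness at once, and so evaluates the definite description in
  \<open>p10\<close>.\<close>

lemma p10_flat_unique:
  "u \<in> T10 flat_\<Omega> \<and> v - u \<in> T01 flat_\<Omega> \<longleftrightarrow> u = (1 / 2) *s (v - \<i> *s rot v)"
proof
  assume *: "u \<in> T10 flat_\<Omega> \<and> v - u \<in> T01 flat_\<Omega>"
  show "u = (1 / 2) *s (v - \<i> *s rot v)"
  proof (rule coord_vec_eqI)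
    fix k :: nat assume k: "k < 4"
    have 1: "u $ coord k = \<i> * u $ coord (k + 4)"
      and 2: "v $ coord k - u $ coord k + \<i> * (v $ coord (k + 4) - u $ coord (k + 4)) = 0"
      using * k by (auto simp: T10_flat_iff T01_flat_iff tform_apply uform_apply)
    have "\<i> * u $ coord (k + 4) * 2 = v $ coord k + \<i> * v $ coord (k + 4)"
      using 2 unfolding 1 by (simp add: algebra_simps)
    then have 3: "\<i> * u $ coord (k + 4) = (v $ coord k + \<i> * v $ coord (k + 4)) / 2"
      by simp
    show "u $ coord k = ((1 / 2) *s (v - \<i> *s rot v)) $ coord k"
      using k unfolding 1 3 by (simp add: rot_nth field_simps)
    have "u $ coord (k + 4) = - \<i> * (\<i> * u $ coord (k + 4))" by simp
    also have "\<dots> = (v $ coord (k + 4) - \<i> * v $ coord k) / 2"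
      unfolding 3 by (simp add: algebra_simps)
    finally show "u $ coord (k + 4) = ((1 / 2) *s (v - \<i> *s rot v)) $ coord (k + 4)"
      using k by (simp add: rot_nth field_simps)
  qed
next
  assume *: "u = (1 / 2) *s (v - \<i> *s rot v)"
  have u: "u $ coord k = (v $ coord k + \<i> * v $ coord (k + 4)) / 2"
    "u $ coord (k + 4) = (v $ coord (k + 4) - \<i> * v $ coord k) / 2" if "k < 4" for k
    using that by (simp_all add: * rot_nth field_simps)
  show "u \<in> T10 flat_\<Omega> \<and> v - u \<in> T01 flat_\<Omega>"
    by (simp add: T10_flat_iff T01_flat_iff tform_apply uform_apply u) (simp add: field_simps)
qed

lemma determines_acs_flat: "determines_acs flat_\<Omega>"
  unfolding determines_acs_def p10_flat_unique by blast

lemma acs_flat: "acs flat_\<Omega> v = rot v"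
proof -
  have p10: "p10 flat_\<Omega> v = (1 / 2) *s (v - \<i> *s rot v)"
    unfolding p10_def p10_flat_unique by (rule the_eq_trivial)
  show ?thesis
    unfolding acs_def p01_def p10 by (simp add: vec_eq_iff field_simps)
qed

lemma flat_J_apply: "flat_J [v, w] = \<i> / 2 * (\<Sum>k<4. tform k [v] * uform k [w] - tform k [w] * uform k [v])"
proof -
  have "(tform k \<and>\<^sub>f uform k) [v, w] = tform k [v] * uform k [w] - tform k [w] * uform k [v]" for k
    using homogeneous_tform[of k]
    by (simp add: one_form_wedge_Cons[OF homogeneous_tform] ins_apply homogeneous_def)
  then show ?thesis
    by (simp add: flat_J_def fscale_def numeral_eq_Suc add_ac)
qed

lemma gmet_flat: "gmet flat_J flat_\<Omega> (cvec_of v) (cvec_of v)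
    = (\<Sum>k<4. of_real ((v $ coord k)\<^sup>2 + (v $ coord (k + 4))\<^sup>2))"
proof -
  let ?v = "cvec_of v"
  have "\<i> / 2 * (tform k [?v] * uform k [rot ?v] - tform k [rot ?v] * uform k [?v])
      = of_real ((v $ coord k)\<^sup>2 + (v $ coord (k + 4))\<^sup>2)" if "k < 4" for k
    using that by (simp add: tform_apply uform_apply rot_nth cvec_of_def power2_eq_square algebra_simps)
  then show ?thesis
    unfolding gmet_def acs_flat flat_J_apply sum_distrib_left by (intro sum.cong) auto
qed

lemma gmet_flat_pos:
  assumes "v \<noteq> 0"
  shows "0 < Re (gmet flat_J flat_\<Omega> (cvec_of v) (cvec_of v))"
proof -
  obtain k where k: "k < 4" "v $ coord k \<noteq> 0 \<or> v $ coord (k + 4) \<noteq> 0"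
    using assms coord_vec_eqI[of v 0] by auto
  have "0 < (\<Sum>k<4. (v $ coord k)\<^sup>2 + (v $ coord (k + 4))\<^sup>2)"
    by (rule sum_pos2[of _ k]) (use k in \<open>auto simp: sum_power2_gt_zero_iff\<close>)
  then show ?thesis
    by (simp add: gmet_flat del: of_real_add of_real_power)
qed

lemma conjf_flat_J: "conjf flat_J = flat_J"
proof -
  have "conjf (tform k \<and>\<^sub>f uform k) = - (tform k \<and>\<^sub>f uform k)" for k
    by (simp add: conjf_wedge conjf_tform conjf_uform ut_swap)
  then show ?thesis
    unfolding flat_J_def conjf_simps
    by (simp add: fscale_add_right fscale_diff_right)
qed

lemma flat_J_wedge_\<Omega>: "flat_J \<and>\<^sub>f flat_\<Omega> = 0"
proof -
  have "(tform k \<and>\<^sub>f uform k) \<and>\<^sub>f flat_\<Omega> = 0" if "k < 4" for k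
    using odd_swap(2)[OF sg_uform sg_tform, of k k flat_\<Omega>] that
    by (simp add: wedge_assoc tform_wedge_flat_\<Omega>)
  then show ?thesis
    by (simp add: flat_J_def wedge_add_left)
qed

text \<open>Multinomial theorem for commuting elements of square zero: only products of distinct
  elements survive, and the successive powers are 2!, 3! and 4! times the elementary symmetric
  polynomials.\<close>

lemma sum_of_four_even_squares_zero:
  assumes even: "sg a = a" "sg b = b" "sg c = c" "sg d = d"
    and sq: "a \<and>\<^sub>f a = 0" "b \<and>\<^sub>f b = 0" "c \<and>\<^sub>f c = 0" "d \<and>\<^sub>f d = 0"
  defines "s \<equiv> a + b + c + d"
  shows "s \<and>\<^sub>f s \<and>\<^sub>f s \<and>\<^sub>f s = 24 *\<^sub>f (a \<and>\<^sub>f b \<and>\<^sub>f c \<and>\<^sub>f d)"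
proof -
  have comm: "y \<and>\<^sub>f x = x \<and>\<^sub>f y" "y \<and>\<^sub>f x \<and>\<^sub>f z = x \<and>\<^sub>f y \<and>\<^sub>f z" if "sg x = x" "sg y = y" for x y z
  proof -
    show *: "y \<and>\<^sub>f x = x \<and>\<^sub>f y"
      using that by (intro wedge_commute_even) auto
    show "y \<and>\<^sub>f x \<and>\<^sub>f z = x \<and>\<^sub>f y \<and>\<^sub>f z"
      using arg_cong[OF *, of "\<lambda>w. w \<and>\<^sub>f z"] by (simp add: wedge_assoc)
  qed
  have sq': "x \<and>\<^sub>f x \<and>\<^sub>f z = 0" if "x \<and>\<^sub>f x = 0" for x z
    using that wedge_assoc[of x x z] by simp
  note rules = sq sq[THEN sq'] comm[OF even(1,2)] comm[OF even(1,3)] comm[OF even(1,4)]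
    comm[OF even(2,3)] comm[OF even(2,4)] comm[OF even(3,4)]
  have s2: "s \<and>\<^sub>f s = 2 *\<^sub>f (a \<and>\<^sub>f b + a \<and>\<^sub>f c + a \<and>\<^sub>f d + b \<and>\<^sub>f c + b \<and>\<^sub>f d + c \<and>\<^sub>f d)"
    unfolding s_def wedge_add_left wedge_add_right rules by (simp add: fun_eq_iff fscale_def algebra_simps)
  have s3: "s \<and>\<^sub>f s \<and>\<^sub>f s = 6 *\<^sub>f (a \<and>\<^sub>f b \<and>\<^sub>f c + a \<and>\<^sub>f b \<and>\<^sub>f d + a \<and>\<^sub>f c \<and>\<^sub>f d + b \<and>\<^sub>f c \<and>\<^sub>f d)"
    unfolding s2 wedge_scale unfolding s_def wedge_add_left wedge_add_right
    by (simp only: rules wedge_zero) (simp add: fun_eq_iff fscale_def algebra_simps)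
  show ?thesis
    unfolding s3 wedge_scale unfolding s_def wedge_add_left wedge_add_right
    by (simp only: rules wedge_zero) (simp add: fun_eq_iff fscale_def algebra_simps)
qed

lemma flat_volume:
  "(1 / 2 ^ 4) *\<^sub>f (flat_\<Omega> \<and>\<^sub>f conjf flat_\<Omega>) = (1 / fact 4) *\<^sub>f (flat_J \<and>\<^sub>f flat_J \<and>\<^sub>f flat_J \<and>\<^sub>f flat_J)"
proof -
  let ?\<sigma> = "\<lambda>k. tform k \<and>\<^sub>f uform k"
  let ?s = "?\<sigma> 0 + ?\<sigma> 1 + ?\<sigma> 2 + ?\<sigma> 3"
  have even: "sg (?\<sigma> k) = ?\<sigma> k" for k
    by (simp add: sg_wedge sg_tform sg_uform)
  have sq: "?\<sigma> k \<and>\<^sub>f ?\<sigma> k = 0" for k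
    by (simp add: wedge_assoc ut_swap odd_square[OF sg_tform])
  \<comment> \<open>1/16 is the fourth power of i/2.\<close>
  have "flat_J \<and>\<^sub>f flat_J \<and>\<^sub>f flat_J \<and>\<^sub>f flat_J = (1 / 16) *\<^sub>f (?s \<and>\<^sub>f ?s \<and>\<^sub>f ?s \<and>\<^sub>f ?s)"
    by (simp add: flat_J_def)
  also have "\<dots> = (24 / 16) *\<^sub>f (?\<sigma> 0 \<and>\<^sub>f ?\<sigma> 1 \<and>\<^sub>f ?\<sigma> 2 \<and>\<^sub>f ?\<sigma> 3)"
    unfolding sum_of_four_even_squares_zero[OF even even even even sq sq sq sq] by simp
  \<comment> \<open>Collecting the holomorphic factors in front takes 3 + 2 + 1 = 6 transpositions
    of one-forms, so no sign arises.\<close>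
  also have "?\<sigma> 0 \<and>\<^sub>f ?\<sigma> 1 \<and>\<^sub>f ?\<sigma> 2 \<and>\<^sub>f ?\<sigma> 3 = flat_\<Omega> \<and>\<^sub>f conjf flat_\<Omega>"
    by (simp add: flat_\<Omega>_def conjf_wedge conjf_tform wedge_assoc
        ut_swap[of 0 1] ut_swap[of 0 2] ut_swap[of 0 3] ut_swap[of 1 2] ut_swap[of 1 3] ut_swap[of 2 3] del: One_nat_def)
  finally show ?thesis
    by (simp add: fact_numeral)
qed

section \<open>Flat eight-space as a manifold with constant forms\<close>

definition flat_atlas :: "(real^8) chart set" where
  "flat_atlas = {(UNIV, id)}"

lemma crange_flat [simp]: "crange (UNIV, id) = UNIV"
  by (simp add: crange_def)

lemma cinv_flat [simp]: "cinv (UNIV, id) = id"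
  by (auto simp: cinv_def fun_eq_iff)

lemma lpts_flat: "lpts flat_atlas = {(UNIV, id)} \<times> UNIV"
  by (auto simp: lpts_def flat_atlas_def)

lemma second_countable_euclidean: "second_countable (euclidean :: 'b::second_countable_topology topology)"
proof -
  obtain \<B> :: "'b set set" where B: "countable \<B>" "topological_basis \<B>"
    using ex_countable_basis by blast
  then have "\<forall>V\<in>\<B>. openin euclidean V"
    by (simp add: topological_basis_open)
  moreover have "\<forall>U x. openin euclidean U \<and> x \<in> U \<longrightarrow> (\<exists>V\<in>\<B>. x \<in> V \<and> V \<subseteq> U)"
    using topological_basisE[OF B(2)] by (metis open_openin)
  ultimately show ?thesis
    unfolding second_countable_def using B(1) by blast
qed

lemma smooth_on_id: "smooth_on UNIV id"
proof -
  have "pderiv_at m id = (\<lambda>_. axis m 1)" for m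
    by (rule ext, subst pderiv_atI[OF has_derivative_id]) simp
  then have "Ck_on k UNIV id" for k
    by (cases k) simp_all
  then show ?thesis
    by (simp add: smooth_on_def)
qed

lemma manifold8_flat: "manifold8 euclidean flat_atlas"
  unfolding manifold8_def flat_atlas_def
  by (simp add: second_countable_euclidean transition_def smooth_on_id)

lemma push_id: "push id = id"
  by (rule ext) (simp add: push_def cvec_of_def vec_eq_iff complex_eq_iff)

lemma dforms_flat:
  assumes "is_form k \<omega>"
  shows "(\<lambda>_. \<omega>) \<in> dforms flat_atlas k"
proof -
  have "frechet_derivative id (at x) = id" for x :: "real^8"
    by (metis frechet_derivative_at has_derivative_id id_def)
  then show ?thesis
    using assms by (simp add: dforms_def flat_atlas_def smooth_on_const transition_def push_id)
qed

lemma is_form_zero: "is_form k 0"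
  by (simp add: is_form_def)

lemma ext_d_const: "ext_d (\<lambda>_. \<omega>) z = 0"
  by (simp add: ext_d_def fun_eq_iff)

lemma smooth_fun_const: "smooth_fun \<A> (\<lambda>_. c)"
  by (simp add: smooth_fun_def comp_def smooth_on_const)

lemma su4_structure_flat: "su4_structure flat_atlas (\<lambda>_. flat_J) (\<lambda>_. flat_\<Omega>) (\<lambda>_. 1)"
proof -
  have "decomposable4 flat_\<Omega>"
    unfolding decomposable4_def flat_\<Omega>_def using is_form_tform by blast
  then show ?thesis
    by (simp add: su4_structure_def real_dforms_def dforms_flat is_form_flat_J is_form_flat_\<Omega> conjf_flat_J
        smooth_fun_const flat_\<Omega>_nonzero determines_acs_flat gmet_flat_pos flat_J_wedge_\<Omega> flat_volume[simplified])
qed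

lemma del0_zero: "del0 \<Omega> (\<lambda>_. 0) z = 0"
  by (simp add: del_def ext_d_zero_form dfun_def type_part_def fun_eq_iff)

lemma conjf_dx: "conjf (dx m) = dx m"
  by (auto simp: conjf_def dx_def cnjv_def fun_eq_iff length_Suc_conv)

text \<open>On flat space with vanishing warp factor, dilaton and angle, the LTY equations do not see the
  RR flux, whereas the supersymmetric system forces \<open>F\<^sub>1 = 0\<close>.\<close>

lemma lty_2B_not_complex_susy:
  defines "zf \<equiv> (\<lambda>_ :: real^8. 0 :: real)" and "uf \<equiv> (\<lambda>_ :: real^8. 1 :: real)"
    and "ZF \<equiv> (\<lambda>_ :: (real^8) lpt. 0 :: pform)" and "F\<^sub>1 \<equiv> (\<lambda>_ :: (real^8) lpt. dx 1)"
    and "J \<equiv> (\<lambda>_ :: (real^8) lpt. flat_J)" and "\<Omega> \<equiv> (\<lambda>_ :: (real^8) lpt. flat_\<Omega>)"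
  shows "configuration flat_atlas J \<Omega> zf zf zf uf ZF ZF F\<^sub>1 ZF ZF ZF"
    and "lty_2B_system flat_atlas (J_B zf zf J) (Omega_B zf zf zf \<Omega>) (K_B zf zf)
      (rho_LTY (J_B zf zf J) (Omega_B zf zf zf \<Omega>) (K_B zf zf))"
    and "\<not> complex_susy_system flat_atlas J \<Omega> zf zf zf uf ZF ZF F\<^sub>1 ZF ZF ZF"
proof -
  have "ZF \<in> real_dforms flat_atlas k" for k
    unfolding ZF_def real_dforms_def using dforms_flat[OF is_form_zero] by (simp add: conjf_simps)
  moreover have "F\<^sub>1 \<in> real_dforms flat_atlas 1"
    unfolding F\<^sub>1_def real_dforms_def using dforms_flat[OF is_form_dx] by (simp add: conjf_dx)
  ultimately show "configuration flat_atlas J \<Omega> zf zf zf uf ZF ZF F\<^sub>1 ZF ZF ZF"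
    unfolding configuration_def zf_def uf_def J_def \<Omega>_def by (simp add: su4_structure_flat smooth_fun_const)
  have "J_B zf zf J = J" "Omega_B zf zf zf \<Omega> = \<Omega>" "K_B zf zf = (\<lambda>_. 1)"
    by (simp_all add: J_B_def Omega_B_def K_B_def zf_def J_def \<Omega>_def fun_eq_iff)
  then show "lty_2B_system flat_atlas (J_B zf zf J) (Omega_B zf zf zf \<Omega>) (K_B zf zf)
      (rho_LTY (J_B zf zf J) (Omega_B zf zf zf \<Omega>) (K_B zf zf))"
    by (simp add: lty_2B_system_def J_def \<Omega>_def su4_structure_flat ext_d_const)
  show "\<not> complex_susy_system flat_atlas J \<Omega> zf zf zf uf ZF ZF F\<^sub>1 ZF ZF ZF"
  proof
    define z :: "(real^8) lpt" where "z = ((UNIV, id), 0)"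
    have z: "z \<in> lpts flat_atlas"
      by (simp add: z_def lpts_flat)
    assume "complex_susy_system flat_atlas J \<Omega> zf zf zf uf ZF ZF F\<^sub>1 ZF ZF ZF"
    then obtain f\<^sub>1 where "one_form_components flat_atlas \<Omega> F\<^sub>1 f\<^sub>1"
      and "\<forall>z\<in>lpts flat_atlas. f\<^sub>1 z = (- \<i>) *\<^sub>f del0 \<Omega> (\<lambda>y. of_real (exp (- zf y) * sin (zf y))) z"
      unfolding complex_susy_system_def Let_def by blast
    \<comment> \<open>At vanishing angle the function inside \<open>del0\<close> is identically
      \<open>exp 0 * sin 0 = 0\<close>. The chosen flux \<open>dx 1\<close> takes the value 1 on
      \<open>ebas 1\<close>, which is the contradiction.\<close>
    then have "F\<^sub>1 z = plus_cc (f\<^sub>1 z)" "f\<^sub>1 z = 0"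
      using z by (auto simp: one_form_components_def zf_def del0_zero)
    then have "dx 1 [ebas 1] = 0"
      by (simp add: F\<^sub>1_def plus_cc_def conjf_simps)
    then show False
      by (simp add: dx_def)
  qed
qed

theorem mainTheorem3:
  shows "(\<forall>(X :: 'a topology) \<A> J \<Omega> A \<phi> \<theta> \<alpha> H\<^sub>1 H\<^sub>3 F\<^sub>1 F\<^sub>3 F\<^sub>5 F\<^sub>7.
            manifold8 X \<A> \<and>
            configuration \<A> J \<Omega> A \<phi> \<theta> \<alpha> H\<^sub>1 H\<^sub>3 F\<^sub>1 F\<^sub>3 F\<^sub>5 F\<^sub>7 \<and>
            complex_susy_system \<A> J \<Omega> A \<phi> \<theta> \<alpha> H\<^sub>1 H\<^sub>3 F\<^sub>1 F\<^sub>3 F\<^sub>5 F\<^sub>7 \<longrightarrow>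
            lty_2B_system \<A> (J_B A \<phi> J) (Omega_B A \<phi> \<theta> \<Omega>) (K_B A \<phi>)
              (rho_LTY (J_B A \<phi> J) (Omega_B A \<phi> \<theta> \<Omega>) (K_B A \<phi>)))
       \<and> (\<exists>(X :: (real^8) topology) \<A> J \<Omega> A \<phi> \<theta> \<alpha> H\<^sub>1 H\<^sub>3 F\<^sub>1 F\<^sub>3 F\<^sub>5 F\<^sub>7.
            manifold8 X \<A> \<and>
            configuration \<A> J \<Omega> A \<phi> \<theta> \<alpha> H\<^sub>1 H\<^sub>3 F\<^sub>1 F\<^sub>3 F\<^sub>5 F\<^sub>7 \<and>
            lty_2B_system \<A> (J_B A \<phi> J) (Omega_B A \<phi> \<theta> \<Omega>) (K_B A \<phi>)
              (rho_LTY (J_B A \<phi> J) (Omega_B A \<phi> \<theta> \<Omega>) (K_B A \<phi>)) \<and>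
            \<not> complex_susy_system \<A> J \<Omega> A \<phi> \<theta> \<alpha> H\<^sub>1 H\<^sub>3 F\<^sub>1 F\<^sub>3 F\<^sub>5 F\<^sub>7)"
proof
  show "\<forall>(X :: 'a topology) \<A> J \<Omega> A \<phi> \<theta> \<alpha> H\<^sub>1 H\<^sub>3 F\<^sub>1 F\<^sub>3 F\<^sub>5 F\<^sub>7.
            manifold8 X \<A> \<and>
            configuration \<A> J \<Omega> A \<phi> \<theta> \<alpha> H\<^sub>1 H\<^sub>3 F\<^sub>1 F\<^sub>3 F\<^sub>5 F\<^sub>7 \<and>
            complex_susy_system \<A> J \<Omega> A \<phi> \<theta> \<alpha> H\<^sub>1 H\<^sub>3 F\<^sub>1 F\<^sub>3 F\<^sub>5 F\<^sub>7 \<longrightarrow>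
            lty_2B_system \<A> (J_B A \<phi> J) (Omega_B A \<phi> \<theta> \<Omega>) (K_B A \<phi>)
              (rho_LTY (J_B A \<phi> J) (Omega_B A \<phi> \<theta> \<Omega>) (K_B A \<phi>))"
    by (blast intro: complex_susy_imp_lty_2B)
next
  show "\<exists>(X :: (real^8) topology) \<A> J \<Omega> A \<phi> \<theta> \<alpha> H\<^sub>1 H\<^sub>3 F\<^sub>1 F\<^sub>3 F\<^sub>5 F\<^sub>7.
            manifold8 X \<A> \<and>
            configuration \<A> J \<Omega> A \<phi> \<theta> \<alpha> H\<^sub>1 H\<^sub>3 F\<^sub>1 F\<^sub>3 F\<^sub>5 F\<^sub>7 \<and>
            lty_2B_system \<A> (J_B A \<phi> J) (Omega_B A \<phi> \<theta> \<Omega>) (K_B A \<phi>)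
              (rho_LTY (J_B A \<phi> J) (Omega_B A \<phi> \<theta> \<Omega>) (K_B A \<phi>)) \<and>
            \<not> complex_susy_system \<A> J \<Omega> A \<phi> \<theta> \<alpha> H\<^sub>1 H\<^sub>3 F\<^sub>1 F\<^sub>3 F\<^sub>5 F\<^sub>7"
    by (intro exI, rule conjI[OF manifold8_flat conjI[OF lty_2B_not_complex_susy(1)
        conjI[OF lty_2B_not_complex_susy(2,3)]]])
qed

end
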